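(* Let $p$ be a prime and let $x\ge 4$ be an integer. The number of isomorphism classes of powerfully nilpotent $p$-groups of rank $2$ and order $p^{x}$ is $$\begin{array}{ll} \dfrac{x^{3}+12x^{2}-60x+216}{72} & \mbox{if } x\equiv 0 \pmod 6,\\[2mm] \dfrac{x^{3}+12x^{2}-69x+200}{72} & \mbox{if } x\equiv 1 \pmod 6,\\[2mm] \dfrac{x^{3}+12x^{2}-60x+208}{72} & \mbox{if } x\equiv 2 \pmod 6,\\[2mm] \dfrac{x^{3}+12x^{2}-69x+216}{72} & \mbox{if } x\equiv 3 \pmod 6,\\[2mm] \dfrac{x^{3}+12x^{2}-60x+200}{72} & \mbox{if } x\equiv 4 \pmod 6,\\[2mm] \dfrac{x^{3}+12x^{2}-69x+208}{72} & \mbox{if } x\equiv 5 \pmod 6. \end{array}$$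
   Context: All $p$-groups are finite. The rank of a $p$-group considered here is its minimal number of generators (so rank $2$ means generated by two elements but not cyclic; abelian groups of rank $2$ are included in the count). For a group $H$ and a positive integer $k$, $H^{k}$ denotes the subgroup generated by all $k$-th powers of elements of $H$. A finite $p$-group $G$ is powerful if $[G,G]\le G^{p}$ when $p$ is odd, and $[G,G]\le G^{4}$ when $p=2$. A powerful $p$-group $G$ is powerfully nilpotent if it has an ascending chain of subgroups $\{1\}=H_{0}\le H_{1}\le\cdots\le H_{n}=G$ such that $[H_{i},G]\le H_{i-1}^{p}$ for $i=1,\ldots,n$. *)

theory Defs
  imports "HOL-Algebra.Algebra" "HOL-Computational_Algebra.Primes" Complex_Main
begin

definition power_subgroup :: "('a, 'b) monoid_scheme \<Rightarrow> 'a set \<Rightarrow> nat \<Rightarrow> 'a set" where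
  "power_subgroup G H k = generate G ((\<lambda>h. h [^]\<^bsub>G\<^esub> k) ` H)"

text \<open>The subgroup \<open>[H, K]\<close>. The library only has the case \<open>H = K\<close> (\<^const>\<open>derived\<close>), whose
  convention for the commutator of two elements is followed here.\<close>

definition commutator_subgroup :: "('a, 'b) monoid_scheme \<Rightarrow> 'a set \<Rightarrow> 'a set \<Rightarrow> 'a set" where
  "commutator_subgroup G H K =
     generate G (\<Union>h\<in>H. \<Union>k\<in>K. {h \<otimes>\<^bsub>G\<^esub> k \<otimes>\<^bsub>G\<^esub> (inv\<^bsub>G\<^esub> h) \<otimes>\<^bsub>G\<^esub> (inv\<^bsub>G\<^esub> k)})"

lemma commutator_subgroup_self: "commutator_subgroup G H H = derived G H"
  by (simp add: commutator_subgroup_def derived_def)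

text \<open>Finiteness is implied by the order condition: \<^const>\<open>order\<close> is \<open>0\<close> on infinite carriers.\<close>

definition finite_p_group :: "nat \<Rightarrow> ('a, 'b) monoid_scheme \<Rightarrow> bool" where
  "finite_p_group p G \<longleftrightarrow> Factorial_Ring.prime p \<and> group G \<and> (\<exists>k. order G = p ^ k)"

definition powerful :: "nat \<Rightarrow> ('a, 'b) monoid_scheme \<Rightarrow> bool" where
  "powerful p G \<longleftrightarrow> finite_p_group p G \<and>
     commutator_subgroup G (carrier G) (carrier G)
       \<subseteq> power_subgroup G (carrier G) (if p = 2 then 4 else p)"

definition powerfully_nilpotent :: "nat \<Rightarrow> ('a, 'b) monoid_scheme \<Rightarrow> bool" where
  "powerfully_nilpotent p G \<longleftrightarrow> powerful p G \<and>
     (\<exists>(n::nat) H. H 0 = {\<one>\<^bsub>G\<^esub>} \<and> H n = carrier G \<and>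
        (\<forall>i\<le>n. subgroup (H i) G) \<and>
        (\<forall>i<n. H i \<subseteq> H (Suc i)) \<and>
        (\<forall>i\<in>{1..n}. commutator_subgroup G (H i) (carrier G) \<subseteq> power_subgroup G (H (i - 1)) p))"

text \<open>The minimal number of generators; only meaningful for finitely generated groups.\<close>

definition group_rank :: "('a, 'b) monoid_scheme \<Rightarrow> nat" where
  "group_rank G = (LEAST n. \<exists>S. S \<subseteq> carrier G \<and> finite S \<and> card S = n \<and> generate G S = carrier G)"

text \<open>Every finite group is isomorphic to one whose carrier is a set of natural numbers, so the
  isomorphism classes of finite groups are represented by structures of type \<^typ>\<open>nat monoid\<close>.\<close>

definition pn_rank2_groups :: "nat \<Rightarrow> nat \<Rightarrow> nat monoid set" where
  "pn_rank2_groups p x = {G. powerfully_nilpotent p G \<and> group_rank G = 2 \<and> order G = p ^ x}"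

definition iso_classes :: "'a monoid set \<Rightarrow> 'a monoid set set" where
  "iso_classes \<G> = \<G> // {(G, H). G \<in> \<G> \<and> H \<in> \<G> \<and> G \<cong> H}"

end

theory Submission
  imports Defs "HOL-Number_Theory.Cong" "HOL-Library.Nat_Bijection"
begin

text \<open>
  A nonabelian powerfully nilpotent group \<open>G\<close> generated by \<open>x, y\<close> has cyclic derived subgroup,
  generated by \<open>c = [x, y]\<close>. In \<open>G / \<langle>c\<^sup>p\<rangle>\<close>, where the commutator is bilinear with values in a
  central subgroup of order \<open>p\<close>, one picks a root \<open>a\<close> of \<open>c\<close> of largest possible degree \<open>p\<^sup>k\<close>; maximality
  of \<open>k\<close> makes \<open>a\<close> part of a generating pair \<open>a, b\<close>, and the powerfully central chain (powerfulness
  itself if \<open>p = 2\<close>) forces \<open>k \<ge> 2\<close>.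
  Hence \<open>G\<close> is metacyclic, and after changing generators
  \<open>b a = a ^ (1 + p ^ k) b\<close>, \<open>a ^ (p ^ m) = 1\<close>, \<open>b ^ (p ^ n) = a ^ (p ^ l)\<close> with \<open>m + n = x\<close>, where either
  \<open>l = m\<close> (split) or \<open>k < l < min m n\<close> and \<open>m \<le> l + k\<close>. The parameters are recovered from the
  order of \<open>G'\<close> and the exponents of \<open>G\<close> and \<open>G/G'\<close>, so that it remains to count them.
\<close>

section \<open>Arithmetic of the multiplier\<close>

text \<open>Powers of products are controllable only when the commutators involved are nearly
  central: \<open>(u v)^q = u^q v^q z^(q (q - 1) / 2)\<close>. For \<open>z^p = 1\<close> the
  correction dies when \<open>p\<close> divides \<open>q (q - 1) / 2\<close>, which holds for odd
  \<open>q = p\<close> and for \<open>q = 4\<close>, \<open>p = 2\<close>; hence the detour through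
  quotients. That \<open>c\<close> is central modulo \<open><c^p>\<close> is itself part of an
  induction down the chain: \<open>G'\<close> lies in \<open>H_i <c>\<close> and
  \<open>[G, c]\<close> lies in \<open>H_i <c^p>\<close>. This is empty for \<open>H_i = G\<close>
  and is the wanted statement for \<open>H_i = 1\<close>. Maximality of \<open>k\<close> is used
  twice. A root of \<open>c\<close> in the Frattini subgroup could be traded for one of degree
  \<open>p^(k+1)\<close>. In the normal form, \<open>l <= k\<close> with \<open>l < n\<close> would
  make \<open>b^(p^(n+k-l))\<close> generate \<open>G'\<close>, again a deeper root. For odd
  \<open>p\<close>, \<open>k = 1\<close> fails by descent: a \<open>p\<close>-th root of
  \<open>c\<close> in \<open>H_(i+1)\<close> has a commutator that generates \<open><c>\<close> and
  lies in \<open>H_i^p\<close>, so \<open>c\<close> has a \<open>p\<close>-th root in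
  \<open>H_i\<close>, down to \<open>H_0 = 1\<close>. The bounds \<open>m <= l + k\<close> and
  \<open>m <= n + k\<close> are the consistency conditions of a cyclic extension: \<open>b\<close>
  fixes \<open>b^(p^n) = a^(p^l)\<close>, and \<open>b^(p^n)\<close> acts trivially on
  \<open>a\<close>.\<close>

lemma sum_lessThan_add:
  fixes f :: "nat \<Rightarrow> 'a::comm_monoid_add"
  shows "(\<Sum>t<m + n. f t) = (\<Sum>t<m. f t) + (\<Sum>t<n. f (m + t))"
  by (induction n) (simp_all add: add.assoc)

lemma sum_lessThan_mult_nat:
  fixes f :: "nat \<Rightarrow> 'a::comm_monoid_add"
  shows "(\<Sum>t<m * n. f t) = (\<Sum>u<n. \<Sum>t<m. f (u * m + t))"
proof (induction n)
  case (Suc n)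
  have "(\<Sum>t<m * Suc n. f t) = (\<Sum>t<m * n + m. f t)" by (simp add: algebra_simps)
  then show ?case using Suc by (simp add: sum_lessThan_add mult.commute)
qed simp

lemma geometric_sum_mult:
  fixes r :: int
  shows "(\<Sum>u<m * n. r ^ u) = (\<Sum>u<n. r ^ (u * m)) * (\<Sum>t<m. r ^ t)"
  unfolding sum_lessThan_mult_nat by (simp add: power_add sum_product)

lemma cong_one_power_int:
  fixes r d :: int
  assumes "d dvd r - 1"
  shows "d dvd r ^ n - 1"
  using assms by (metis dvd_mult2 power_diff_1_eq)

text \<open>A sum of \<open>p^(j+1)\<close> terms factors into a sum of \<open>p\<close> terms, each
  1 modulo \<open>p\<close>, times the sum of \<open>p^j\<close> terms. So each step gains a factor
  \<open>p\<close>.\<close>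

lemma dvd_geometric_sum:
  fixes r :: int
  assumes "int p dvd r - 1"
  shows "int (p ^ j) dvd (\<Sum>u<p ^ j. r ^ u)"
proof (induction j)
  case (Suc j)
  have "(\<Sum>u<p ^ Suc j. r ^ u) = (\<Sum>u<p. r ^ (u * p ^ j)) * (\<Sum>t<p ^ j. r ^ t)"
    by (simp only: power_Suc2 geometric_sum_mult)
  moreover have "int p dvd (\<Sum>u<p. r ^ (u * p ^ j))"
  proof -
    have "int p dvd (\<Sum>u<p. r ^ (u * p ^ j) - 1)"
      by (intro dvd_sum cong_one_power_int assms)
    then have "int p dvd (\<Sum>u<p. r ^ (u * p ^ j)) - int p" by (simp add: sum_subtractf)
    then show ?thesis by (metis diff_add_cancel dvd_add dvd_refl)
  qed
  ultimately show ?case using Suc by (simp add: mult_dvd_mono)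
qed simp

text \<open>The same factorisation; now the \<open>p\<close> summands are 1 modulo
  \<open>p^2\<close>, so their sum is \<open>p\<close> times a number congruent to 1 modulo
  \<open>p\<close>. Congruence modulo \<open>p\<close> would not do for \<open>p = 2\<close>:
  \<open>1 + 3 = 4\<close>.\<close>

lemma geometric_sum_exact:
  fixes r :: int
  assumes "int (p ^ 2) dvd r - 1"
  shows "\<exists>z. (\<Sum>u<p ^ j. r ^ u) = int (p ^ j) * (1 + int p * z)"
proof (induction j)
  case 0
  show ?case by (rule exI[of _ 0]) simp
next
  case (Suc j)
  then obtain z where z: "(\<Sum>u<p ^ j. r ^ u) = int (p ^ j) * (1 + int p * z)" by blast
  have eq: "(\<Sum>u<p ^ Suc j. r ^ u) = (\<Sum>u<p. r ^ (u * p ^ j)) * (\<Sum>t<p ^ j. r ^ t)"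
    by (simp only: power_Suc2 geometric_sum_mult)
  have "int (p ^ 2) dvd (\<Sum>u<p. r ^ (u * p ^ j) - 1)"
    by (intro dvd_sum cong_one_power_int assms)
  then have "int (p ^ 2) dvd (\<Sum>u<p. r ^ (u * p ^ j)) - int p" by (simp add: sum_subtractf)
  then obtain y where "(\<Sum>u<p. r ^ (u * p ^ j)) - int p = int (p ^ 2) * y" by blast
  then have "(\<Sum>u<p. r ^ (u * p ^ j)) = int p * (1 + int p * y)"
    by (simp add: power2_eq_square algebra_simps)
  then have "(\<Sum>u<p ^ Suc j. r ^ u) = int (p ^ Suc j) * (1 + int p * (y + z + int p * y * z))"
    unfolding eq z by (simp add: algebra_simps)
  then show ?case by blast
qed

text \<open>Multiply the exact geometric sum by \<open>r - 1 = e p^k\<close>. Raising to the power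
  \<open>p^j\<close> shifts the \<open>p\<close>-adic distance from 1 by exactly
  \<open>j\<close>.\<close>

lemma power_prime_power_exact:
  fixes e :: int
  assumes "k \<ge> 2"
  shows "\<exists>z. (1 + e * int p ^ k) ^ (p ^ j) = 1 + e * int p ^ (k + j) * (1 + int p * z)"
proof -
  have "int (p ^ 2) dvd (1 + e * int p ^ k) - 1"
    using assms by (simp add: le_imp_power_dvd)
  from geometric_sum_exact[OF this] obtain z
    where z: "(\<Sum>u<p ^ j. (1 + e * int p ^ k) ^ u) = int (p ^ j) * (1 + int p * z)" by blast
  have "(1 + e * int p ^ k) ^ (p ^ j) - 1 = e * int p ^ k * (int (p ^ j) * (1 + int p * z))"
    unfolding power_diff_1_eq z by simp
  then show ?thesis by (intro exI[of _ z]) (simp add: power_add algebra_simps)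
qed

text \<open>The unknown is a natural number because it will serve as an exponent of group
  elements.\<close>

lemma coprime_solve:
  fixes u v :: int
  assumes "Factorial_Ring.prime p" "\<not> int p dvd u"
  shows "\<exists>j::nat. int (p ^ M) dvd v + int j * u"
proof -
  have "coprime (int p) u"
    using assms by (intro prime_imp_coprime) auto
  then have "coprime u (int (p ^ M))"
    by (simp add: coprime_commute)
  then obtain w where w: "[u * w = 1] (mod int (p ^ M))"
    using cong_solve_coprime_int by blast
  have pos: "int (p ^ M) > 0" using assms(1) by (simp add: prime_gt_0_nat)
  define j where "j = nat ((- v * w) mod int (p ^ M))"
  have j: "int j = (- v * w) mod int (p ^ M)"
    unfolding j_def using pos by (simp only: pos_mod_sign int_nat_eq if_True)
  have "[v + int j * u = v + (- v * w) * u] (mod int (p ^ M))"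
    unfolding j by (intro cong_add cong_mult cong_refl cong_mod_leftI)
  also have "v + (- v * w) * u = v - v * (u * w)" by (simp add: algebra_simps)
  also have "[v - v * (u * w) = v - v * 1] (mod int (p ^ M))"
    by (intro cong_diff cong_mult cong_refl w)
  finally have "[v + int j * u = 0] (mod int (p ^ M))" by simp
  then show ?thesis unfolding cong_0_iff by blast
qed

text \<open>Binomial expansion to first order: the remaining terms carry \<open>p^(2 k)\<close>, and
  \<open>2 k >= k + 1\<close>.\<close>

lemma dvd_power_mult_diff:
  fixes e :: int
  assumes "p > 0" "k \<ge> 1"
  shows "int p ^ (k + 1) dvd (1 + e * int p ^ k) ^ N - (1 + int N * e * int p ^ k)"
proof (induction N)
  case (Suc N)
  then obtain t where "(1 + e * int p ^ k) ^ N - (1 + int N * e * int p ^ k) = int p ^ (k + 1) * t"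
    by blast
  then have t: "(1 + e * int p ^ k) ^ N = 1 + int N * e * int p ^ k + int p ^ (k + 1) * t"
    by simp
  have "int p ^ (k + 1) dvd int p ^ (2 * k)" using assms by (intro le_imp_power_dvd) auto
  then obtain s where s: "int p ^ k * int p ^ k = int p ^ (k + 1) * s"
    by (metis dvdE mult_2 power_add)
  have "(1 + e * int p ^ k) ^ Suc N - (1 + int (Suc N) * e * int p ^ k)
      = int N * e * e * (int p ^ k * int p ^ k) + int p ^ (k + 1) * t * (1 + e * int p ^ k)"
    by (simp add: t algebra_simps)
  also have "\<dots> = int p ^ (k + 1) * (int N * e * e * s + t * (1 + e * int p ^ k))"
    unfolding s by (simp add: algebra_simps)
  finally show ?case by simp
qed simp

text \<open>Serves to replace \<open>b\<close> by \<open>b^i\<close> so that the multiplier becomes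
  exactly \<open>1 + p^k\<close>. The exponent is built digit by digit: adding \<open>p^j y\<close>
  to \<open>i\<close> changes the power first at the digit \<open>p^(k+j)\<close>, and there
  linearly in \<open>y\<close>.\<close>

lemma normalize_multiplier:
  fixes e :: int
  assumes p: "Factorial_Ring.prime p" and k: "k \<ge> 2" and e: "\<not> int p dvd e"
  shows "\<exists>i::nat. \<not> p dvd i \<and> int p ^ M dvd (1 + e * int p ^ k) ^ i - (1 + int p ^ k)"
proof -
  have p0: "p > 0" using p prime_gt_0_nat by blast
  have main: "\<exists>i::nat. int p ^ (k + j) dvd (1 + e * int p ^ k) ^ i - (1 + int p ^ k)" for j
  proof (induction j)
    case 0
    show ?case by (rule exI[of _ 0]) simp
  next
    case (Suc j)
    then obtain i t where "(1 + e * int p ^ k) ^ i - (1 + int p ^ k) = int p ^ (k + j) * t"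
      by blast
    then have t: "(1 + e * int p ^ k) ^ i = 1 + int p ^ k + int p ^ (k + j) * t"
      by simp
    \<comment> \<open>\<open>t\<close> is the error at the digit \<open>p^(k+j)\<close>;
      \<open>y\<close> is chosen so that the first-order change \<open>y e\<close> cancels it modulo
      \<open>p\<close>.\<close>
    obtain y where y: "int (p ^ 1) dvd t + int y * e" using coprime_solve[OF p e, of 1 t] by blast
    define E where "E = (1 + e * int p ^ k) ^ (p ^ j)"
    obtain z where z: "E = 1 + e * int p ^ (k + j) * (1 + int p * z)"
      using power_prime_power_exact[OF k] unfolding E_def by blast
    have E': "E = 1 + (e * (1 + int p * z)) * int p ^ (k + j)" by (simp add: z)
    have "int p ^ (k + j + 1) dvd E ^ y - (1 + int y * (e * (1 + int p * z)) * int p ^ (k + j))"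
      unfolding E' using p0 k by (intro dvd_power_mult_diff) auto
    then obtain w where "E ^ y - (1 + int y * (e * (1 + int p * z)) * int p ^ (k + j)) = int p ^ (k + j + 1) * w"
      by blast
    then have w: "E ^ y = 1 + int y * (e * (1 + int p * z)) * int p ^ (k + j) + int p ^ (k + j + 1) * w"
      by simp
    obtain y' where y': "t + int y * e = int p * y'" using y by auto
    obtain P where P: "int p ^ k = int p * P" using k by (cases k) auto
    obtain Q where Q: "int p ^ (k + j) = int p * Q" using P by (metis power_add mult.assoc)
    define B where "B = int p ^ (k + j)"
    have BQ: "B = int p * Q" using Q by (simp add: B_def)
    have w': "E ^ y = 1 + int y * (e * (1 + int p * z)) * B + B * int p * w"
      using w by (simp add: B_def)
    have "(1 + e * int p ^ k) ^ (i + p ^ j * y) - (1 + int p ^ k)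
       = (1 + int p ^ k + B * t) * E ^ y - (1 + int p ^ k)"
      by (simp add: power_add[of _ i] power_mult t flip: E_def B_def)
    also have "\<dots> = B * (t + int y * e) + B * (int y * e * int p * z + int p * w
         + (int p ^ k + B * t) * (int y * (e * (1 + int p * z)) + int p * w))"
      unfolding w' by (simp add: algebra_simps)
    also have "int p ^ k + B * t = int p * (P + Q * t)"
      unfolding P BQ by (simp only: algebra_simps)
    also have "B * (t + int y * e) + B * (int y * e * int p * z + int p * w
         + int p * (P + Q * t) * (int y * (e * (1 + int p * z)) + int p * w))
       = B * int p * (y' + int y * e * z + w
         + (P + Q * t) * (int y * (e * (1 + int p * z)) + int p * w))"
      unfolding y' by (simp only: algebra_simps)
    finally have "(1 + e * int p ^ k) ^ (i + p ^ j * y) - (1 + int p ^ k) = B * int p * (y' + int y * e * z + w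
         + (P + Q * t) * (int y * (e * (1 + int p * z)) + int p * w))" .
    then have "int p ^ (k + Suc j) dvd (1 + e * int p ^ k) ^ (i + p ^ j * y) - (1 + int p ^ k)"
      by (simp add: B_def)
    then show ?case by blast
  qed
  \<comment> \<open>Going at least one digit beyond \<open>p^k\<close>, whatever \<open>M\<close>
    is, gives \<open>i e = 1\<close> modulo \<open>p\<close> and hence that \<open>p\<close> does
    not divide \<open>i\<close>.\<close>
  obtain i where i: "int p ^ (k + Suc M) dvd (1 + e * int p ^ k) ^ i - (1 + int p ^ k)" using main by blast
  have "\<not> p dvd i"
  proof
    assume "p dvd i"
    then obtain i' where i': "i = p * i'" by blast
    have "int p ^ (k + 1) dvd (1 + e * int p ^ k) ^ i - (1 + int p ^ k)"
      by (rule dvd_trans[OF _ i]) (simp add: le_imp_power_dvd)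
    moreover have "int p ^ (k + 1) dvd (1 + e * int p ^ k) ^ i - (1 + int i * e * int p ^ k)"
      using p0 k by (intro dvd_power_mult_diff) auto
    ultimately have "int p ^ (k + 1) dvd ((1 + e * int p ^ k) ^ i - (1 + int p ^ k))
        - ((1 + e * int p ^ k) ^ i - (1 + int i * e * int p ^ k))"
      by (rule dvd_diff)
    then have "int p ^ k * int p dvd int p ^ k * (int i * e - 1)" by (simp add: algebra_simps)
    then have 1: "int p dvd int i * e - 1" using p0 by simp
    have "int p dvd int i * e" by (simp add: i')
    from dvd_diff[OF this 1] have "int p dvd 1" by simp
    then show False using p by (simp add: prime_nat_iff)
  qed
  moreover have "int p ^ M dvd (1 + e * int p ^ k) ^ i - (1 + int p ^ k)"
    by (rule dvd_trans[OF _ i]) (simp add: le_imp_power_dvd)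
  ultimately show ?thesis by blast
qed

section \<open>Commutators and quotients\<close>

abbreviation comm :: "('a, 'b) monoid_scheme \<Rightarrow> 'a \<Rightarrow> 'a \<Rightarrow> 'a" where
  "comm G x y \<equiv> x \<otimes>\<^bsub>G\<^esub> y \<otimes>\<^bsub>G\<^esub> inv\<^bsub>G\<^esub> x \<otimes>\<^bsub>G\<^esub> inv\<^bsub>G\<^esub> y"

context group
begin

lemma comm_closed: "x \<in> carrier G \<Longrightarrow> y \<in> carrier G \<Longrightarrow> comm G x y \<in> carrier G"
  by simp

lemma comm_swap: "x \<in> carrier G \<Longrightarrow> y \<in> carrier G \<Longrightarrow> x \<otimes> y = comm G x y \<otimes> y \<otimes> x"
  by (simp add: m_assoc)

lemma comm_eqI:
  assumes "x \<in> carrier G" "y \<in> carrier G" "z \<in> carrier G" "x \<otimes> y = z \<otimes> y \<otimes> x"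
  shows "comm G x y = z"
  using assms by (simp add: m_assoc)

lemma inv_commutator: "x \<in> carrier G \<Longrightarrow> y \<in> carrier G \<Longrightarrow> inv (comm G x y) = comm G y x"
  by (simp add: inv_mult_group m_assoc)

lemma comm_eq_one_iff: "x \<in> carrier G \<Longrightarrow> y \<in> carrier G \<Longrightarrow> comm G x y = \<one> \<longleftrightarrow> x \<otimes> y = y \<otimes> x"
  by (metis comm_eqI comm_swap l_one m_assoc m_closed one_closed)

lemma comm_in_derived:
  assumes "x \<in> carrier G" "y \<in> carrier G"
  shows "comm G x y \<in> derived G (carrier G)"
  unfolding derived_def using assms by (intro generate.incl) blast

text \<open>The centraliser of \<open>c\<close> is closed under products and inverses.\<close>

lemma generate_commute:
  assumes S: "S \<subseteq> carrier G" and c: "c \<in> carrier G" and comm: "\<And>s. s \<in> S \<Longrightarrow> s \<otimes> c = c \<otimes> s"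
    and u: "u \<in> generate G S"
  shows "u \<otimes> c = c \<otimes> u"
  using u
proof (induction rule: generate.induct)
  case one
  show ?case using c by simp
next
  case (incl h)
  then show ?case by (rule comm)
next
  case (inv h)
  then have h: "h \<in> carrier G" using S by blast
  have "inv h \<otimes> c = inv h \<otimes> (c \<otimes> h) \<otimes> inv h" using h c by (simp add: m_assoc)
  also have "\<dots> = inv h \<otimes> (h \<otimes> c) \<otimes> inv h" using comm[OF inv] by simp
  also have "\<dots> = c \<otimes> inv h" using h c by (simp flip: m_assoc)
  finally show ?case .
next
  case (eng h1 h2)
  then have h: "h1 \<in> carrier G" "h2 \<in> carrier G" using generate_incl[OF S] by auto
  have "h1 \<otimes> h2 \<otimes> c = h1 \<otimes> (c \<otimes> h2)" using h c eng.IH(2) by (simp add: m_assoc)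
  also have "\<dots> = (h1 \<otimes> c) \<otimes> h2" using h c by (simp add: m_assoc)
  also have "\<dots> = c \<otimes> (h1 \<otimes> h2)" using h c eng.IH(1) by (simp add: m_assoc)
  finally show ?case .
qed

lemma generate_pairwise_commute:
  assumes S: "S \<subseteq> carrier G" and comm: "\<And>s t. s \<in> S \<Longrightarrow> t \<in> S \<Longrightarrow> s \<otimes> t = t \<otimes> s"
    and "u \<in> generate G S" "v \<in> generate G S"
  shows "u \<otimes> v = v \<otimes> u"
proof -
  have u: "u \<in> carrier G" using assms(3) generate_incl[OF S] by blast
  have "s \<otimes> u = u \<otimes> s" if s: "s \<in> S" for s
    by (rule generate_commute[OF S _ _ assms(3), symmetric]) (use S s comm in blast)+
  from generate_commute[OF S u this assms(4)] show ?thesis by simp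
qed

lemma commute_int_pow:
  assumes "x \<in> carrier G" "y \<in> carrier G" "x \<otimes> y = y \<otimes> x"
  shows "x [^] (i::int) \<otimes> y [^] (j::int) = y [^] j \<otimes> x [^] i"
proof (rule generate_pairwise_commute[of "{x, y}"])
  show "x [^] i \<in> generate G {x, y}" "y [^] j \<in> generate G {x, y}"
    using assms by (intro subgroup_int_pow_closed[OF generate_is_subgroup] generate.incl; simp)+
  show "s \<otimes> t = t \<otimes> s" if "s \<in> {x, y}" "t \<in> {x, y}" for s t
    using that assms(3) by (metis empty_iff insert_iff)
qed (use assms(1,2) in blast)

lemma commute_pow:
  assumes "x \<in> carrier G" "y \<in> carrier G" "x \<otimes> y = y \<otimes> x"
  shows "x [^] (i::nat) \<otimes> y [^] (j::nat) = y [^] j \<otimes> x [^] i"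
  using commute_int_pow[OF assms, of "int i" "int j"] by (simp add: int_pow_int)

lemma pow_mod:
  fixes i P :: nat
  assumes "g \<in> carrier G" "g [^] P = \<one>"
  shows "g [^] (i mod P) = g [^] i"
proof -
  have "g [^] i = g [^] (P * (i div P) + i mod P)" by simp
  also have "\<dots> = (g [^] P) [^] (i div P) \<otimes> g [^] (i mod P)"
    using assms(1) by (simp only: nat_pow_mult nat_pow_pow nat_pow_closed)
  finally show ?thesis using assms by simp
qed

text \<open>Collecting all factors \<open>c\<close> on the left moves a \<open>g\<close> past a
  \<open>c\<close> exactly \<open>N (N - 1) / 2\<close> times, and each move leaves one
  \<open>z\<close>, which commutes with both.\<close>

lemma pow_mult_class2:
  fixes N :: nat
  assumes c: "c \<in> carrier G" and g: "g \<in> carrier G" and z: "z \<in> carrier G"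
    and gc: "g \<otimes> c = z \<otimes> c \<otimes> g" and zc: "z \<otimes> c = c \<otimes> z" and zg: "z \<otimes> g = g \<otimes> z"
  shows "(c \<otimes> g) [^] N = c [^] N \<otimes> g [^] N \<otimes> z [^] (N * (N - 1) div 2)"
proof (induction N)
  case (Suc N)
  have A: "g \<otimes> c [^] N = z [^] N \<otimes> c [^] N \<otimes> g" for N :: nat
  proof (induction N)
    case (Suc N)
    have "g \<otimes> c [^] Suc N = (g \<otimes> c [^] N) \<otimes> c" using c g by (simp add: m_assoc)
    also have "\<dots> = z [^] N \<otimes> c [^] N \<otimes> (g \<otimes> c)" unfolding Suc using c g z by (simp add: m_assoc)
    also have "\<dots> = z [^] N \<otimes> (c [^] N \<otimes> z) \<otimes> c \<otimes> g" unfolding gc using c g z by (simp add: m_assoc)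
    also have "c [^] N \<otimes> z = z \<otimes> c [^] N" using commute_pow[OF c z zc[symmetric], of N 1] c z by simp
    finally show ?case using c g z by (simp add: m_assoc)
  qed (use g in simp)
  have B: "z [^] i \<otimes> g [^] j = g [^] j \<otimes> z [^] i" "z [^] i \<otimes> c [^] j = c [^] j \<otimes> z [^] i" for i j :: nat
    using commute_pow[OF z g zg] commute_pow[OF z c zc] by auto
  have T: "N * (N - 1) div 2 + N = Suc N * (Suc N - 1) div 2"
  proof -
    have "Suc N * (Suc N - 1) = N * (N - 1) + 2 * N" by (cases N) auto
    then show ?thesis by simp
  qed
  have "(c \<otimes> g) [^] Suc N = c \<otimes> g \<otimes> (c [^] N \<otimes> g [^] N \<otimes> z [^] (N * (N - 1) div 2))"
    unfolding Suc.IH[symmetric] using c g by (intro nat_pow_Suc2) simp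
  also have "\<dots> = c \<otimes> (g \<otimes> c [^] N) \<otimes> (g [^] N \<otimes> z [^] (N * (N - 1) div 2))"
    using c g z by (simp add: m_assoc)
  also have "\<dots> = (c \<otimes> (z [^] N \<otimes> c [^] N)) \<otimes> (g \<otimes> g [^] N) \<otimes> z [^] (N * (N - 1) div 2)"
    unfolding A using c g z by (simp add: m_assoc)
  also have "\<dots> = (c \<otimes> c [^] N) \<otimes> (z [^] N \<otimes> g [^] Suc N) \<otimes> z [^] (N * (N - 1) div 2)"
    unfolding nat_pow_Suc2[OF g] B using c g z by (simp only: m_assoc m_closed nat_pow_closed)
  also have "\<dots> = c [^] Suc N \<otimes> g [^] Suc N \<otimes> (z [^] N \<otimes> z [^] (N * (N - 1) div 2))"
    unfolding B(1) nat_pow_Suc2[OF c] using c g z by (simp only: m_assoc m_closed nat_pow_closed)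
  also have "z [^] N \<otimes> z [^] (N * (N - 1) div 2) = z [^] (Suc N * (Suc N - 1) div 2)"
    unfolding T[symmetric] using z by (simp add: nat_pow_mult add.commute)
  finally show ?case .
qed (use c g in simp)

lemma quotient_hom:
  assumes "N \<lhd> G"
  shows "group_hom G (G Mod N) (\<lambda>x. N #> x)"
    and "carrier (G Mod N) = (\<lambda>x. N #> x) ` carrier G"
    and "\<And>x. x \<in> carrier G \<Longrightarrow> N #> x = \<one>\<^bsub>G Mod N\<^esub> \<longleftrightarrow> x \<in> N"
proof -
  interpret N: normal N G by fact
  show "group_hom G (G Mod N) (\<lambda>x. N #> x)"
    by (simp add: group_hom_def group_hom_axioms_def N.factorgroup_is_group N.r_coset_hom_Mod)
  show "carrier (G Mod N) = (\<lambda>x. N #> x) ` carrier G" by (rule carrier_FactGroup)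
  show "N #> x = \<one>\<^bsub>G Mod N\<^esub> \<longleftrightarrow> x \<in> N" if "x \<in> carrier G" for x
    using that by (metis coset_join1 coset_join2 N.subgroup_axioms one_FactGroup)
qed

end

lemma (in group_hom) hom_eq_iff:
  assumes "x \<in> carrier G" "y \<in> carrier G" and ker: "\<And>x. x \<in> carrier G \<Longrightarrow> h x = \<one>\<^bsub>H\<^esub> \<longleftrightarrow> x \<in> N"
  shows "h x = h y \<longleftrightarrow> x \<otimes> inv y \<in> N"
proof -
  have "h x = h y \<longleftrightarrow> h x \<otimes>\<^bsub>H\<^esub> inv\<^bsub>H\<^esub> h y = \<one>\<^bsub>H\<^esub>"
    using assms(1,2) by (metis H.inv_closed H.inv_solve_right H.l_one H.one_closed hom_closed)
  also have "\<dots> \<longleftrightarrow> h (x \<otimes> inv y) = \<one>\<^bsub>H\<^esub>" using assms(1,2) by simp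
  finally show ?thesis using ker[of "x \<otimes> inv y"] assms(1,2) by (simp del: hom_mult)
qed

lemma (in group_hom) hom_comm:
  assumes "x \<in> carrier G" "y \<in> carrier G"
  shows "h (comm G x y) = comm H (h x) (h y)"
  using assms by simp

context group
begin

text \<open>The images of the generators commute in the quotient by \<open>N\<close>, so the
  quotient is abelian.\<close>

lemma derived_subset_normal:
  assumes N: "N \<lhd> G" and S: "S \<subseteq> carrier G" "generate G S = carrier G"
    and comm: "\<And>x y. x \<in> S \<Longrightarrow> y \<in> S \<Longrightarrow> comm G x y \<in> N"
  shows "derived G (carrier G) \<subseteq> N"
proof -
  interpret q: group_hom G "G Mod N" "\<lambda>x. N #> x" by (rule quotient_hom[OF N])
  note ker = quotient_hom(3)[OF N]
  have c: "comm G u v \<in> N" if u: "u \<in> carrier G" "v \<in> carrier G" for u v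
  proof -
    let ?S = "(\<lambda>x. N #> x) ` S"
    have gen: "generate (G Mod N) ?S = (\<lambda>x. N #> x) ` carrier G"
      using q.generate_img[OF S(1)] S(2) by simp
    have "(N #> u) \<otimes>\<^bsub>G Mod N\<^esub> (N #> v) = (N #> v) \<otimes>\<^bsub>G Mod N\<^esub> (N #> u)"
    proof (rule q.H.generate_pairwise_commute[of ?S])
      show "?S \<subseteq> carrier (G Mod N)" using S(1) q.hom_closed by blast
      show "N #> u \<in> generate (G Mod N) ?S" "N #> v \<in> generate (G Mod N) ?S"
        unfolding gen using u by auto
      fix s t assume "s \<in> ?S" "t \<in> ?S"
      then obtain x y where xy: "x \<in> S" "s = N #> x" "y \<in> S" "t = N #> y" by blast
      have xyG: "x \<in> carrier G" "y \<in> carrier G" using xy S by auto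
      have "comm (G Mod N) s t = \<one>\<^bsub>G Mod N\<^esub>"
        unfolding xy q.hom_comm[OF xyG, symmetric] using ker comm xy xyG by (metis comm_closed)
      then show "s \<otimes>\<^bsub>G Mod N\<^esub> t = t \<otimes>\<^bsub>G Mod N\<^esub> s"
        using q.H.comm_eq_one_iff[of s t] xyG xy q.hom_closed by metis
    qed
    then have "comm (G Mod N) (N #> u) (N #> v) = \<one>\<^bsub>G Mod N\<^esub>"
      using q.H.comm_eq_one_iff q.hom_closed u by metis
    then show ?thesis
      using ker[of "comm G u v"] u q.hom_comm[OF u] by (metis comm_closed)
  qed
  have "derived_set G (carrier G) \<subseteq> N" using c by blast
  then show ?thesis unfolding derived_def
    using N by (intro generate_subgroup_incl) (auto simp: normal_def)
qed

lemma derived_subset_normal2: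
  assumes N: "N \<lhd> G" and xy: "x \<in> carrier G" "y \<in> carrier G" "generate G {x, y} = carrier G"
    and comm: "comm G x y \<in> N"
  shows "derived G (carrier G) \<subseteq> N"
proof (rule derived_subset_normal[OF N _ xy(3)])
  interpret N: normal N G by fact
  have "comm G y x \<in> N" using inv_commutator[OF xy(1,2)] comm by (metis N.m_inv_closed)
  moreover have "comm G u u = \<one>" if "u \<in> carrier G" for u using that by (simp add: comm_eq_one_iff)
  ultimately show "comm G u v \<in> N" if "u \<in> {x, y}" "v \<in> {x, y}" for u v
    using that comm xy N.one_closed by (metis empty_iff insert_iff)
qed (use xy in auto)

lemma int_pow_unit:
  assumes p: "Factorial_Ring.prime p" and g: "g \<in> carrier G" "g [^] (p ^ M) = \<one>" and i: "\<not> int p dvd i"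
  shows "\<exists>j::int. g [^] (i * j) = g"
proof -
  obtain j where "int (p ^ M) dvd - 1 + int j * i" using coprime_solve[OF p i] by blast
  then obtain t where t: "- 1 + int j * i = int (p ^ M) * t" by blast
  have "g [^] (i * int j) = g [^] (1 + int (p ^ M) * t)" using t by (simp add: algebra_simps)
  also have "\<dots> = g [^] (1::int) \<otimes> (g [^] int (p ^ M)) [^] t"
    using g(1) by (simp add: int_pow_mult int_pow_pow del: of_nat_power)
  also have "\<dots> = g" using g unfolding int_pow_int by simp
  finally show ?thesis by blast
qed

text \<open>The hypothesis says \<open>g^(1 - p j) = 1\<close>, and \<open>1 - p j\<close> is
  invertible modulo the order of \<open>g\<close>. This plays the role of Nakayama's lemma for
  \<open><c>\<close> and \<open><c^p>\<close>.\<close>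

lemma int_pow_p_eq_self:
  assumes p: "Factorial_Ring.prime p" and g: "g \<in> carrier G" "g [^] (p ^ M) = \<one>"
    and eq: "g = g [^] (int p * j)"
  shows "g = \<one>"
proof -
  have "\<not> int p dvd 1 - int p * j"
  proof
    assume "int p dvd 1 - int p * j"
    then have "int p dvd (1 - int p * j) + int p * j" by (intro dvd_add) auto
    then show False using p by (simp add: prime_nat_iff)
  qed
  then obtain i where i: "g [^] ((1 - int p * j) * i) = g" using int_pow_unit[OF p g] by blast
  have "g [^] (1 - int p * j) = g [^] (1::int) \<otimes> inv (g [^] (int p * j))" using g(1) by (simp only: int_pow_diff)
  also have "\<dots> = \<one>" using g eq by simp
  finally have "g [^] (1 - int p * j) = \<one>" .
  then have "g [^] ((1 - int p * j) * i) = \<one>" using g(1) by (simp add: int_pow_one flip: int_pow_pow)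
  then show ?thesis using i by simp
qed

end

section \<open>The derived subgroup is cyclic\<close>

text \<open>The chain of powerful nilpotency with the commutator condition put elementwise and the
  index shifted to start at 0, a form that passes directly to homomorphic images.\<close>

definition pn_chain :: "nat \<Rightarrow> ('a, 'b) monoid_scheme \<Rightarrow> (nat \<Rightarrow> 'a set) \<Rightarrow> nat \<Rightarrow> bool" where
  "pn_chain p G H n \<longleftrightarrow> H 0 = {\<one>\<^bsub>G\<^esub>} \<and> H n = carrier G \<and> (\<forall>i\<le>n. subgroup (H i) G) \<and>
     (\<forall>i<n. H i \<subseteq> H (Suc i)) \<and>
     (\<forall>i<n. \<forall>u\<in>H (Suc i). \<forall>g\<in>carrier G. comm G u g \<in> power_subgroup G (H i) p)"

definition powerful_exponent :: "nat \<Rightarrow> nat" where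
  "powerful_exponent p = (if p = 2 then 4 else p)"

text \<open>The second divisibility kills the correction term in the power of a product. It shows
  why 2 must be replaced by 4: \<open>2 * 1 / 2\<close> is odd, \<open>4 * 3 / 2\<close> is
  even.\<close>

lemma powerful_exponent_dvd:
  assumes "Factorial_Ring.prime p"
  shows "p dvd powerful_exponent p" 
    and "p dvd powerful_exponent p * (powerful_exponent p - 1) div 2"
proof -
  show "p dvd powerful_exponent p" by (simp add: powerful_exponent_def)
  show "p dvd powerful_exponent p * (powerful_exponent p - 1) div 2"
  proof (cases "p = 2")
    case False
    then have "even (p - 1)" using assms prime_odd_nat[of p] prime_ge_2_nat[of p] by simp
    then obtain t where "p - 1 = 2 * t" by blast
    then have "p * (p - 1) div 2 = p * t" by simp
    then show ?thesis using False by (simp add: powerful_exponent_def)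
  qed (simp add: powerful_exponent_def)
qed

lemma powerfully_nilpotentE:
  assumes "powerfully_nilpotent p G"
  obtains H n where "group G" "Factorial_Ring.prime p" "pn_chain p G H n"
    "derived G (carrier G) \<subseteq> power_subgroup G (carrier G) (powerful_exponent p)"
proof -
  obtain n H where H: "H 0 = {\<one>\<^bsub>G\<^esub>}" "H n = carrier G" "\<forall>i\<le>n. subgroup (H i) G"
    "\<forall>i<n. H i \<subseteq> H (Suc i)"
    and C: "\<forall>i\<in>{1..n}. commutator_subgroup G (H i) (carrier G) \<subseteq> power_subgroup G (H (i - 1)) p"
    using assms unfolding powerfully_nilpotent_def by blast
  have "comm G u g \<in> power_subgroup G (H i) p" if "i < n" "u \<in> H (Suc i)" "g \<in> carrier G" for i u g
  proof -
    have "comm G u g \<in> commutator_subgroup G (H (Suc i)) (carrier G)"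
      unfolding commutator_subgroup_def using that by (intro generate.incl) blast
    then show ?thesis using C that(1) by (force dest: bspec[of _ _ "Suc i"])
  qed
  then have "pn_chain p G H n" using H unfolding pn_chain_def by blast
  then show thesis
    using assms that unfolding powerfully_nilpotent_def powerful_def finite_p_group_def
      commutator_subgroup_self powerful_exponent_def by blast
qed

lemma (in group_hom) power_subgroup_img:
  assumes "S \<subseteq> carrier G"
  shows "power_subgroup H (h ` S) q = h ` power_subgroup G S q"
proof -
  have "(\<lambda>g. g [^]\<^bsub>H\<^esub> q) ` h ` S = h ` (\<lambda>g. g [^] q) ` S"
    unfolding image_image using assms hom_nat_pow by (intro image_cong) auto
  moreover have "(\<lambda>g. g [^] q) ` S \<subseteq> carrier G" using assms by auto
  ultimately show ?thesis unfolding power_subgroup_def by (simp add: generate_img)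
qed

context group
begin

lemma power_subgroup_subset:
  assumes "subgroup S G"
  shows "power_subgroup G S q \<subseteq> S"
proof -
  interpret S: subgroup S G by fact
  have "(\<lambda>g. g [^] q) ` S \<subseteq> S"
    using S.subset assms by (metis image_subsetI int_pow_int subgroup_int_pow_closed)
  then show ?thesis unfolding power_subgroup_def by (intro generate_subgroup_incl assms)
qed

lemma derived_img_Mod:
  assumes "N \<lhd> G"
  shows "derived (G Mod N) (carrier (G Mod N)) = (\<lambda>x. N #> x) ` derived G (carrier G)"
  using group_hom.derived_img[OF quotient_hom(1)[OF assms], of "carrier G"] quotient_hom(2)[OF assms]
  by simp

lemma derived_closed: "d \<in> derived G (carrier G) \<Longrightarrow> d \<in> carrier G"
  using derived_in_carrier[of "carrier G"] by blast

lemma conj_pow: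
  fixes n :: nat
  assumes "h \<in> carrier G" "g \<in> carrier G" "u \<in> carrier G" "h \<otimes> g = u \<otimes> h"
  shows "h \<otimes> g [^] n = u [^] n \<otimes> h"
proof (induction n)
  case (Suc n)
  have "h \<otimes> g [^] Suc n = (h \<otimes> g [^] n) \<otimes> g" using assms by (simp add: m_assoc)
  also have "\<dots> = u [^] n \<otimes> (h \<otimes> g)" unfolding Suc using assms by (simp add: m_assoc)
  also have "\<dots> = u [^] Suc n \<otimes> h" using assms by (simp add: m_assoc)
  finally show ?case .
qed (use assms in simp)

lemma conj_int_pow:
  fixes j :: int
  assumes "h \<in> carrier G" "g \<in> carrier G" "u \<in> carrier G" "h \<otimes> g = u \<otimes> h"
  shows "h \<otimes> g [^] j = u [^] j \<otimes> h"
proof (cases j rule: int_cases2)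
  case (nonneg n)
  then show ?thesis using conj_pow[OF assms] by (simp add: int_pow_int)
next
  case (nonpos n)
  have e: "h \<otimes> g [^] n = u [^] n \<otimes> h" by (rule conj_pow[OF assms])
  have "inv (u [^] n) \<otimes> (u [^] n \<otimes> h) \<otimes> inv (g [^] n) = inv (u [^] n) \<otimes> (h \<otimes> g [^] n) \<otimes> inv (g [^] n)"
    unfolding e ..
  moreover have "inv (u [^] n) \<otimes> (u [^] n \<otimes> h) = h" using assms by (simp flip: m_assoc)
  moreover have "inv (u [^] n) \<otimes> (h \<otimes> g [^] n) \<otimes> inv (g [^] n) = inv (u [^] n) \<otimes> h"
    using assms by (simp add: m_assoc)
  ultimately show ?thesis using nonpos assms by (simp add: int_pow_neg_int)
qed

lemma pow_dvd_one:
  fixes p N :: nat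
  assumes "g \<in> carrier G" "g [^] p = \<one>" "p dvd N"
  shows "g [^] N = \<one>"
  using assms by (metis dvdE nat_pow_one nat_pow_pow)

text \<open>It suffices that every \<open>g^q\<close>, with \<open>q\<close> the powerful exponent,
  is central, for these powers generate a subgroup containing \<open>G'\<close>. Conjugating by
  \<open>h\<close> turns \<open>g^q\<close> into \<open>(c g)^q\<close> with
  \<open>c = [h, g]\<close>. As \<open>z = [g, c]\<close> is central, this equals
  \<open>c^q g^q z^(q (q - 1) / 2)\<close>, and both extra factors are trivial because
  \<open>G'\<close> has exponent \<open>p\<close>.\<close>

lemma derived_central:
  assumes p: "Factorial_Ring.prime p"
    and exp: "\<And>d. d \<in> derived G (carrier G) \<Longrightarrow> d [^] p = \<one>"
    and class3: "\<And>d g h. d \<in> derived G (carrier G) \<Longrightarrow> g \<in> carrier G \<Longrightarrow> h \<in> carrier G \<Longrightarrow>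
        comm G g d \<otimes> h = h \<otimes> comm G g d"
    and pw: "derived G (carrier G) \<subseteq> power_subgroup G (carrier G) (powerful_exponent p)"
    and d: "d \<in> derived G (carrier G)" and h: "h \<in> carrier G"
  shows "d \<otimes> h = h \<otimes> d"
proof -
  let ?q = "powerful_exponent p"
  have cent: "g [^] ?q \<otimes> h = h \<otimes> g [^] ?q" if g: "g \<in> carrier G" for g
  proof -
    define c where "c = comm G h g"
    define z where "z = comm G g c"
    have cD: "c \<in> derived G (carrier G)" unfolding c_def using g h by (rule comm_in_derived[rotated])
    have c: "c \<in> carrier G" using cD by (rule derived_closed)
    have zD: "z \<in> derived G (carrier G)" unfolding z_def using g c by (rule comm_in_derived)
    have z: "z \<in> carrier G" using zD by (rule derived_closed)
    have zc: "z \<otimes> u = u \<otimes> z" if "u \<in> carrier G" for u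
      unfolding z_def using cD g that by (rule class3)
    have "(c \<otimes> g) [^] ?q = c [^] ?q \<otimes> g [^] ?q \<otimes> z [^] (?q * (?q - 1) div 2)"
      using comm_swap[OF g c] unfolding z_def[symmetric]
      by (intro pow_mult_class2 c g z zc)
    also have "c [^] ?q = \<one>" using pow_dvd_one[OF c exp[OF cD]] powerful_exponent_dvd(1)[OF p] by blast
    also have "z [^] (?q * (?q - 1) div 2) = \<one>"
      using pow_dvd_one[OF z exp[OF zD]] powerful_exponent_dvd(2)[OF p] by blast
    finally have "(c \<otimes> g) [^] ?q = g [^] ?q" using g by simp
    moreover have "h \<otimes> g [^] ?q = (c \<otimes> g) [^] ?q \<otimes> h"
      using g h c comm_swap[OF h g] unfolding c_def[symmetric] by (intro conj_pow) auto
    ultimately show ?thesis by simp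
  qed
  show ?thesis
  proof (rule generate_commute)
    show "d \<in> generate G ((\<lambda>g. g [^] ?q) ` carrier G)" using d pw unfolding power_subgroup_def by blast
    show "s \<otimes> h = h \<otimes> s" if "s \<in> (\<lambda>g. g [^] ?q) ` carrier G" for s using that cent by blast
  qed (use h in auto)
qed

lemma left_commuteI:
  assumes "a \<in> carrier G" "b \<in> carrier G" "t \<in> carrier G" "a \<otimes> b = b \<otimes> a"
  shows "a \<otimes> (b \<otimes> t) = b \<otimes> (a \<otimes> t)"
  using assms by (simp flip: m_assoc)

text \<open>Modulo the subgroup of \<open>p\<close>-th powers of elements of \<open>G'\<close>, the hypotheses give class at most 3, so powerfulness
  makes \<open>G'\<close> central there.\<close>

lemma derived_cyclic_step:
  fixes M :: nat
  assumes p: "Factorial_Ring.prime p"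
    and M: "\<And>g. g \<in> carrier G \<Longrightarrow> g [^] (p ^ M) = \<one>"
    and xy: "x \<in> carrier G" "y \<in> carrier G" "generate G {x, y} = carrier G"
    and pw: "derived G (carrier G) \<subseteq> power_subgroup G (carrier G) (powerful_exponent p)"
    and Hc: "H \<subseteq> carrier G" and Hcent: "\<And>h g. h \<in> H \<Longrightarrow> g \<in> carrier G \<Longrightarrow> h \<otimes> g = g \<otimes> h"
    and D: "\<And>d. d \<in> derived G (carrier G) \<Longrightarrow> \<exists>h\<in>H. \<exists>j::int. d = h \<otimes> comm G x y [^] j"
    and act: "\<And>g. g \<in> carrier G \<Longrightarrow> \<exists>h\<in>H. \<exists>j::int. comm G g (comm G x y) = h \<otimes> comm G x y [^] (int p * j)"
  shows "d \<in> derived G (carrier G) \<Longrightarrow> \<exists>j::int. d = comm G x y [^] j"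
    and "g \<in> carrier G \<Longrightarrow> \<exists>j::int. comm G g (comm G x y) = comm G x y [^] (int p * j)"
proof -
  define c where "c = comm G x y"
  let ?D = "derived G (carrier G)"
  have cD: "c \<in> ?D" unfolding c_def using xy(1,2) by (rule comm_in_derived)
  have c: "c \<in> carrier G" using cD by (rule derived_closed)
  have subD: "subgroup ?D G" by (rule derived_is_subgroup) simp
  interpret DS: subgroup ?D G by (rule subD)
  have normD: "?D \<lhd> G" by (rule derived_self_is_normal)
  have powD: "c [^] (j::int) \<in> ?D" for j using subD cD by (rule subgroup_int_pow_closed)
  \<comment> \<open>Each element of \<open>G'\<close> is a central element times a power of
    \<open>c\<close>, so \<open>G'\<close> is abelian.\<close>
  have Dab: "d \<otimes> d' = d' \<otimes> d" if dd: "d \<in> ?D" "d' \<in> ?D" for d d'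
  proof -
    obtain h j where h: "h \<in> H" "d = h \<otimes> c [^] (j::int)" using D dd(1) unfolding c_def by blast
    have hG: "h \<in> carrier G" "d' \<in> carrier G" using h(1) Hc dd(2) derived_closed by auto
    obtain h' j' where h': "h' \<in> H" "d' = h' \<otimes> c [^] (j'::int)" using D dd(2) unfolding c_def by blast
    have h'G: "h' \<in> carrier G" using h'(1) Hc by auto
    have "c [^] j \<otimes> d' = h' \<otimes> (c [^] j \<otimes> c [^] j')"
      unfolding h' using h'G c Hcent[OF h'(1), of "c [^] j"] by (intro left_commuteI) auto
    also have "c [^] j \<otimes> c [^] j' = c [^] j' \<otimes> c [^] j" using c by (intro commute_int_pow) auto
    finally have 1: "c [^] j \<otimes> d' = d' \<otimes> c [^] j" unfolding h' using h'G c by (simp add: m_assoc)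
    have "d \<otimes> d' = h \<otimes> (d' \<otimes> c [^] j)" unfolding h using hG c 1 by (simp add: m_assoc)
    also have "\<dots> = (d' \<otimes> h) \<otimes> c [^] j" using Hcent[OF h(1) hG(2)] hG c by (simp flip: m_assoc)
    finally show ?thesis unfolding h using hG c by (simp add: m_assoc)
  qed
  \<comment> \<open>In the abelian group \<open>G'\<close> the \<open>p\<close>-th powers already
    form a subgroup, so no generated subgroup is needed.\<close>
  define P where "P = (\<lambda>d. d [^] p) ` ?D"
  have PG: "P \<subseteq> carrier G" unfolding P_def using derived_closed by auto
  have "subgroup P G"
  proof (rule subgroupI)
    show "P \<noteq> {}" unfolding P_def using cD by blast
    fix a assume "a \<in> P"
    then obtain d where d: "d \<in> ?D" "a = d [^] p" unfolding P_def by blast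
    have "inv a = (inv d) [^] p" using d derived_closed by (simp add: nat_pow_inv)
    then show "inv a \<in> P" unfolding P_def using d(1) DS.m_inv_closed by blast
    fix b assume "b \<in> P"
    then obtain d' where d': "d' \<in> ?D" "b = d' [^] p" unfolding P_def by blast
    have "a \<otimes> b = (d \<otimes> d') [^] p" unfolding d(2) d'(2)
      by (rule pow_mult_distrib[symmetric]) (use d(1) d'(1) derived_closed Dab in auto)
    then show "a \<otimes> b \<in> P" unfolding P_def using d(1) d'(1) DS.m_closed by blast
  qed (rule PG)
  moreover have "u \<otimes> a \<otimes> inv u \<in> P" if ua: "u \<in> carrier G" "a \<in> P" for u a
  proof -
    obtain d where d: "d \<in> ?D" "a = d [^] p" using ua(2) unfolding P_def by blast
    have dG: "d \<in> carrier G" using d derived_closed by blast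
    have e: "u \<otimes> d \<otimes> inv u \<in> ?D" using normD d(1) ua(1) by (simp add: normal_inv_iff)
    have "u \<otimes> d [^] p = (u \<otimes> d \<otimes> inv u) [^] p \<otimes> u"
      using ua(1) dG by (intro conj_pow) (simp_all add: m_assoc)
    then have "u \<otimes> a \<otimes> inv u = (u \<otimes> d \<otimes> inv u) [^] p"
      unfolding d(2) using ua(1) dG by (simp add: m_assoc)
    then show ?thesis unfolding P_def using e by blast
  qed
  ultimately have P: "P \<lhd> G" by (simp add: normal_inv_iff)
  define r where "r = (\<lambda>x. P #> x)"
  define L where "L = G Mod P"
  interpret r: group_hom G L r unfolding L_def r_def by (rule quotient_hom(1)[OF P])
  have carrL: "carrier L = r ` carrier G" unfolding L_def r_def by (rule quotient_hom(2)[OF P])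
  have ker: "r u = \<one>\<^bsub>L\<^esub> \<longleftrightarrow> u \<in> P" if "u \<in> carrier G" for u
    unfolding L_def r_def using that by (rule quotient_hom(3)[OF P])
  have DL: "derived L (carrier L) = r ` ?D" unfolding L_def r_def by (rule derived_img_Mod[OF P])
  have central: "r d \<otimes>\<^bsub>L\<^esub> l = l \<otimes>\<^bsub>L\<^esub> r d" if "d \<in> ?D" "l \<in> carrier L" for d l
  proof (rule r.H.derived_central[OF p])
    show "derived L (carrier L) \<subseteq> power_subgroup L (carrier L) (powerful_exponent p)"
      unfolding DL unfolding carrL r.power_subgroup_img[OF subset_refl] using pw by (rule image_mono)
    show "r d \<in> derived L (carrier L)" unfolding DL using that by blast
    show "e [^]\<^bsub>L\<^esub> p = \<one>\<^bsub>L\<^esub>" if eD: "e \<in> derived L (carrier L)" for e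
    proof -
      obtain d where d: "d \<in> ?D" "e = r d" using eD unfolding DL by blast
      have "d [^] p \<in> P" unfolding P_def using d by blast
      then show ?thesis unfolding d(2) using ker d(1) derived_closed by (simp flip: r.hom_nat_pow)
    qed
    fix e g h assume "e \<in> derived L (carrier L)" "g \<in> carrier L" "h \<in> carrier L"
    then obtain d g' h' where d: "d \<in> ?D" "e = r d" and g': "g' \<in> carrier G" "g = r g'"
      and h': "h' \<in> carrier G" "h = r h'" unfolding DL unfolding carrL by blast
    have dG: "d \<in> carrier G" using d derived_closed by blast
    \<comment> \<open>Class at most 3: with \<open>d = k c^j\<close> and
      \<open>[g', c] = k' c^(p j')\<close>, the commutator \<open>[g', d]\<close> is
      \<open>k'^j\<close> times a \<open>p\<close>-th power of an element of \<open>G'\<close>.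
      Modulo \<open>P\<close> only \<open>k'^j\<close> remains, and \<open>k'\<close> is
      central.\<close>
    obtain k j where k: "k \<in> H" "d = k \<otimes> c [^] (j::int)" using D d(1) unfolding c_def by blast
    obtain k' j' where k': "k' \<in> H" "comm G g' c = k' \<otimes> c [^] (int p * j')"
      using act[OF g'(1)] unfolding c_def by blast
    have kG: "k \<in> carrier G" "k' \<in> carrier G" using k k' Hc by auto
    have 1: "g' \<otimes> c = (k' \<otimes> c [^] (int p * j') \<otimes> c) \<otimes> g'"
      using comm_swap[OF g'(1) c] k'(2) by simp
    have kc: "k' \<otimes> c [^] (i::int) = c [^] i \<otimes> k'" for i using Hcent[OF k'(1)] c by simp
    have "g' \<otimes> c [^] j = (k' \<otimes> c [^] (int p * j') \<otimes> c) [^] j \<otimes> g'"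
      using g' c kG 1 by (intro conj_int_pow) auto
    also have "(k' \<otimes> c [^] (int p * j') \<otimes> c) = k' \<otimes> c [^] (int p * j' + 1)"
      using c kG by (simp add: int_pow_mult m_assoc)
    also have "\<dots> [^] j = k' [^] j \<otimes> c [^] ((int p * j' + 1) * j)"
      unfolding int_pow_pow[OF c, symmetric] using c kG kc by (intro int_pow_mult_distrib) auto
    also have "c [^] ((int p * j' + 1) * j) = (c [^] (j' * j)) [^] p \<otimes> c [^] j"
      using c by (simp add: int_pow_pow int_pow_mult[symmetric] algebra_simps flip: int_pow_int)
    finally have 2: "g' \<otimes> c [^] j = (k' [^] j \<otimes> (c [^] (j' * j)) [^] p) \<otimes> c [^] j \<otimes> g'"
      using c kG by (simp add: m_assoc)
    have "g' \<otimes> d = k \<otimes> (g' \<otimes> c [^] j)" unfolding k(2) using Hcent[OF k(1) g'(1)] kG g' c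
      by (intro left_commuteI) auto
    also have "\<dots> = (k \<otimes> (k' [^] j \<otimes> (c [^] (j' * j)) [^] p)) \<otimes> c [^] j \<otimes> g'"
      unfolding 2 using kG c g' by (simp add: m_assoc)
    also have "k \<otimes> (k' [^] j \<otimes> (c [^] (j' * j)) [^] p) = (k' [^] j \<otimes> (c [^] (j' * j)) [^] p) \<otimes> k"
      using kG c by (intro Hcent[OF k(1)]) auto
    finally have "g' \<otimes> d = (k' [^] j \<otimes> (c [^] (j' * j)) [^] p) \<otimes> d \<otimes> g'"
      unfolding k(2) using kG c g' by (simp add: m_assoc)
    then have cm: "comm G g' d = k' [^] j \<otimes> (c [^] (j' * j)) [^] p"
      using g' dG kG c by (intro comm_eqI) auto
    have "(c [^] (j' * j)) [^] p \<in> P" unfolding P_def using powD by blast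
    then have "r ((c [^] (j' * j)) [^] p) = \<one>\<^bsub>L\<^esub>" using ker c by (simp del: r.hom_nat_pow)
    then have "comm L g e = r (k' [^] j)"
      unfolding g' d r.hom_comm[OF g'(1) dG, symmetric] cm using c kG by (simp del: r.hom_nat_pow)
    moreover have "k' [^] j \<otimes> h' = h' \<otimes> k' [^] j"
      using commute_int_pow[OF kG(2) h'(1) Hcent[OF k'(1) h'(1)], of j 1] h' kG by simp
    ultimately show "comm L g e \<otimes>\<^bsub>L\<^esub> h = h \<otimes>\<^bsub>L\<^esub> comm L g e"
      unfolding h' using h' kG by (metis int_pow_closed r.hom_mult)
  qed (rule that)
  have rc: "r c \<in> carrier L" using c by simp
  have NL: "generate L {r c} \<lhd> L"
    unfolding r.H.normal_inv_iff
  proof (intro conjI ballI)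
    show "subgroup (generate L {r c}) L" using rc by (intro r.H.generate_is_subgroup) simp
    fix u a assume u: "u \<in> carrier L" and a: "a \<in> generate L {r c}"
    have aL: "a \<in> carrier L" using a rc r.H.generate_incl[of "{r c}"] by blast
    have au: "a \<otimes>\<^bsub>L\<^esub> u = u \<otimes>\<^bsub>L\<^esub> a"
    proof (rule r.H.generate_commute[OF _ u _ a])
      fix s assume "s \<in> {r c}"
      then have "s = r c" by blast
      then show "s \<otimes>\<^bsub>L\<^esub> u = u \<otimes>\<^bsub>L\<^esub> s" using central[OF cD u] by simp
    qed (use rc in blast)
    have "u \<otimes>\<^bsub>L\<^esub> a \<otimes>\<^bsub>L\<^esub> inv\<^bsub>L\<^esub> u = a"
      unfolding au[symmetric] using u aL by (simp add: r.H.m_assoc)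
    then show "u \<otimes>\<^bsub>L\<^esub> a \<otimes>\<^bsub>L\<^esub> inv\<^bsub>L\<^esub> u \<in> generate L {r c}" using a by simp
  qed
  have genL: "generate L {r x, r y} = carrier L"
    using r.generate_img[of "{x, y}"] xy carrL by simp
  have "derived L (carrier L) \<subseteq> generate L {r c}"
  proof (rule r.H.derived_subset_normal2[OF NL _ _ genL])
    show "comm L (r x) (r y) \<in> generate L {r c}"
      unfolding r.hom_comm[OF xy(1,2), symmetric] c_def[symmetric] by (rule generate.incl) simp
  qed (use xy in auto)
  then have DcP: "\<exists>d1\<in>?D. \<exists>j::int. d = c [^] j \<otimes> d1 [^] p" if d: "d \<in> ?D" for d
  proof -
    have dG: "d \<in> carrier G" using d derived_closed by blast
    have "r d \<in> generate L {r c}" using d DL \<open>derived L (carrier L) \<subseteq> generate L {r c}\<close> by blast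
    then obtain j where "r d = r c [^]\<^bsub>L\<^esub> (j::int)" unfolding r.H.generate_pow[OF rc] by blast
    then have "r d = r (c [^] j)" using c by (simp add: r.hom_int_pow)
    then have "d \<otimes> inv (c [^] j) \<in> P" using r.hom_eq_iff[of d "c [^] j" P] ker dG c by simp
    then obtain d1 where d1: "d1 \<in> ?D" "d \<otimes> inv (c [^] j) = d1 [^] p" unfolding P_def by blast
    have d1G: "d1 \<in> carrier G" using d1 derived_closed by blast
    have "d = d1 [^] p \<otimes> c [^] j" unfolding d1(2)[symmetric] using dG c by (simp add: m_assoc)
    also have "\<dots> = c [^] j \<otimes> d1 [^] p"
      using commute_pow[OF d1G int_pow_closed[OF c] Dab[OF d1(1) powD[of j]], of p 1] c d1G by simp
    finally show ?thesis using d1(1) by blast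
  qed
  \<comment> \<open>The relation \<open>G' = <c> (G')^p\<close> is substituted into itself; for
    \<open>N = M\<close> the second factor is trivial.\<close>
  have iter: "\<exists>d1\<in>?D. \<exists>j::int. d = c [^] j \<otimes> d1 [^] (p ^ N)" if d: "d \<in> ?D" for d N
  proof (induction N)
    case 0
    show ?case using d derived_closed by (intro bexI[of _ d] exI[of _ 0]) auto
  next
    case (Suc N)
    then obtain d1 j where d1: "d1 \<in> ?D" "d = c [^] (j::int) \<otimes> d1 [^] (p ^ N)" by blast
    obtain d2 i where d2: "d2 \<in> ?D" "d1 = c [^] (i::int) \<otimes> d2 [^] p" using DcP[OF d1(1)] by blast
    have d2G: "d2 \<in> carrier G" using d2 derived_closed by blast
    have "c [^] i \<otimes> d2 [^] p = d2 [^] p \<otimes> c [^] i"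
      using commute_pow[OF d2G int_pow_closed[OF c] Dab[OF d2(1) powD[of i]], of p 1] c d2G by simp
    then have "d1 [^] (p ^ N) = (c [^] i) [^] (p ^ N) \<otimes> (d2 [^] p) [^] (p ^ N)"
      unfolding d2 using c d2G by (intro pow_mult_distrib) auto
    also have "\<dots> = c [^] (i * int (p ^ N)) \<otimes> d2 [^] (p ^ Suc N)"
      using c d2G by (simp add: nat_pow_pow int_pow_pow flip: int_pow_int)
    finally have "d = c [^] (j + i * int (p ^ N)) \<otimes> d2 [^] (p ^ Suc N)"
      unfolding d1(2) using c d2G by (simp add: int_pow_mult m_assoc)
    then show ?case using d2(1) by blast
  qed
  have Dc: "\<exists>j::int. d = c [^] j" if dD: "d \<in> ?D" for d
  proof -
    obtain d1 j where "d1 \<in> ?D" "d = c [^] (j::int) \<otimes> d1 [^] (p ^ M)" using iter[OF dD] by blast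
    then show ?thesis using M[of d1] derived_closed c by auto
  qed
  then show "d \<in> ?D \<Longrightarrow> \<exists>j::int. d = comm G x y [^] j" unfolding c_def by blast
  \<comment> \<open>Centrality of \<open>c\<close> modulo \<open>P\<close> makes
    \<open>[g, c]\<close> the \<open>p\<close>-th power of an element of \<open>G'\<close>, that is,
    of a power of \<open>c\<close>.\<close>
  assume g: "g \<in> carrier G"
  have "comm L (r g) (r c) = \<one>\<^bsub>L\<^esub>"
    using r.H.comm_eq_one_iff[of "r g" "r c"] central[OF cD, of "r g"] g rc by simp
  then have "comm G g c \<in> P"
    using ker[OF comm_closed[OF g c]] unfolding r.hom_comm[OF g c] by blast
  then obtain d where d: "d \<in> ?D" "comm G g c = d [^] p" unfolding P_def by blast
  obtain j where "d = c [^] (j::int)" using Dc d(1) by blast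
  then have "comm G g c = c [^] (int p * j)"
    using d(2) c by (simp add: int_pow_pow mult.commute flip: int_pow_int)
  then show "\<exists>j::int. comm G g (comm G x y) = comm G x y [^] (int p * j)" unfolding c_def by blast
qed

text \<open>Write \<open>g u g^-1 = [g, u] u\<close>; the commutator lies in the power subgroup of
  the preceding term, hence in the chain member itself.\<close>

lemma pn_chain_normal:
  assumes "pn_chain p G H n" "i \<le> n"
  shows "H i \<lhd> G"
proof -
  have sub: "subgroup (H j) G" if "j \<le> n" for j using assms(1) that unfolding pn_chain_def by blast
  have "g \<otimes> u \<otimes> inv g \<in> H i" if g: "g \<in> carrier G" and u: "u \<in> H i" for g u
  proof (cases i)
    case 0
    then have "u = \<one>" using u assms(1) unfolding pn_chain_def by auto
    then show ?thesis using g u by simp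
  next
    case (Suc j)
    interpret Hi: subgroup "H i" G using sub assms(2) by blast
    have uG: "u \<in> carrier G" using u Hi.subset by blast
    have j: "j < n" using Suc assms(2) by simp
    have "comm G u g \<in> power_subgroup G (H j) p"
      using assms(1) j u g unfolding pn_chain_def Suc by blast
    also have "\<dots> \<subseteq> H j" using sub j by (intro power_subgroup_subset) auto
    also have "\<dots> \<subseteq> H i" using assms(1) j unfolding pn_chain_def Suc by blast
    finally have "comm G g u \<otimes> u \<in> H i"
      unfolding inv_commutator[OF uG g, symmetric] using u by blast
    also have "comm G g u \<otimes> u = g \<otimes> u \<otimes> inv g" using g uG by (simp add: m_assoc)
    finally show ?thesis .
  qed
  then show ?thesis using sub assms(2) unfolding normal_inv_iff by blast
qed

text \<open>Descending induction on the chain with the predicate \<open>E\<close>: both statements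
  hold modulo \<open>H i\<close>. At \<open>i = n\<close> there is nothing to prove. From
  \<open>Suc i\<close> to \<open>i\<close>, \<open>derived_cyclic_step\<close> is applied to the
  quotient by \<open>H i\<close> with the image of \<open>H (Suc i)\<close> as central set. At
  \<open>i = 0\<close> the error term is trivial.\<close>

lemma derived_cyclic:
  fixes M :: nat
  assumes p: "Factorial_Ring.prime p"
    and M: "\<And>g. g \<in> carrier G \<Longrightarrow> g [^] (p ^ M) = \<one>"
    and xy: "x \<in> carrier G" "y \<in> carrier G" "generate G {x, y} = carrier G"
    and pw: "derived G (carrier G) \<subseteq> power_subgroup G (carrier G) (powerful_exponent p)"
    and chain: "pn_chain p G H n"
  shows "d \<in> derived G (carrier G) \<Longrightarrow> \<exists>j::int. d = comm G x y [^] j"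
    and "g \<in> carrier G \<Longrightarrow> \<exists>j::int. comm G g (comm G x y) = comm G x y [^] (int p * j)"
proof -
  define c where "c = comm G x y"
  let ?D = "derived G (carrier G)"
  have cD: "c \<in> ?D" unfolding c_def using xy(1,2) by (rule comm_in_derived)
  have c: "c \<in> carrier G" using cD by (rule derived_closed)
  define E where "E i \<longleftrightarrow> (\<forall>d\<in>?D. \<exists>h\<in>H i. \<exists>j::int. d = h \<otimes> c [^] j) \<and>
      (\<forall>g\<in>carrier G. \<exists>h\<in>H i. \<exists>j::int. comm G g c = h \<otimes> c [^] (int p * j))" for i
  have "E 0"
  proof (rule inc_induct[of 0 n])
    have Hn: "H n = carrier G" using chain unfolding pn_chain_def by blast
    have triv: "\<exists>h\<in>H n. \<exists>j::int. u = h \<otimes> c [^] (k * j)" if "u \<in> carrier G" for u k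
      unfolding Hn using that c by (intro bexI[of _ u] exI[of _ 0]) auto
    show "E n" unfolding E_def
      using triv[OF derived_closed, of _ 1] triv[OF comm_closed[OF _ c], of _ "int p"] by auto
  next
    fix i assume i: "0 \<le> i" "i < n" and IH: "E (Suc i)"
    have N: "H i \<lhd> G" using chain i(2) by (intro pn_chain_normal) auto
    define r where "r = (\<lambda>x. H i #> x)"
    define L where "L = G Mod H i"
    interpret r: group_hom G L r unfolding L_def r_def by (rule quotient_hom(1)[OF N])
    have carrL: "carrier L = r ` carrier G" unfolding L_def r_def by (rule quotient_hom(2)[OF N])
    have ker: "r u = \<one>\<^bsub>L\<^esub> \<longleftrightarrow> u \<in> H i" if "u \<in> carrier G" for u
      unfolding L_def r_def using that by (rule quotient_hom(3)[OF N])
    have DL: "derived L (carrier L) = r ` ?D" unfolding L_def r_def by (rule derived_img_Mod[OF N])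
    have HS: "H (Suc i) \<subseteq> carrier G"
      using chain i(2) unfolding pn_chain_def by (meson Suc_leI subgroup.subset)
    have rc: "comm L (r x) (r y) = r c" unfolding c_def r.hom_comm[OF xy(1,2)] ..
    have Mexp: "l [^]\<^bsub>L\<^esub> (p ^ M) = \<one>\<^bsub>L\<^esub>" if l: "l \<in> carrier L" for l
    proof -
      obtain g where g: "g \<in> carrier G" "l = r g" using l unfolding carrL by blast
      then show ?thesis using M[OF g(1)] by (simp flip: r.hom_nat_pow)
    qed
    have gen: "generate L {r x, r y} = carrier L"
      using r.generate_img[of "{x, y}"] xy carrL by simp
    have pwL: "derived L (carrier L) \<subseteq> power_subgroup L (carrier L) (powerful_exponent p)"
      unfolding DL unfolding carrL r.power_subgroup_img[OF subset_refl] using pw by (rule image_mono)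
    \<comment> \<open>\<open>[H (Suc i), G]\<close> lies in the power subgroup of
      \<open>H i\<close>, hence in \<open>H i\<close>, so the image of \<open>H (Suc i)\<close> is
      central.\<close>
    have cent: "l \<otimes>\<^bsub>L\<^esub> l' = l' \<otimes>\<^bsub>L\<^esub> l" if l: "l \<in> r ` H (Suc i)" "l' \<in> carrier L" for l l'
    proof -
      obtain h g where h: "h \<in> H (Suc i)" "l = r h" and g: "g \<in> carrier G" "l' = r g"
        using l unfolding carrL by blast
      have hG: "h \<in> carrier G" using h HS by blast
      have "comm G h g \<in> power_subgroup G (H i) p"
        using chain i(2) h g unfolding pn_chain_def by blast
      also have "\<dots> \<subseteq> H i" using N by (intro power_subgroup_subset) (simp add: normal_def)
      finally have "comm L l l' = \<one>\<^bsub>L\<^esub>"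
        unfolding h g r.hom_comm[OF hG g(1), symmetric] using ker[OF comm_closed[OF hG g(1)]] by blast
      then show ?thesis using r.H.comm_eq_one_iff[of l l'] hG g h by simp
    qed
    have DE: "\<exists>h\<in>r ` H (Suc i). \<exists>j::int. e = h \<otimes>\<^bsub>L\<^esub> comm L (r x) (r y) [^]\<^bsub>L\<^esub> j"
      if e: "e \<in> derived L (carrier L)" for e
    proof -
      obtain d where d: "d \<in> ?D" "e = r d" using e unfolding DL by blast
      obtain h j where hj: "h \<in> H (Suc i)" "d = h \<otimes> c [^] (j::int)"
        using IH d(1) unfolding E_def by blast
      have "h \<in> carrier G" using hj HS by blast
      then have "e = r h \<otimes>\<^bsub>L\<^esub> r c [^]\<^bsub>L\<^esub> j" unfolding d(2) hj(2) using c by (simp add: r.hom_int_pow)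
      then show ?thesis unfolding rc using hj(1) by blast
    qed
    have actE: "\<exists>h\<in>r ` H (Suc i). \<exists>j::int. comm L l (comm L (r x) (r y)) = h \<otimes>\<^bsub>L\<^esub> comm L (r x) (r y) [^]\<^bsub>L\<^esub> (int p * j)"
      if l: "l \<in> carrier L" for l
    proof -
      obtain g where g: "g \<in> carrier G" "l = r g" using l unfolding carrL by blast
      obtain h j where hj: "h \<in> H (Suc i)" "comm G g c = h \<otimes> c [^] (int p * j)"
        using IH g(1) unfolding E_def by blast
      have "h \<in> carrier G" using hj HS by blast
      then have "comm L l (r c) = r h \<otimes>\<^bsub>L\<^esub> r c [^]\<^bsub>L\<^esub> (int p * j)"
        unfolding g(2) r.hom_comm[OF g(1) c, symmetric] hj(2) using c by (simp add: r.hom_int_pow)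
      then show ?thesis unfolding rc using hj(1) by blast
    qed
    have HL: "r ` H (Suc i) \<subseteq> carrier L" unfolding carrL using HS by blast
    have rxy: "r x \<in> carrier L" "r y \<in> carrier L" using xy by simp_all
    note step = r.H.derived_cyclic_step[OF p Mexp rxy gen pwL HL cent DE actE, unfolded rc]
    have lift: "\<exists>h\<in>H i. u = h \<otimes> v" if "u \<in> carrier G" "v \<in> carrier G" "r u = r v" for u v
    proof -
      have "u \<otimes> inv v \<in> H i" using r.hom_eq_iff[OF that(1,2) ker] that(3) by simp
      moreover have "u = (u \<otimes> inv v) \<otimes> v" using that by (simp add: m_assoc)
      ultimately show ?thesis by blast
    qed
    show "E i"
      unfolding E_def
    proof (intro conjI ballI)
      fix d assume d: "d \<in> ?D"
      have "r d \<in> derived L (carrier L)" unfolding DL using d by blast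
      then obtain j where "r d = r c [^]\<^bsub>L\<^esub> (j::int)" using step(1) by blast
      then have "r d = r (c [^] j)" using c by (simp add: r.hom_int_pow)
      from lift[OF derived_closed[OF d] int_pow_closed[OF c] this]
      show "\<exists>h\<in>H i. \<exists>j::int. d = h \<otimes> c [^] j" by blast
    next
      fix g assume g: "g \<in> carrier G"
      obtain j where "comm L (r g) (r c) = r c [^]\<^bsub>L\<^esub> (int p * j)" using step(2)[of "r g"] g by auto
      then have "r (comm G g c) = r (c [^] (int p * j))" 
        unfolding r.hom_comm[OF g c] using c by (simp only: r.hom_int_pow)
      from lift[OF comm_closed[OF g c] int_pow_closed[OF c] this]
      show "\<exists>h\<in>H i. \<exists>j::int. comm G g c = h \<otimes> c [^] (int p * j)" by blast
    qed
  qed simp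
  moreover have "H 0 = {\<one>}" using chain unfolding pn_chain_def by blast
  ultimately have "\<forall>d\<in>?D. \<exists>j::int. d = c [^] j" "\<forall>g\<in>carrier G. \<exists>j::int. comm G g c = c [^] (int p * j)"
    unfolding E_def using c by simp_all
  then show "d \<in> ?D \<Longrightarrow> \<exists>j::int. d = comm G x y [^] j"
    and "g \<in> carrier G \<Longrightarrow> \<exists>j::int. comm G g (comm G x y) = comm G x y [^] (int p * j)"
    unfolding c_def by blast+
qed

end

section \<open>Class two quotients\<close>

text \<open>Describes the quotient by \<open><c^p>\<close>: there \<open>c\<close> is central of
  order exactly \<open>p\<close>. The bound \<open>M\<close> on the exponent is inherited from the
  original group.\<close>

locale class2_pair = group G for G (structure) +
  fixes p M :: nat and x y c
  assumes p: "Factorial_Ring.prime p"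
    and M: "\<And>g. g \<in> carrier G \<Longrightarrow> g [^] (p ^ M) = \<one>"
    and x: "x \<in> carrier G" and y: "y \<in> carrier G" and gen: "generate G {x, y} = carrier G"
    and c_def: "c = comm G x y"
    and central: "\<And>g. g \<in> carrier G \<Longrightarrow> c \<otimes> g = g \<otimes> c"
    and exp_c: "c [^] p = \<one>" and c_ne: "c \<noteq> \<one>"
begin

lemma c: "c \<in> carrier G" unfolding c_def using x y by simp

lemma c_pow_comm: "g \<in> carrier G \<Longrightarrow> c [^] (i::int) \<otimes> g = g \<otimes> c [^] i"
  using commute_int_pow[OF c _ central, of g i 1] c by simp

lemma c_pow_p: "c [^] (int p * i) = \<one>"
proof -
  have "c [^] (int p * i) = (c [^] p) [^] i" using c by (simp add: int_pow_pow flip: int_pow_int)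
  then show ?thesis by (simp add: exp_c)
qed

lemma comm_pow: 
  assumes "u \<in> carrier G" "v \<in> carrier G"
  shows "\<exists>i::int. comm G u v = c [^] i"
proof -
  have "generate G {c} \<lhd> G"
    unfolding normal_inv_iff
  proof (intro conjI ballI)
    show "subgroup (generate G {c}) G" using c by (intro generate_is_subgroup) simp
    fix g a assume g: "g \<in> carrier G" and a: "a \<in> generate G {c}"
    then obtain i where i: "a = c [^] (i::int)" unfolding generate_pow[OF c] by blast
    have "g \<otimes> a \<otimes> inv g = a"
      unfolding i c_pow_comm[OF g, symmetric] using g c by (simp add: m_assoc)
    then show "g \<otimes> a \<otimes> inv g \<in> generate G {c}" using a by simp
  qed
  then have "derived G (carrier G) \<subseteq> generate G {c}"
    using x y gen by (rule derived_subset_normal2) (simp add: c_def[symmetric] generate.incl)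
  then show ?thesis using comm_in_derived[OF assms] unfolding generate_pow[OF c] by blast
qed

lemma swap_pow:
  assumes "u \<in> carrier G" "v \<in> carrier G"
  shows "\<exists>i::int. u \<otimes> v = v \<otimes> u \<otimes> c [^] i"
proof -
  obtain i where "comm G u v = c [^] (i::int)" using comm_pow[OF assms] by blast
  then have "u \<otimes> v = c [^] i \<otimes> (v \<otimes> u)" using comm_swap[OF assms] assms c by (simp add: m_assoc)
  also have "\<dots> = v \<otimes> u \<otimes> c [^] i" using assms by (intro c_pow_comm) simp
  finally show ?thesis by blast
qed

lemma normal_form:
  assumes "g \<in> carrier G"
  shows "\<exists>(\<alpha>::int) (\<beta>::int) (\<gamma>::int). g = x [^] \<alpha> \<otimes> y [^] \<beta> \<otimes> c [^] \<gamma>"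
proof -
  have "g \<in> generate G {x, y}" using assms gen by simp
  then show ?thesis
  proof (induction rule: generate.induct)
    case one
    have "\<one> = x [^] (0::int) \<otimes> y [^] (0::int) \<otimes> c [^] (0::int)" by simp
    then show ?case by blast
  next
    case (incl h)
    have "x = x [^] (1::int) \<otimes> y [^] (0::int) \<otimes> c [^] (0::int)" "y = x [^] (0::int) \<otimes> y [^] (1::int) \<otimes> c [^] (0::int)" using x y by simp_all
    then show ?case using incl by blast
  next
    case (inv h)
    have "inv x = x [^] (- 1::int) \<otimes> y [^] (0::int) \<otimes> c [^] (0::int)" "inv y = x [^] (0::int) \<otimes> y [^] (- 1::int) \<otimes> c [^] (0::int)"
      using x y by (simp_all add: int_pow_neg)
    then show ?case using inv by blast
  next
    case (eng h1 h2)
    then obtain a b i a' b' i' :: int where h: "h1 = x [^] a \<otimes> y [^] b \<otimes> c [^] i"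
      "h2 = x [^] a' \<otimes> y [^] b' \<otimes> c [^] i'" by blast
    obtain j where j: "y [^] b \<otimes> x [^] a' = x [^] a' \<otimes> y [^] b \<otimes> c [^] (j::int)"
      using swap_pow[of "y [^] b" "x [^] a'"] x y by auto
    have "h1 \<otimes> h2 = x [^] a \<otimes> y [^] b \<otimes> (c [^] i \<otimes> (x [^] a' \<otimes> (y [^] b' \<otimes> c [^] i')))"
      unfolding h using x y c by (simp add: m_assoc)
    also have "\<dots> = x [^] a \<otimes> (y [^] b \<otimes> x [^] a') \<otimes> (y [^] b' \<otimes> (c [^] i' \<otimes> c [^] i))"
      using c_pow_comm[of "x [^] a' \<otimes> (y [^] b' \<otimes> c [^] i')" i] x y c by (simp add: m_assoc)
    also have "\<dots> = (x [^] a \<otimes> x [^] a') \<otimes> y [^] b \<otimes> (c [^] j \<otimes> (y [^] b' \<otimes> (c [^] i' \<otimes> c [^] i)))"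
      unfolding j using x y c by (simp add: m_assoc)
    also have "\<dots> = (x [^] a \<otimes> x [^] a') \<otimes> (y [^] b \<otimes> y [^] b') \<otimes> (c [^] i' \<otimes> c [^] i \<otimes> c [^] j)"
      using c_pow_comm[of "y [^] b' \<otimes> (c [^] i' \<otimes> c [^] i)" j] x y c by (simp add: m_assoc)
    also have "\<dots> = x [^] (a + a') \<otimes> y [^] (b + b') \<otimes> c [^] (i' + i + j)"
      using x y c by (simp add: int_pow_mult)
    finally show ?case by blast
  qed
qed

text \<open>Symmetry in the two generators, so that results about the exponent of \<open>x\<close>
  in a normal form also cover \<open>y\<close>.\<close>

lemma swap_class2_pair: "class2_pair G p M y x (inv c)"
proof unfold_locales
  show "generate G {y, x} = carrier G" using gen by (simp add: insert_commute)
  show "inv c = comm G y x" unfolding c_def using x y by (rule inv_commutator)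
  show "inv c \<otimes> g = g \<otimes> inv c" if "g \<in> carrier G" for g
    using c_pow_comm[OF that, of "-1"] c by (simp add: int_pow_neg)
  show "inv c [^] p = \<one>" using exp_c c by (metis inv_one nat_pow_inv)
  show "inv c \<noteq> \<one>" using c_ne c inv_eq_1_iff by blast
qed (use p M x y in auto)

text \<open>The factors \<open>y^\<beta>\<close> and \<open>c^\<gamma>\<close> commute with
  \<open>y\<close>; only \<open>[x^\<alpha>, y]\<close> contributes, and it is
  \<open>c^\<alpha>\<close> because \<open>c\<close> is central.\<close>

lemma comm_normal_form:
  assumes "g = x [^] (\<alpha>::int) \<otimes> y [^] (\<beta>::int) \<otimes> c [^] (\<gamma>::int)"
  shows "comm G g y = c [^] \<alpha>"
proof (rule comm_eqI)
  have "inv y \<otimes> x = (c \<otimes> x) \<otimes> inv y"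
  proof -
    have "x \<otimes> y = y \<otimes> (c \<otimes> x)"
      using comm_swap[OF x y] central[OF y] x y c unfolding c_def[symmetric] by (simp flip: m_assoc)
    then have "inv y \<otimes> (x \<otimes> y) \<otimes> inv y = inv y \<otimes> (y \<otimes> (c \<otimes> x)) \<otimes> inv y" by simp
    moreover have "inv y \<otimes> (x \<otimes> y) \<otimes> inv y = inv y \<otimes> x" using x y by (simp add: m_assoc)
    moreover have "inv y \<otimes> (y \<otimes> (c \<otimes> x)) \<otimes> inv y = c \<otimes> x \<otimes> inv y"
      using x y c by (simp flip: m_assoc)
    ultimately show ?thesis by simp
  qed
  then have "inv y \<otimes> x [^] \<alpha> = (c \<otimes> x) [^] \<alpha> \<otimes> inv y"
    using x y c by (intro conj_int_pow) auto
  also have "(c \<otimes> x) [^] \<alpha> = c [^] \<alpha> \<otimes> x [^] \<alpha>"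
    using x c central[OF x] by (intro int_pow_mult_distrib) auto
  finally have "y \<otimes> (inv y \<otimes> x [^] \<alpha>) \<otimes> y = y \<otimes> (c [^] \<alpha> \<otimes> x [^] \<alpha> \<otimes> inv y) \<otimes> y" by simp
  moreover have "y \<otimes> (inv y \<otimes> x [^] \<alpha>) \<otimes> y = x [^] \<alpha> \<otimes> y" using x y by (simp flip: m_assoc)
  ultimately have 1: "x [^] \<alpha> \<otimes> y = y \<otimes> (c [^] \<alpha> \<otimes> x [^] \<alpha>)" using x y c by (simp add: m_assoc)
  have "g \<otimes> y = x [^] \<alpha> \<otimes> (y [^] \<beta> \<otimes> (y \<otimes> c [^] \<gamma>))"
    unfolding assms using c_pow_comm[OF y] x y c by (simp add: m_assoc)
  also have "y [^] \<beta> \<otimes> (y \<otimes> c [^] \<gamma>) = y \<otimes> (y [^] \<beta> \<otimes> c [^] \<gamma>)"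
    using commute_int_pow[OF y y refl, of \<beta> 1] y c by (intro left_commuteI) auto
  also have "x [^] \<alpha> \<otimes> (y \<otimes> (y [^] \<beta> \<otimes> c [^] \<gamma>)) = (x [^] \<alpha> \<otimes> y) \<otimes> (y [^] \<beta> \<otimes> c [^] \<gamma>)"
    using x y c by (simp add: m_assoc)
  also have "\<dots> = y \<otimes> c [^] \<alpha> \<otimes> (x [^] \<alpha> \<otimes> y [^] \<beta> \<otimes> c [^] \<gamma>)"
    unfolding 1 using x y c by (simp add: m_assoc)
  finally show "g \<otimes> y = c [^] \<alpha> \<otimes> y \<otimes> g" unfolding assms c_pow_comm[OF y] .
qed (use assms x y c in auto)

text \<open>The subgroup contains \<open>[g, y] = c^\<alpha>\<close> and so \<open>c\<close>.
  Stripping \<open>y^\<beta>\<close> and \<open>c^\<gamma>\<close> off \<open>g\<close> leaves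
  \<open>x^\<alpha>\<close>, a unit power of \<open>x\<close>.\<close>

lemma generate_normal_form:
  assumes g: "g = x [^] (\<alpha>::int) \<otimes> y [^] (\<beta>::int) \<otimes> c [^] (\<gamma>::int)" and \<alpha>: "\<not> int p dvd \<alpha>"
  shows "generate G {g, y} = carrier G"
proof -
  have gG: "g \<in> carrier G" unfolding g using x y c by simp
  let ?W = "generate G {g, y}"
  have W: "subgroup ?W G" using gG y by (intro generate_is_subgroup) simp
  interpret W: subgroup ?W G by (rule W)
  have gW: "g \<in> ?W" and yW: "y \<in> ?W" by (simp_all add: generate.incl)
  have "comm G g y \<in> ?W" using gW yW by simp
  then have "c [^] \<alpha> \<in> ?W" unfolding comm_normal_form[OF g] .
  moreover obtain j where "c [^] (\<alpha> * j) = c" using int_pow_unit[OF p c, of 1 \<alpha>] exp_c \<alpha> by auto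
  ultimately have cW: "c \<in> ?W" using W c by (metis int_pow_pow subgroup_int_pow_closed)
  have "x [^] \<alpha> = g \<otimes> inv (c [^] \<gamma>) \<otimes> inv (y [^] \<beta>)"
    unfolding g using x y c by (simp add: m_assoc)
  moreover have "inv (c [^] \<gamma>) \<in> ?W" "inv (y [^] \<beta>) \<in> ?W" using W cW yW by (simp_all add: subgroup_int_pow_closed)
  ultimately have "x [^] \<alpha> \<in> ?W" using gW by simp
  moreover obtain j where "x [^] (\<alpha> * j) = x" using int_pow_unit[OF p x M[OF x] \<alpha>] by auto
  ultimately have "x \<in> ?W" using W x by (metis int_pow_pow subgroup_int_pow_closed)
  then have "generate G {x, y} \<subseteq> ?W" using yW W by (intro generate_subgroup_incl) auto
  then show ?thesis using gen W.subset by simp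
qed

text \<open>An element outside the Frattini subgroup belongs to a generating pair: the partner is
  \<open>y\<close> if \<open>p\<close> does not divide \<open>\<alpha>\<close>, with commutator
  \<open>c^\<alpha>\<close>, and otherwise \<open>x\<close>, with commutator
  \<open>c^(-\<beta>)\<close>.\<close>

lemma generating_partner:
  assumes g: "g = x [^] (\<alpha>::int) \<otimes> y [^] (\<beta>::int) \<otimes> c [^] (\<gamma>::int)" and nd: "\<not> (int p dvd \<alpha> \<and> int p dvd \<beta>)"
  shows "\<exists>h\<in>carrier G. generate G {g, h} = carrier G \<and> (\<exists>i::int. comm G g h = c [^] i \<and> \<not> int p dvd i)"
proof (cases "int p dvd \<alpha>")
  case False
  then show ?thesis using generate_normal_form[OF g] comm_normal_form[OF g] y by blast
next
  case True
  then have \<beta>: "\<not> int p dvd \<beta>" using nd by simp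
  interpret s: class2_pair G p M y x "inv c" by (rule swap_class2_pair)
  obtain j where j: "x [^] \<alpha> \<otimes> y [^] \<beta> = y [^] \<beta> \<otimes> x [^] \<alpha> \<otimes> c [^] (j::int)"
    using swap_pow[of "x [^] \<alpha>" "y [^] \<beta>"] x y by auto
  have neg: "inv c [^] (i::int) = c [^] (- i)" for i using c by (simp add: int_pow_inv int_pow_neg)
  have "g = y [^] \<beta> \<otimes> x [^] \<alpha> \<otimes> inv c [^] (- j - \<gamma>)"
    unfolding g j neg using x y c by (simp add: m_assoc add.commute flip: int_pow_mult)
  from s.generate_normal_form[OF this \<beta>] s.comm_normal_form[OF this] show ?thesis
    unfolding neg using x \<beta> by (intro bexI[of _ x] conjI exI[of _ "- \<beta>"]) auto
qed

lemma pow_mult_upto_c: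
  assumes "u \<in> carrier G" "v \<in> carrier G"
  shows "\<exists>i::int. \<forall>N. (u \<otimes> v) [^] (N::nat) = u [^] N \<otimes> v [^] N \<otimes> c [^] (i * int (N * (N - 1) div 2))"
proof -
  obtain i where i: "comm G v u = c [^] (i::int)" using comm_pow assms by blast
  have "(u \<otimes> v) [^] N = u [^] N \<otimes> v [^] N \<otimes> (c [^] i) [^] (N * (N - 1) div 2)" for N :: nat
    using comm_swap[OF assms(2,1)] unfolding i
    by (intro pow_mult_class2 assms c_pow_comm int_pow_closed c)
  then show ?thesis using c by (intro exI[of _ i]) (simp add: int_pow_pow flip: int_pow_int)
qed

text \<open>In the class two quotient an element of the Frattini subgroup is a \<open>p\<close>-th power up to a power of \<open>c\<close>.\<close>

lemma p_power_lift:
  assumes g: "g = x [^] (int p * \<alpha>) \<otimes> y [^] (int p * \<beta>) \<otimes> c [^] (\<gamma>::int)" and k: "k \<ge> 1"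
  shows "\<exists>u\<in>carrier G. g [^] (p ^ k) = u [^] (p ^ (k + 1))"
proof -
  define u where "u = x [^] \<alpha> \<otimes> y [^] \<beta>"
  have u: "u \<in> carrier G" unfolding u_def using x y by simp
  obtain i where i: "\<And>N. u [^] (N::nat) = (x [^] \<alpha>) [^] N \<otimes> (y [^] \<beta>) [^] N \<otimes> c [^] (i * int (N * (N - 1) div 2))"
    unfolding u_def using pow_mult_upto_c[of "x [^] \<alpha>" "y [^] \<beta>"] x y by auto
  define t where "t = i * int (p * (p - 1) div 2)"
  have "u [^] p = x [^] (int p * \<alpha>) \<otimes> y [^] (int p * \<beta>) \<otimes> c [^] t"
    unfolding i t_def using x y by (simp add: int_pow_pow mult.commute flip: int_pow_int)
  then have "u [^] p \<otimes> c [^] (\<gamma> - t) = g"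
    unfolding g using x y c by (simp add: m_assoc int_pow_mult[symmetric])
  \<comment> \<open>\<open>g\<close> and \<open>u^p\<close> differ by a power of \<open>c\<close>,
    which the exponent \<open>p^k\<close> removes because \<open>k >= 1\<close>.\<close>
  then have "g [^] (p ^ k) = (u [^] p) [^] (p ^ k) \<otimes> (c [^] (\<gamma> - t)) [^] (p ^ k)"
    using pow_mult_distrib[OF c_pow_comm[symmetric], of "u [^] p" "\<gamma> - t" "p ^ k"] u c by auto
  also have "(c [^] (\<gamma> - t)) [^] (p ^ k) = c [^] (int p * ((\<gamma> - t) * int (p ^ (k - 1))))"
    using c k by (cases k) (simp_all add: int_pow_pow mult_ac flip: int_pow_int)
  also have "\<dots> = \<one>" by (rule c_pow_p)
  finally show ?thesis using u by (intro bexI[of _ u]) (simp_all add: nat_pow_pow)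
qed

text \<open>\<open>(u v)^q\<close> differs from \<open>u^q v^q\<close> by a power of
  \<open>c\<close> with exponent divisible by \<open>p\<close>, so the \<open>q\<close>-th powers
  are closed under products and there is no need to generate.\<close>

lemma power_subgroup_powers:
  assumes S: "subgroup S G" and dvd: "p dvd q * (q - 1) div 2" and g: "g \<in> power_subgroup G S q"
  shows "\<exists>u\<in>S. g = u [^] q"
  using g unfolding power_subgroup_def
proof (induction rule: generate.induct)
  interpret S: subgroup S G by (rule S)
  case one
  show ?case by (intro bexI[of _ \<one>]) auto
next
  case (incl h)
  then show ?case by blast
next
  interpret S: subgroup S G by (rule S)
  case (inv h)
  then obtain u where u: "u \<in> S" "h = u [^] q" by blast
  then have "inv h = (inv u) [^] q" using S.subset by (auto simp: nat_pow_inv)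
  then show ?case using u(1) by blast
next
  interpret S: subgroup S G by (rule S)
  case (eng h1 h2)
  then obtain u v where uv: "u \<in> S" "h1 = u [^] q" "v \<in> S" "h2 = v [^] q" by blast
  have uvG: "u \<in> carrier G" "v \<in> carrier G" using uv S.subset by auto
  obtain t where t: "q * (q - 1) div 2 = p * t" using dvd by blast
  obtain i where "(u \<otimes> v) [^] q = u [^] q \<otimes> v [^] q \<otimes> c [^] (i * int (q * (q - 1) div 2))"
    using pow_mult_upto_c[OF uvG] by blast
  also have "i * int (q * (q - 1) div 2) = int p * (i * int t)" unfolding t by simp
  finally have "h1 \<otimes> h2 = (u \<otimes> v) [^] q" unfolding uv c_pow_p using uvG by simp
  then show ?case using uv by blast
qed

text \<open>Powerfulness provides some root of \<open>c\<close>. Taking \<open>k\<close> largest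
  among all root degrees forces the root out of the Frattini subgroup, and so gives it a generating
  partner.\<close>

lemma deep_root_of_c:
  assumes pw: "derived G (carrier G) \<subseteq> power_subgroup G (carrier G) (powerful_exponent p)"
    and chain: "pn_chain p G H n"
  obtains k w h i where "k \<ge> 2" "w \<in> carrier G" "h \<in> carrier G" "w [^] (p ^ k) = c"
    "generate G {w, h} = carrier G" "comm G w h = c [^] (i::int)" "\<not> int p dvd i"
    "\<And>k' v. v \<in> carrier G \<Longrightarrow> v [^] (p ^ k') = c \<Longrightarrow> k' \<le> k"
proof -
  let ?q = "powerful_exponent p"
  define Q where "Q k \<longleftrightarrow> (\<exists>v\<in>carrier G. v [^] (p ^ k) = c)" for k
  have "c \<in> derived G (carrier G)" unfolding c_def using x y by (rule comm_in_derived)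
  then obtain u where u: "u \<in> carrier G" "c = u [^] ?q"
    using power_subgroup_powers[OF subgroup_self powerful_exponent_dvd(2)[OF p]] pw by blast
  \<comment> \<open>\<open>p ^ k0\<close> is the powerful exponent, so \<open>c\<close> is known to
    be a \<open>p ^ k0\<close>-th power.\<close>
  define k0 :: nat where "k0 = (if p = 2 then 2 else 1)"
  have "?q = p ^ k0" by (simp add: powerful_exponent_def k0_def)
  then have Q0: "Q k0" unfolding Q_def using u by auto
  \<comment> \<open>Powers of degree \<open>p^M\<close> are trivial while \<open>c\<close> is not;
    hence a greatest degree exists.\<close>
  have bound: "k < M" if "Q k" for k
  proof (rule ccontr)
    assume "\<not> k < M"
    then have "p ^ M dvd p ^ k" by (intro le_imp_power_dvd) simp
    then have "v [^] (p ^ k) = \<one>" if "v \<in> carrier G" for v using pow_dvd_one[OF that M[OF that]] by blast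
    then show False using \<open>Q k\<close> c_ne unfolding Q_def by auto
  qed
  then obtain k where k: "Q k" "\<And>k'. Q k' \<Longrightarrow> k' \<le> k"
    using ex_has_greatest_nat[of Q k0 "\<lambda>k. k" M] Q0 by (metis less_imp_le_nat)
  have k1: "k \<ge> 1" using k(2)[OF Q0] by (simp add: k0_def split: if_splits)
  \<comment> \<open>If both exponents of \<open>w\<close> were divisible by \<open>p\<close>,
    \<open>p_power_lift\<close> would turn \<open>w\<close> into a root of degree
    \<open>p^(k+1)\<close>.\<close>
  have partner: "\<exists>h\<in>carrier G. generate G {w, h} = carrier G \<and> (\<exists>i::int. comm G w h = c [^] i \<and> \<not> int p dvd i)"
    if w: "w \<in> carrier G" "w [^] (p ^ k) = c" for w
  proof -
    obtain \<alpha> \<beta> \<gamma> :: int where nf: "w = x [^] \<alpha> \<otimes> y [^] \<beta> \<otimes> c [^] \<gamma>" using normal_form[OF w(1)] by blast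
    have "\<not> (int p dvd \<alpha> \<and> int p dvd \<beta>)"
    proof
      assume "int p dvd \<alpha> \<and> int p dvd \<beta>"
      then obtain \<alpha>' \<beta>' where "\<alpha> = int p * \<alpha>'" "\<beta> = int p * \<beta>'" by blast
      then obtain u where "u \<in> carrier G" "w [^] (p ^ k) = u [^] (p ^ (k + 1))"
        using p_power_lift[OF _ k1] nf by blast
      then have "Q (k + 1)" using w unfolding Q_def by metis
      then show False using k(2)[of "k + 1"] by simp
    qed
    then show ?thesis by (rule generating_partner[OF nf])
  qed
  \<comment> \<open>Here \<open>k = 1\<close> can only occur for odd \<open>p\<close>. A
    \<open>p\<close>-th root \<open>v\<close> of \<open>c\<close> in \<open>H (Suc i)\<close> has a
    partner \<open>h\<close> with \<open>[v, h]\<close> generating \<open><c>\<close>. Since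
    \<open>[v, h]\<close> lies in the power subgroup of \<open>H i\<close>, so does
    \<open>c\<close>, which is then a \<open>p\<close>-th power of an element of \<open>H i\<close>.
    At \<open>i = 0\<close> this contradicts \<open>c\<close> being nontrivial.\<close>
  have k2: "k \<ge> 2"
  proof (rule ccontr)
    assume "\<not> k \<ge> 2"
    then have keq: "k = 1" and q: "?q = p"
      using k1 k(2)[OF Q0] by (auto simp: k0_def powerful_exponent_def split: if_splits)
    have sub: "subgroup (H i) G" if "i \<le> n" for i using chain that unfolding pn_chain_def by blast
    have "\<exists>v\<in>H 0. v [^] p = c"
    proof (rule inc_induct[of 0 n])
      show "\<exists>v\<in>H n. v [^] p = c" using k(1) chain unfolding keq Q_def pn_chain_def by simp
    next
      fix i assume i: "0 \<le> i" "i < n" and "\<exists>v\<in>H (Suc i). v [^] p = c"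
      then obtain v where v: "v \<in> H (Suc i)" "v [^] p = c" by blast
      have vG: "v \<in> carrier G" using sub[of "Suc i"] i v(1) subgroup.subset by fastforce
      obtain h j where h: "h \<in> carrier G" "comm G v h = c [^] (j::int)" "\<not> int p dvd j"
        using partner[of v] vG v(2) unfolding keq by auto
      let ?P = "power_subgroup G (H i) p"
      have Hi: "subgroup (H i) G" using sub i by simp
      have P: "subgroup ?P G" unfolding power_subgroup_def
        using subgroup.subset[OF Hi] by (intro generate_is_subgroup) auto
      have "c [^] j \<in> ?P" using chain i(2) v(1) h unfolding pn_chain_def by metis
      moreover obtain j' where "c [^] (j * j') = c" using int_pow_unit[OF p c, of 1 j] exp_c h(3) by auto
      ultimately have "c \<in> ?P" using P c by (metis int_pow_pow subgroup_int_pow_closed)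
      then show "\<exists>v\<in>H i. v [^] p = c"
        using power_subgroup_powers[OF Hi] powerful_exponent_dvd(2)[OF p] unfolding q by metis
    qed simp
    then show False using chain c_ne unfolding pn_chain_def by simp
  qed
  obtain w where w: "w \<in> carrier G" "w [^] (p ^ k) = c" using k(1) unfolding Q_def by blast
  obtain h i where h: "h \<in> carrier G" "generate G {w, h} = carrier G"
      "comm G w h = c [^] (i::int)" "\<not> int p dvd i" using partner[OF w] by blast
  show thesis
  proof (rule that[OF k2 w(1) h(1) w(2) h(2-4)])
    show "k' \<le> k" if "v \<in> carrier G" "v [^] (p ^ k') = c" for k' v
      using k(2)[of k'] that unfolding Q_def by blast
  qed
qed

end

lemma (in group_hom) pn_chain_img:
  assumes chain: "pn_chain p G C n" and surj: "h ` carrier G = carrier H"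
  shows "pn_chain p H (\<lambda>i. h ` C i) n"
proof -
  have sub: "subgroup (C i) G" if "i \<le> n" for i using chain that unfolding pn_chain_def by blast
  have "comm H u g \<in> power_subgroup H (h ` C i) p"
    if i: "i < n" and u: "u \<in> h ` C (Suc i)" and g: "g \<in> carrier H" for i u g
  proof -
    obtain u' g' where u': "u' \<in> C (Suc i)" "u = h u'" and g': "g' \<in> carrier G" "g = h g'"
      using u g surj by blast
    have Ci: "C i \<subseteq> carrier G" and u'G: "u' \<in> carrier G"
      using sub[of i] sub[of "Suc i"] i u' subgroup.subset by fastforce+
    have "comm G u' g' \<in> power_subgroup G (C i) p"
      using chain i u' g' unfolding pn_chain_def by blast
    then show ?thesis
      unfolding power_subgroup_img[OF Ci] u'(2) g'(2) hom_comm[OF u'G g'(1), symmetric] by blast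
  qed
  moreover have "h ` C 0 = {\<one>\<^bsub>H\<^esub>}" using chain unfolding pn_chain_def by simp
  moreover have "h ` C n = carrier H" using chain surj unfolding pn_chain_def by simp
  moreover have "subgroup (h ` C i) H" if "i \<le> n" for i
    using sub[OF that] by (rule subgroup_img_is_subgroup)
  moreover have "h ` C i \<subseteq> h ` C (Suc i)" if "i < n" for i
    using chain that unfolding pn_chain_def by blast
  ultimately show ?thesis unfolding pn_chain_def by blast
qed

context group
begin

lemma generate_pow_unit:
  assumes p: "Factorial_Ring.prime p" and g: "g \<in> carrier G" "g [^] (p ^ M) = \<one>" and i: "\<not> int p dvd i"
  shows "generate G {g [^] i} = generate G {g}"
proof
  have gi: "g [^] i \<in> carrier G" using g by simp
  show "generate G {g [^] i} \<subseteq> generate G {g}"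
    using g by (intro generate_subgroup_incl generate_is_subgroup) (auto simp: generate_pow)
  obtain j where "g [^] (i * j) = g" using int_pow_unit[OF p g i] by blast
  then have "g \<in> generate G {g [^] i}"
    unfolding generate_pow[OF gi] using g by (metis (mono_tags, lifting) UNIV_I int_pow_pow mem_Collect_eq)
  then show "generate G {g} \<subseteq> generate G {g [^] i}"
    using gi by (intro generate_subgroup_incl generate_is_subgroup) auto
qed

text \<open>Lifts \<open>deep_root_of_c\<close> from the quotient by \<open><c^p>\<close>. Nothing
  is lost, because \<open>c^(p j + i)\<close> with \<open>i\<close> prime to \<open>p\<close>
  generates \<open><c>\<close> just as \<open>c\<close> does.\<close>

lemma metacyclic_generators:
  fixes M :: nat
  assumes p: "Factorial_Ring.prime p"
    and M: "\<And>g. g \<in> carrier G \<Longrightarrow> g [^] (p ^ M) = \<one>"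
    and xy: "x \<in> carrier G" "y \<in> carrier G" "generate G {x, y} = carrier G"
    and pw: "derived G (carrier G) \<subseteq> power_subgroup G (carrier G) (powerful_exponent p)"
    and chain: "pn_chain p G H n"
    and nonab: "comm G x y \<noteq> \<one>"
  obtains a b k where "a \<in> carrier G" "b \<in> carrier G" "generate G {a, b} = carrier G" "k \<ge> 2"
    "derived G (carrier G) = generate G {a [^] (p ^ k)}"
    "\<And>v k'. v \<in> carrier G \<Longrightarrow> derived G (carrier G) = generate G {v [^] (p ^ k')} \<Longrightarrow> k' \<le> k"
proof -
  define c where "c = comm G x y"
  let ?D = "derived G (carrier G)"
  have cD: "c \<in> ?D" unfolding c_def using xy(1,2) by (rule comm_in_derived)
  have c: "c \<in> carrier G" using cD by (rule derived_closed)
  have cyc: "d \<in> ?D \<Longrightarrow> \<exists>j::int. d = c [^] j"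
    "g \<in> carrier G \<Longrightarrow> \<exists>j::int. comm G g c = c [^] (int p * j)" for d g
    unfolding c_def using derived_cyclic[OF p _ xy pw chain] M by blast+
  have D: "?D = generate G {c}"
  proof
    show "?D \<subseteq> generate G {c}" using cyc(1) unfolding generate_pow[OF c] by blast
    show "generate G {c} \<subseteq> ?D" using cD by (intro generate_subgroup_incl derived_is_subgroup) auto
  qed
  have cp: "c [^] p \<in> carrier G" using c by simp
  define N where "N = generate G {c [^] p}"
  have N_iff: "u \<in> N \<longleftrightarrow> (\<exists>j::int. u = c [^] (int p * j))" for u
    unfolding N_def generate_pow[OF cp] using c by (auto simp: int_pow_pow simp flip: int_pow_int)
  have "g \<otimes> u \<otimes> inv g \<in> N" if g: "g \<in> carrier G" and u: "u \<in> N" for g u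
  proof -
    obtain j where j: "u = c [^] (int p * j)" using u N_iff by blast
    obtain i where i: "comm G g c = c [^] (int p * i)" using cyc(2)[OF g] by blast
    have "g \<otimes> c = c [^] (int p * i + 1) \<otimes> g"
      using comm_swap[OF g c] unfolding i using c by (simp add: int_pow_mult)
    then have "g \<otimes> u = (c [^] (int p * i + 1)) [^] (int p * j) \<otimes> g"
      unfolding j using g c by (intro conj_int_pow) auto
    then have "g \<otimes> u \<otimes> inv g = (c [^] (int p * i + 1)) [^] (int p * j)" using g c by (simp add: m_assoc)
    also have "\<dots> = c [^] (int p * ((int p * i + 1) * j))" using c by (simp add: int_pow_pow mult_ac)
    finally show ?thesis using N_iff by blast
  qed
  moreover have subN: "subgroup N G" unfolding N_def using cp by (intro generate_is_subgroup) simp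
  ultimately have N: "N \<lhd> G" unfolding normal_inv_iff by blast
  define r where "r = (\<lambda>x. N #> x)"
  define L where "L = G Mod N"
  interpret r: group_hom G L r unfolding L_def r_def by (rule quotient_hom(1)[OF N])
  have carrL: "carrier L = r ` carrier G" unfolding L_def r_def by (rule quotient_hom(2)[OF N])
  have ker: "r u = \<one>\<^bsub>L\<^esub> \<longleftrightarrow> u \<in> N" if "u \<in> carrier G" for u
    unfolding L_def r_def using that by (rule quotient_hom(3)[OF N])
  have DL: "derived L (carrier L) = r ` ?D" unfolding L_def r_def by (rule derived_img_Mod[OF N])
  have req: "\<exists>j::int. u = c [^] (int p * j) \<otimes> v" if uv: "u \<in> carrier G" "v \<in> carrier G" "r u = r v" for u v
  proof -
    have "u \<otimes> inv v \<in> N" using r.hom_eq_iff[OF uv(1,2) ker] uv(3) by simp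
    then obtain j where "u \<otimes> inv v = c [^] (int p * j)" using N_iff by blast
    moreover have "u = (u \<otimes> inv v) \<otimes> v" using uv by (simp add: m_assoc)
    ultimately show ?thesis by auto
  qed
  interpret L: class2_pair L p M "r x" "r y" "r c"
  proof unfold_locales
    show "l [^]\<^bsub>L\<^esub> (p ^ M) = \<one>\<^bsub>L\<^esub>" if l: "l \<in> carrier L" for l
    proof -
      obtain g where g: "g \<in> carrier G" "l = r g" using l unfolding carrL by blast
      then show ?thesis using M[OF g(1)] by (simp flip: r.hom_nat_pow)
    qed
    show "generate L {r x, r y} = carrier L"
      using r.generate_img[of "{x, y}"] xy carrL by simp
    show "r c = comm L (r x) (r y)" unfolding c_def by (rule r.hom_comm[OF xy(1,2)])
    show "r c \<otimes>\<^bsub>L\<^esub> l = l \<otimes>\<^bsub>L\<^esub> r c" if l: "l \<in> carrier L" for l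
    proof -
      obtain g where g: "g \<in> carrier G" "l = r g" using l unfolding carrL by blast
      have "comm G g c \<in> N" using cyc(2)[OF g(1)] N_iff by blast
      then have "comm L l (r c) = \<one>\<^bsub>L\<^esub>"
        unfolding g r.hom_comm[OF g(1) c, symmetric] using ker[OF comm_closed[OF g(1) c]] by blast
      then show ?thesis using r.H.comm_eq_one_iff[of l "r c"] g c by simp
    qed
    have "c [^] p \<in> N" unfolding N_def by (simp add: generate.incl)
    then show "r c [^]\<^bsub>L\<^esub> p = \<one>\<^bsub>L\<^esub>" using ker[OF cp] r.hom_nat_pow[OF c, of p] by simp
    show "r c \<noteq> \<one>\<^bsub>L\<^esub>"
    proof
      assume "r c = \<one>\<^bsub>L\<^esub>"
      then obtain j where "c = c [^] (int p * j)" using ker[OF c] N_iff by blast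
      then have "c = \<one>" by (rule int_pow_p_eq_self[OF p c M[OF c]])
      then show False using nonab c_def by simp
    qed
  qed (use p xy in auto)
  have pwL: "derived L (carrier L) \<subseteq> power_subgroup L (carrier L) (powerful_exponent p)"
    unfolding DL unfolding carrL r.power_subgroup_img[OF subset_refl] using pw by (rule image_mono)
  obtain k w' h' i where k: "k \<ge> 2" and w': "w' \<in> carrier L" and h': "h' \<in> carrier L"
    and wk: "w' [^]\<^bsub>L\<^esub> (p ^ k) = r c" and gen': "generate L {w', h'} = carrier L"
    and cm: "comm L w' h' = r c [^]\<^bsub>L\<^esub> (i::int)" and i: "\<not> int p dvd i"
    and max: "\<And>k' v. v \<in> carrier L \<Longrightarrow> v [^]\<^bsub>L\<^esub> (p ^ k') = r c \<Longrightarrow> k' \<le> k"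
    using L.deep_root_of_c[OF pwL r.pn_chain_img[OF chain carrL[symmetric]]] by blast
  obtain w h where w: "w \<in> carrier G" "w' = r w" and h: "h \<in> carrier G" "h' = r h"
    using w' h' unfolding carrL by blast
  have unit: "generate G {c [^] (int p * j + i)} = generate G {c}" if "\<not> int p dvd i" for i j
    by (rule generate_pow_unit[OF p c M[OF c]]) (use that in \<open>simp add: dvd_add_right_iff\<close>)
  let ?W = "generate G {w, h}"
  have W: "subgroup ?W G" using w h by (intro generate_is_subgroup) simp
  interpret W: subgroup ?W G by (rule W)
  \<comment> \<open>\<open>[w, h] = c^(p j + i)\<close> generates \<open><c>\<close>, so
    \<open>?W\<close> contains the kernel \<open>N\<close> and generation can be tested in the
    quotient.\<close>
  have gen: "?W = carrier G"
  proof
    have "r (comm G w h) = r (c [^] i)"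
      unfolding r.hom_comm[OF w(1) h(1)] using cm w h c by (simp only: r.hom_int_pow)
    then obtain j where "comm G w h = c [^] (int p * j) \<otimes> c [^] i"
      using req[OF comm_closed[OF w(1) h(1)] int_pow_closed[OF c]] by blast
    then have j: "comm G w h = c [^] (int p * j + i)" using c by (simp add: int_pow_mult)
    have "w \<in> ?W" "h \<in> ?W" by (simp_all add: generate.incl)
    then have "comm G w h \<in> ?W" by simp
    then have "generate G {c} \<subseteq> ?W"
      unfolding unit[OF i, of j, symmetric] j using W by (intro generate_subgroup_incl) auto
    then have NW: "N \<subseteq> ?W" unfolding generate_pow[OF c] using N_iff by blast
    show "carrier G \<subseteq> ?W"
    proof
      fix g assume g: "g \<in> carrier G"
      have "r g \<in> generate L {w', h'}" unfolding gen' using g by simp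
      then have "r g \<in> r ` ?W" using r.generate_img[of "{w, h}"] w h by simp
      then obtain u where u: "u \<in> ?W" "r g = r u" by blast
      then obtain j where "g = c [^] (int p * j) \<otimes> u" using req[OF g W.mem_carrier] by blast
      moreover have "c [^] (int p * j) \<in> ?W" using NW N_iff by blast
      ultimately show "g \<in> ?W" using u by simp
    qed
  qed (rule W.subset)
  have "r (w [^] (p ^ k)) = r c" using wk w r.hom_nat_pow[of w "p ^ k"] by simp
  then obtain j where "w [^] (p ^ k) = c [^] (int p * j) \<otimes> c" using req[of "w [^] (p ^ k)" c] w c by auto
  then have "w [^] (p ^ k) = c [^] (int p * j + 1)" using c by (simp add: int_pow_mult)
  moreover have "\<not> int p dvd 1" using p by (simp add: prime_nat_iff)
  ultimately have Dw: "?D = generate G {w [^] (p ^ k)}" using unit[of 1 j] D by simp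
  show thesis
  proof (rule that[OF w(1) h(1) gen k Dw])
    \<comment> \<open>If \<open>v^(p^k')\<close> generates \<open>G'\<close>, then \<open>c\<close>
      itself is the \<open>p^k'\<close>-th power of a power of \<open>v\<close>, to which maximality
      in the quotient applies.\<close>
    fix v k' assume v: "v \<in> carrier G" and Dv: "?D = generate G {v [^] (p ^ k')}"
    have vk: "v [^] (p ^ k') \<in> carrier G" using v by simp
    obtain j where "c = (v [^] (p ^ k')) [^] (j::int)"
      using cD unfolding Dv generate_pow[OF vk] by blast
    also have "\<dots> = (v [^] j) [^] (p ^ k')" using v by (simp add: int_pow_pow mult.commute flip: int_pow_int)
    finally have "r (v [^] j) [^]\<^bsub>L\<^esub> (p ^ k') = r c" using v r.hom_nat_pow[of "v [^] j"] by simp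
    then show "k' \<le> k" using max[of "r (v [^] j)" k'] v by simp
  qed
qed

end

section \<open>Metacyclic groups\<close>

text \<open>Finiteness turns inverses into positive powers, so natural exponents suffice
  throughout.\<close>

locale metacyclic_pair = group G for G (structure) +
  fixes Q :: nat and a b
  assumes a: "a \<in> carrier G" and b: "b \<in> carrier G"
    and ba: "b \<otimes> a = a [^] Q \<otimes> b"
    and gen: "generate G {a, b} = carrier G"
    and finite_carrier: "finite (carrier G)"
begin

lemma swap: "b [^] j \<otimes> a [^] i = a [^] (i * Q ^ j) \<otimes> b [^] (j::nat)" for i j :: nat
proof (induction j arbitrary: i)
  case (Suc j)
  have "b \<otimes> a [^] i = (a [^] Q) [^] i \<otimes> b" using a b ba by (intro conj_pow) auto
  then have 1: "b \<otimes> a [^] i = a [^] (i * Q) \<otimes> b" unfolding nat_pow_pow[OF a] by (simp only: mult.commute)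
  have "b [^] Suc j \<otimes> a [^] i = b [^] j \<otimes> a [^] (i * Q) \<otimes> b" using a b 1 by (simp add: m_assoc)
  then show ?case unfolding Suc using a b by (simp add: m_assoc algebra_simps)
qed (use a b in simp)

lemma mult_form: "(a [^] i \<otimes> b [^] j) \<otimes> (a [^] i' \<otimes> b [^] j') = a [^] (i + i' * Q ^ j) \<otimes> b [^] (j + j')"
  for i j i' j' :: nat
proof -
  have "(a [^] i \<otimes> b [^] j) \<otimes> (a [^] i' \<otimes> b [^] j') = a [^] i \<otimes> (b [^] j \<otimes> a [^] i') \<otimes> b [^] j'"
    using a b by (simp add: m_assoc)
  then show ?thesis unfolding swap using a b by (simp add: m_assoc nat_pow_mult[symmetric])
qed

lemma surj_form: "g \<in> carrier G \<Longrightarrow> \<exists>(i::nat) (j::nat). g = a [^] i \<otimes> b [^] j"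
proof -
  assume "g \<in> carrier G"
  then have "g \<in> generate G {a, b}" using gen by simp
  then show ?thesis
  proof (induction rule: generate.induct)
    case one
    have "\<one> = a [^] (0::nat) \<otimes> b [^] (0::nat)" by simp
    then show ?case by blast
  next
    case (incl h)
    have "a = a [^] (1::nat) \<otimes> b [^] (0::nat)" "b = a [^] (0::nat) \<otimes> b [^] (1::nat)" using a b by simp_all
    then show ?case using incl by blast
  next
    case (inv h)
    have "ord b \<noteq> 0" "ord a \<noteq> 0" using finite_carrier a b by (metis ord_ge_1 not_one_le_zero)+
    then obtain s t where st: "ord a = Suc s" "ord b = Suc t" using not0_implies_Suc by blast
    have "a [^] s \<otimes> a = \<one>" "b [^] t \<otimes> b = \<one>" using pow_ord_eq_1[OF a] pow_ord_eq_1[OF b] st by simp_all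
    then have "inv a = a [^] s" "inv b = b [^] t" using a b inv_equality by simp_all
    then have "inv a = a [^] s \<otimes> b [^] (0::nat)" "inv b = a [^] (0::nat) \<otimes> b [^] t" using a b by simp_all
    then show ?case using inv by blast
  next
    case (eng h1 h2)
    then show ?case using mult_form by blast
  qed
qed

text \<open>Conjugation by \<open>a^i b^j\<close> raises \<open>a^t\<close> to the power
  \<open>Q^j\<close>.\<close>

lemma normal_sub: "generate G {a [^] (t::nat)} \<lhd> G"
  unfolding normal_inv_iff
proof (intro conjI ballI)
  have at: "a [^] t \<in> carrier G" using a by simp
  then show "subgroup (generate G {a [^] t}) G" by (intro generate_is_subgroup) simp
  fix g u assume g: "g \<in> carrier G" and "u \<in> generate G {a [^] t}"
  then obtain z where z: "u = (a [^] t) [^] (z::int)" unfolding generate_pow[OF at] by blast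
  obtain i j :: nat where ij: "g = a [^] i \<otimes> b [^] j" using surj_form[OF g] by blast
  have "a [^] (i::nat) \<otimes> b [^] j \<otimes> (a [^] t \<otimes> b [^] (0::nat)) = a [^] (t * Q ^ j) \<otimes> b [^] (0::nat) \<otimes> (a [^] i \<otimes> b [^] j)"
    unfolding mult_form by (simp add: add.commute)
  then have "g \<otimes> a [^] t = (a [^] t) [^] (Q ^ j) \<otimes> g" unfolding ij using a b by (simp add: nat_pow_pow)
  then have "g \<otimes> u = ((a [^] t) [^] (Q ^ j)) [^] z \<otimes> g" unfolding z using g a by (intro conj_int_pow) auto
  then have "g \<otimes> u \<otimes> inv g = ((a [^] t) [^] (Q ^ j)) [^] z" using g a by (simp add: m_assoc)
  also have "\<dots> = (a [^] t) [^] (int (Q ^ j) * z)" using at by (simp add: int_pow_pow flip: int_pow_int)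
  finally show "g \<otimes> u \<otimes> inv g \<in> generate G {a [^] t}" unfolding generate_pow[OF at] by blast
qed

end

text \<open>The three relations alone only bound the order from above by \<open>p^(m+n)\<close>; the
  assumption on the order makes them a faithful presentation.\<close>

locale metacyclic = metacyclic_pair G "1 + p ^ k" a b
  for G (structure) and p m n l k :: nat and a b +
  assumes p: "Factorial_Ring.prime p"
    and a_pow: "a [^] (p ^ m) = \<one>" and b_pow: "b [^] (p ^ n) = a [^] (p ^ l)"
    and order: "order G = p ^ (m + n)"
begin

lemma p_pos: "p ^ i > 0" using p prime_gt_0_nat by simp

lemma a_pow_mod: "a [^] (i mod p ^ m) = a [^] i" for i :: nat
  using a a_pow by (rule pow_mod)

lemma b_pow_mod: "b [^] j = a [^] (p ^ l * (j div p ^ n)) \<otimes> b [^] (j mod p ^ n)" for j :: nat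
proof -
  have "b [^] j = b [^] (p ^ n * (j div p ^ n) + j mod p ^ n)" by simp
  also have "\<dots> = (b [^] (p ^ n)) [^] (j div p ^ n) \<otimes> b [^] (j mod p ^ n)"
    using b by (simp only: nat_pow_mult nat_pow_pow nat_pow_closed)
  finally show ?thesis using a by (simp add: b_pow nat_pow_pow)
qed

lemma form_mod: "a [^] i \<otimes> b [^] j = a [^] ((i + p ^ l * (j div p ^ n)) mod p ^ m) \<otimes> b [^] (j mod p ^ n)" for i j :: nat
  unfolding a_pow_mod using b_pow_mod[of j] a b by (simp add: m_assoc nat_pow_mult[symmetric])

text \<open>The reduced forms exhaust the group, and there are just as many of them as elements, so
  they are distinct.\<close>

lemma bij_form: "bij_betw (\<lambda>(i, j). a [^] i \<otimes> b [^] j) ({..<p ^ m} \<times> {..<p ^ n}) (carrier G)"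
proof -
  let ?f = "\<lambda>(i, j). a [^] (i::nat) \<otimes> b [^] (j::nat)" and ?A = "{..<p ^ m} \<times> {..<p ^ n}"
  have "carrier G \<subseteq> ?f ` ?A"
  proof
    fix g assume "g \<in> carrier G"
    then obtain i j :: nat where "g = a [^] i \<otimes> b [^] j" using surj_form by blast
    then have "g = ?f ((i + p ^ l * (j div p ^ n)) mod p ^ m, j mod p ^ n)" using form_mod by simp
    moreover have "((i + p ^ l * (j div p ^ n)) mod p ^ m, j mod p ^ n) \<in> ?A" using p_pos by simp
    ultimately show "g \<in> ?f ` ?A" by (rule image_eqI)
  qed
  then have im: "?f ` ?A = carrier G" using a b by auto
  have "card ?A = card (?f ` ?A)" unfolding im using order by (simp add: order_def power_add)
  then have "inj_on ?f ?A" by (intro eq_card_imp_inj_on) auto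
  then show ?thesis using im by (simp add: bij_betw_def)
qed

lemma form_eq_iff:
  fixes i j i' j' :: nat
  assumes "j < p ^ n" "j' < p ^ n"
  shows "a [^] i \<otimes> b [^] j = a [^] i' \<otimes> b [^] j' \<longleftrightarrow> i mod p ^ m = i' mod p ^ m \<and> j = j'"
proof
  assume "a [^] i \<otimes> b [^] j = a [^] i' \<otimes> b [^] j'"
  then have "a [^] (i mod p ^ m) \<otimes> b [^] j = a [^] (i' mod p ^ m) \<otimes> b [^] j'" unfolding a_pow_mod .
  moreover have "inj_on (\<lambda>(i, j). a [^] i \<otimes> b [^] j) ({..<p ^ m} \<times> {..<p ^ n})"
    using bij_form by (simp add: bij_betw_def)
  ultimately have "(i mod p ^ m, j) = (i' mod p ^ m, j')"
    using assms p_pos by (elim inj_onD[of _ _ "(i mod p ^ m, j)" "(i' mod p ^ m, j')"]) auto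
  then show "i mod p ^ m = i' mod p ^ m \<and> j = j'" by simp
next
  assume "i mod p ^ m = i' mod p ^ m \<and> j = j'"
  then show "a [^] i \<otimes> b [^] j = a [^] i' \<otimes> b [^] j'" using a_pow_mod by metis
qed

lemma a_pow_eq_iff: "a [^] i = a [^] i' \<longleftrightarrow> i mod p ^ m = i' mod p ^ m" for i i' :: nat
  using form_eq_iff[of 0 0 i i'] p_pos[of n] a by simp

lemma a_pow_one_iff: "a [^] i = \<one> \<longleftrightarrow> p ^ m dvd i" for i :: nat
  using a_pow_eq_iff[of i 0] by (simp add: mod_eq_0_iff_dvd)

lemma ord_a: "ord a = p ^ m"
  using pow_eq_id[OF a] a_pow_one_iff by (metis dvd_antisym dvd_refl)

lemma b_pow_in_a: "b [^] j = a [^] i \<Longrightarrow> p ^ n dvd j" for i j :: nat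
  using form_eq_iff[of "j mod p ^ n" 0 "p ^ l * (j div p ^ n)" i] b_pow_mod[of j] p_pos[of n] a
  by (simp add: mod_eq_0_iff_dvd)

lemma pow_form: "(a [^] i \<otimes> b [^] j) [^] N = a [^] (i * (\<Sum>t<N. ((1 + p ^ k) ^ j) ^ t)) \<otimes> b [^] (j * N)" for i j N :: nat
proof (induction N)
  case (Suc N)
  show ?case unfolding nat_pow_Suc Suc mult_form
    by (simp add: algebra_simps flip: power_mult)
qed simp

lemma derived_eq: "derived G (carrier G) = generate G {a [^] (p ^ k)}"
proof
  have "comm G b a = a [^] (p ^ k)"
    using a b ba by (intro comm_eqI) (simp_all add: nat_pow_Suc2[symmetric])
  then show "generate G {a [^] (p ^ k)} \<subseteq> derived G (carrier G)"
    using comm_in_derived[OF b a] by (intro generate_subgroup_incl derived_is_subgroup) auto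
  show "derived G (carrier G) \<subseteq> generate G {a [^] (p ^ k)}"
  proof (rule derived_subset_normal2[OF normal_sub b a])
    show "generate G {b, a} = carrier G" using gen by (simp add: insert_commute)
    show "comm G b a \<in> generate G {a [^] (p ^ k)}"
      unfolding \<open>comm G b a = a [^] (p ^ k)\<close> by (simp add: generate.incl)
  qed
qed

text \<open>Truncated subtraction also covers the abelian case \<open>k >= m\<close>, where the
  value is 1.\<close>

lemma card_derived: "card (derived G (carrier G)) = p ^ (m - k)"
proof -
  have "ord (a [^] (p ^ k)) = p ^ m div gcd (p ^ m) (p ^ k)"
    using ord_pow_gen[OF a, of "p ^ k"] p_pos[of k] unfolding ord_a by (metis less_irrefl)
  also have "gcd (p ^ m) (p ^ k) = p ^ min m k"
    by (metis gcd_nat.absorb1 gcd_nat.absorb2 le_imp_power_dvd min_def nat_le_linear)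
  also have "p ^ m div p ^ min m k = p ^ (m - k)"
    using p_pos[of 1] by (simp add: min_def power_diff)
  finally show ?thesis unfolding derived_eq using generate_pow_card[of "a [^] (p ^ k)"] a by simp
qed

lemma a_pow_in_derived_iff: "a [^] i \<in> derived G (carrier G) \<longleftrightarrow> p ^ min k m dvd i" for i :: nat
proof -
  have "a [^] i \<in> derived G (carrier G) \<longleftrightarrow> (\<exists>t::nat. a [^] i = a [^] (p ^ k * t))"
    unfolding derived_eq using generate_pow_on_finite_carrier[OF finite_carrier, of "a [^] (p ^ k)"] a
    by (auto simp: nat_pow_pow)
  also have "\<dots> \<longleftrightarrow> p ^ min k m dvd i"
  proof
    assume "\<exists>t::nat. a [^] i = a [^] (p ^ k * t)"
    then obtain t where "i mod p ^ m = (p ^ k * t) mod p ^ m" unfolding a_pow_eq_iff by blast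
    moreover have "p ^ min k m dvd p ^ m" "p ^ min k m dvd p ^ k * t"
      by (simp_all add: le_imp_power_dvd dvd_mult2)
    ultimately show "p ^ min k m dvd i" by (metis dvd_mod_iff)
  next
    assume d: "p ^ min k m dvd i"
    show "\<exists>t::nat. a [^] i = a [^] (p ^ k * t)"
    proof (cases "k \<le> m")
      case True
      then show ?thesis using d by (auto simp: min_def dvd_def)
    next
      case False
      then have "a [^] i = a [^] (p ^ k * 0)" using d a_pow_one_iff by (simp add: min_def)
      then show ?thesis by blast
    qed
  qed
  finally show ?thesis .
qed

end

text \<open>Collects what the three families of types have in common. The condition
  \<open>kl\<close> says that \<open>b^(p^n) = a^(p^l)\<close> lies in \<open>G'\<close>; the
  minimum is there for the abelian types, where \<open>k\<close> exceeds \<open>m\<close>.\<close>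

locale std_metacyclic = metacyclic +
  assumes k2: "2 \<le> k" and n1: "1 \<le> n" and l1: "1 \<le> l" and lm: "l \<le> m" and kl: "min k m \<le> l"
begin

text \<open>The exponent of \<open>a\<close> is a geometric sum with ratio 1 modulo
  \<open>p\<close>, hence divisible by \<open>p^e\<close>. So exponents of the group can be read off
  from \<open>a\<close> and \<open>b\<close> although the power map is not a homomorphism.\<close>

lemma p_pow_in_form:
  fixes i j e :: nat
  shows "\<exists>s. (a [^] i \<otimes> b [^] j) [^] (p ^ e) = a [^] (p ^ e * s) \<otimes> b [^] (j * p ^ e)"
proof -
  have "int p dvd int ((1 + p ^ k) ^ j) - 1"
  proof -
    have "int p dvd (1 + int p ^ k) - 1" using k2 by (cases k) auto
    then show ?thesis using cong_one_power_int by fastforce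
  qed
  then have "int (p ^ e) dvd (\<Sum>t<p ^ e. int ((1 + p ^ k) ^ j) ^ t)" by (rule dvd_geometric_sum)
  also have "(\<Sum>t<p ^ e. int ((1 + p ^ k) ^ j) ^ t) = int (\<Sum>t<p ^ e. ((1 + p ^ k) ^ j) ^ t)" by simp
  finally have "p ^ e dvd (\<Sum>t<p ^ e. ((1 + p ^ k) ^ j) ^ t)" by (simp only: int_dvd_int_iff)
  then obtain s where "(\<Sum>t<p ^ e. ((1 + p ^ k) ^ j) ^ t) = p ^ e * s" by blast
  then show ?thesis unfolding pow_form by (intro exI[of _ "i * s"]) (simp add: mult_ac)
qed

text \<open>\<open>b^(p^n) = a^(p^l)\<close> has order \<open>p^(m-l)\<close>, and smaller powers of
  \<open>b\<close> do not meet \<open><a>\<close> trivially or otherwise.\<close>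

lemma b_pow_one_iff: "b [^] (p ^ e) = \<one> \<longleftrightarrow> n + m - l \<le> e"
proof (cases "n \<le> e")
  case True
  then obtain d where d: "e = n + d" by (metis le_iff_add)
  have "b [^] (p ^ e) = a [^] (p ^ (l + d))"
    using a b unfolding d by (simp add: power_add b_pow nat_pow_pow flip: nat_pow_pow[of b])
  then have "b [^] (p ^ e) = \<one> \<longleftrightarrow> m \<le> l + d"
    using a_pow_one_iff p by (simp add: dvd_power_iff_le prime_ge_2_nat)
  then show ?thesis using d by auto
next
  case False
  have "\<not> p ^ n dvd p ^ e" using False p by (simp add: dvd_power_iff_le prime_ge_2_nat)
  then have "b [^] (p ^ e) \<noteq> \<one>" using b_pow_in_a[of "p ^ e" 0] by auto
  then show ?thesis using False lm by simp
qed

text \<open>Phrased as a threshold for \<open>e\<close> so that isomorphic groups have equal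
  thresholds. The generators \<open>a\<close> and \<open>b\<close> attain it.\<close>

lemma exponent_iff: "(\<forall>g\<in>carrier G. g [^] (p ^ e) = \<one>) \<longleftrightarrow> max m (n + m - l) \<le> e"
proof
  assume "\<forall>g\<in>carrier G. g [^] (p ^ e) = \<one>"
  then have "a [^] (p ^ e) = \<one>" "b [^] (p ^ e) = \<one>" using a b by auto
  then show "max m (n + m - l) \<le> e"
    using b_pow_one_iff a_pow_one_iff p by (simp add: dvd_power_iff_le prime_ge_2_nat)
next
  assume e: "max m (n + m - l) \<le> e"
  show "\<forall>g\<in>carrier G. g [^] (p ^ e) = \<one>"
  proof
    fix g assume "g \<in> carrier G"
    then obtain i j :: nat where g: "g = a [^] i \<otimes> b [^] j" using surj_form by blast
    obtain s where s: "g [^] (p ^ e) = a [^] (p ^ e * s) \<otimes> b [^] (j * p ^ e)"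
      unfolding g using p_pow_in_form by blast
    have "p ^ m dvd p ^ e * s" using e by (simp add: le_imp_power_dvd)
    then have "a [^] (p ^ e * s) = \<one>" using a_pow_one_iff by blast
    moreover have "b [^] (j * p ^ e) = (b [^] (p ^ e)) [^] j" using b by (simp add: nat_pow_pow mult.commute)
    then have "b [^] (j * p ^ e) = \<one>" using b_pow_one_iff[of e] e by simp
    ultimately show "g [^] (p ^ e) = \<one>" using s by simp
  qed
qed

text \<open>Modulo \<open>G'\<close> the group is the product of cyclic groups of orders
  \<open>p^(min k m)\<close> and \<open>p^n\<close>, the latter because \<open>b^(p^n)\<close> lies
  in \<open>G'\<close>.\<close>

lemma derived_exponent_iff:
  "(\<forall>g\<in>carrier G. g [^] (p ^ e) \<in> derived G (carrier G)) \<longleftrightarrow> max (min k m) n \<le> e"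
proof
  assume asm: "\<forall>g\<in>carrier G. g [^] (p ^ e) \<in> derived G (carrier G)"
  then have "p ^ min k m dvd p ^ e" using a a_pow_in_derived_iff by blast
  moreover have "b [^] (p ^ e) \<in> generate G {a [^] (p ^ k)}" using asm b unfolding derived_eq by blast
  then have "\<exists>i::nat. b [^] (p ^ e) = a [^] i"
    using generate_pow_on_finite_carrier[OF finite_carrier, of "a [^] (p ^ k)"] a by (auto simp: nat_pow_pow)
  then have "p ^ n dvd p ^ e" using b_pow_in_a by blast
  ultimately show "max (min k m) n \<le> e" using p by (simp add: dvd_power_iff_le prime_ge_2_nat)
next
  assume e: "max (min k m) n \<le> e"
  show "\<forall>g\<in>carrier G. g [^] (p ^ e) \<in> derived G (carrier G)"
  proof
    fix g assume "g \<in> carrier G"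
    then obtain i j :: nat where g: "g = a [^] i \<otimes> b [^] j" using surj_form by blast
    obtain s where s: "g [^] (p ^ e) = a [^] (p ^ e * s) \<otimes> b [^] (j * p ^ e)"
      unfolding g using p_pow_in_form by blast
    have "p ^ e = p ^ n * p ^ (e - n)" using e by (simp flip: power_add)
    then have "b [^] (j * p ^ e) = (b [^] (p ^ n)) [^] (p ^ (e - n) * j)" using b by (simp add: nat_pow_pow mult_ac)
    also have "\<dots> = a [^] (p ^ l * (p ^ (e - n) * j))" unfolding b_pow using a by (simp add: nat_pow_pow)
    finally have "g [^] (p ^ e) = a [^] (p ^ e * s + p ^ l * (p ^ (e - n) * j))"
      using s a by (simp add: nat_pow_mult)
    moreover have "p ^ min k m dvd p ^ e" "p ^ min k m dvd p ^ l"
      using e kl by (auto intro: le_imp_power_dvd)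
    then have "p ^ min k m dvd p ^ e * s + p ^ l * (p ^ (e - n) * j)" by (intro dvd_add dvd_mult2)
    ultimately show "g [^] (p ^ e) \<in> derived G (carrier G)" using a_pow_in_derived_iff by simp
  qed
qed

text \<open>A generator would have order \<open>p^(m+n)\<close>, while the exponent is smaller since
  \<open>n\<close> and \<open>l\<close> are positive.\<close>

lemma not_cyclic: "g \<in> carrier G \<Longrightarrow> generate G {g} \<noteq> carrier G"
proof
  assume g: "g \<in> carrier G" and "generate G {g} = carrier G"
  then have "ord g = p ^ (m + n)" using generate_pow_card[OF g] order by (simp add: order_def)
  moreover have "g [^] (p ^ max m (n + m - l)) = \<one>" using exponent_iff g by blast
  ultimately have "p ^ (m + n) dvd p ^ max m (n + m - l)" using pow_eq_id[OF g] by simp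
  then have "m + n \<le> max m (n + m - l)" using p by (simp add: dvd_power_iff_le prime_ge_2_nat)
  then show False using n1 l1 lm by simp
qed

lemma group_rank_eq: "group_rank G = 2"
  unfolding group_rank_def
proof (rule Least_equality)
  have "a \<noteq> b"
  proof
    assume "a = b"
    then have "generate G {a} = carrier G" using gen by simp
    then show False using not_cyclic[OF a] by blast
  qed
  then have "{a, b} \<subseteq> carrier G \<and> finite {a, b} \<and> card {a, b} = 2 \<and> generate G {a, b} = carrier G"
    using a b gen by simp
  then show "\<exists>S\<subseteq>carrier G. finite S \<and> card S = 2 \<and> generate G S = carrier G" by blast
next
  fix t assume "\<exists>S\<subseteq>carrier G. finite S \<and> card S = t \<and> generate G S = carrier G"
  then obtain S where S: "S \<subseteq> carrier G" "finite S" "card S = t" "generate G S = carrier G" by blast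
  show "2 \<le> t"
  proof (rule ccontr)
    assume "\<not> 2 \<le> t"
    then consider "card S = 0" | "card S = 1" using S by linarith
    then show False
    proof cases
      case 1
      then have "generate G {\<one>} = carrier G" using S generate_empty generate_one by simp
      then show False using not_cyclic by blast
    next
      case 2
      then obtain g where "S = {g}" using card_1_singletonE by blast
      then show False using S not_cyclic by blast
    qed
  qed
qed

lemma derived_powerful: "derived G (carrier G) \<subseteq> power_subgroup G (carrier G) (if p = 2 then 4 else p)"
proof -
  let ?q = "if p = 2 then 4 else p"
  have "\<exists>t. p ^ k = t * ?q"
  proof (cases "p = 2")
    case True
    have "p ^ k = p ^ (k - 2) * p\<^sup>2" 
      using power_add[of p "k - 2" 2] k2 by (simp only: le_add_diff_inverse2)
    then show ?thesis using True by auto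
  next
    case False
    have "p ^ k = p ^ (k - 1) * p" using k2 by (cases k) auto
    then show ?thesis using False by auto
  qed
  then obtain t where "p ^ k = t * ?q" by blast
  then have "a [^] (p ^ k) = (a [^] t) [^] ?q" using a by (simp only: nat_pow_pow)
  then have "a [^] (p ^ k) \<in> power_subgroup G (carrier G) ?q"
    unfolding power_subgroup_def using a by (intro generate.incl) auto
  moreover have "subgroup (power_subgroup G (carrier G) ?q) G"
    unfolding power_subgroup_def by (intro generate_is_subgroup) auto
  ultimately show ?thesis unfolding derived_eq by (intro generate_subgroup_incl) auto
qed

text \<open>The chain is \<open><a^(p^(m-i))>\<close> with the whole group on top. Commutators with
  its \<open>i\<close>-th member gain a factor \<open>p^k\<close> in the exponent of
  \<open>a\<close>, whereas the power subgroup of the preceding member contains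
  \<open>a^(p^(m-i+2))\<close>; so \<open>k >= 2\<close> is exactly what is needed.\<close>

lemma powerfully_nilpotent: "powerfully_nilpotent p G"
proof -
  have "powerful p G"
    unfolding powerful_def finite_p_group_def commutator_subgroup_self
    using p order derived_powerful is_group by blast
  moreover define H where "H i = (if i = m then carrier G else generate G {a [^] (p ^ (m - i))})" for i
  have m1: "m \<ge> 1" using l1 lm by simp
  have sub: "subgroup (H i) G" for i
    unfolding H_def using a by (auto intro: generate_is_subgroup subgroup_self)
  have "H 0 = {\<one>}" unfolding H_def using m1 a_pow generate_one by simp
  moreover have "H m = carrier G" unfolding H_def by simp
  moreover have "H i \<subseteq> H (Suc i)" if i: "i < m" for i
  proof (cases "Suc i = m")
    case True
    then show ?thesis using sub[of i] subgroup.subset unfolding H_def by fastforce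
  next
    case False
    have "m - i = Suc (m - Suc i)" using i by simp
    then have "a [^] (p ^ (m - i)) = (a [^] (p ^ (m - Suc i))) [^] p"
      using a by (simp add: nat_pow_pow mult.commute)
    also have "\<dots> \<in> H (Suc i)"
    proof -
      have "a [^] (p ^ (m - Suc i)) \<in> H (Suc i)" unfolding H_def using False by (simp add: generate.incl)
      then show ?thesis by (metis int_pow_int sub subgroup_int_pow_closed)
    qed
    finally have "{a [^] (p ^ (m - i))} \<subseteq> H (Suc i)" by blast
    then have "generate G {a [^] (p ^ (m - i))} \<subseteq> H (Suc i)" by (rule generate_subgroup_incl[OF _ sub])
    then show ?thesis using i unfolding H_def[of i] by simp
  qed
  moreover have "commutator_subgroup G (H i) (carrier G) \<subseteq> power_subgroup G (H (i - 1)) p" if i: "i \<in> {1..m}" for i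
  proof -
    let ?P = "power_subgroup G (H (i - 1)) p"
    \<comment> \<open>One unit comes from stepping down from \<open>i\<close> to
      \<open>i - 1\<close>, the other from taking \<open>p\<close>-th powers.\<close>
    let ?e = "m - i + 2"
    have "a [^] (p ^ (m - (i - 1))) \<in> H (i - 1)" unfolding H_def using i m1 by (auto simp: generate.incl)
    then have "(a [^] (p ^ (m - (i - 1)))) [^] p \<in> ?P"
      unfolding power_subgroup_def by (intro generate.incl) blast
    moreover have "(a [^] (p ^ (m - (i - 1)))) [^] p = a [^] (p ^ ?e)"
    proof -
      have "?e = Suc (m - (i - 1))" using i by auto
      then show ?thesis using a by (simp add: nat_pow_pow mult.commute)
    qed
    ultimately have aP: "a [^] (p ^ ?e) \<in> ?P" by simp
    have P: "subgroup ?P G" unfolding power_subgroup_def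
      using subgroup.subset[OF sub[of "i - 1"]] by (intro generate_is_subgroup) auto
    have dvdP: "a [^] t \<in> ?P" if d: "p ^ ?e dvd t" for t
    proof -
      obtain s where "t = p ^ ?e * s" using d by blast
      then have "a [^] t = (a [^] (p ^ ?e)) [^] s" using a by (simp only: nat_pow_pow)
      then show ?thesis using P aP by (metis int_pow_int subgroup_int_pow_closed)
    qed
    have comm: "comm G u g \<in> ?P" if u: "u \<in> H i" and g: "g \<in> carrier G" for u g
    proof (cases "i = m")
      case True
      have "u \<in> carrier G" using u sub subgroup.subset by blast
      then have "comm G u g \<in> generate G {a [^] (p ^ k)}" using comm_in_derived g unfolding derived_eq by blast
      also have "\<dots> \<subseteq> ?P"
        using True k2 dvdP[OF le_imp_power_dvd, of k] P by (intro generate_subgroup_incl) auto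
      finally show ?thesis .
    next
      case False
      have at: "a [^] (p ^ (m - i)) \<in> carrier G" using a by simp
      obtain t :: nat where t: "u = a [^] (p ^ (m - i) * t)"
        using u False generate_pow_on_finite_carrier[OF finite_carrier at] a unfolding H_def
        by (auto simp: nat_pow_pow)
      obtain i' j :: nat where g': "g = a [^] i' \<otimes> b [^] j" using surj_form[OF g] by blast
      define s where "s = p ^ (m - i) * t"
      have "int p ^ k dvd (1 + int p ^ k) ^ j - 1" by (rule cong_one_power_int) simp
      then have "int (p ^ k) dvd int ((1 + p ^ k) ^ j - 1)" by (simp add: of_nat_diff)
      then have "p ^ k dvd (1 + p ^ k) ^ j - 1" by (simp only: int_dvd_int_iff)
      then obtain z where "(1 + p ^ k) ^ j - 1 = p ^ k * z" by blast
      moreover have "1 \<le> (1 + p ^ k) ^ j" by (rule one_le_power) simp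
      ultimately have z: "(1 + p ^ k) ^ j = 1 + p ^ k * z" by linarith
      have "g \<otimes> u = (a [^] i' \<otimes> b [^] j) \<otimes> (a [^] s \<otimes> b [^] (0::nat))"
        unfolding g' t s_def using a b by simp
      also have "\<dots> = a [^] (s * (p ^ k * z)) \<otimes> ((a [^] s \<otimes> b [^] (0::nat)) \<otimes> (a [^] i' \<otimes> b [^] j))"
        unfolding mult_form z using a b by (simp add: m_assoc[symmetric] nat_pow_mult algebra_simps)
      also have "\<dots> = a [^] (s * (p ^ k * z)) \<otimes> u \<otimes> g"
        unfolding g' t s_def using a b by (simp add: m_assoc)
      finally have "comm G g u = a [^] (s * (p ^ k * z))"
        using g a t by (intro comm_eqI) auto
      moreover have "p ^ ?e dvd s * (p ^ k * z)"
        unfolding s_def power_add using k2 by (intro mult_dvd_mono dvd_mult2 le_imp_power_dvd dvd_refl)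
      ultimately have "inv (comm G g u) \<in> ?P" using dvdP P by (simp add: subgroup.m_inv_closed)
      then show ?thesis using inv_commutator[of g u] g a t by simp
    qed
    show ?thesis unfolding commutator_subgroup_def
      using comm P by (intro generate_subgroup_incl) auto
  qed
  ultimately show ?thesis unfolding powerfully_nilpotent_def
    using sub by (intro conjI exI[of _ m] exI[of _ H]) auto
qed

end

text \<open>The code of \<open>(i, j)\<close> stands for \<open>a ^ i b ^ j\<close>; the last summand of the first component is the carry
  \<open>b ^ (p ^ n) = a ^ (p ^ l)\<close>.\<close>

definition metacyclic_model :: "nat \<Rightarrow> nat \<Rightarrow> nat \<Rightarrow> nat \<Rightarrow> nat \<Rightarrow> nat monoid" where
  "metacyclic_model p m n l k =
     \<lparr>carrier = prod_encode ` ({..<p ^ m} \<times> {..<p ^ n}),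
      monoid.mult = (\<lambda>u v. let (i, j) = prod_decode u; (i', j') = prod_decode v in
        prod_encode ((i + i' * (1 + p ^ k) ^ j + p ^ l * ((j + j') div p ^ n)) mod p ^ m, (j + j') mod p ^ n)),
      one = prod_encode (0, 0)\<rparr>"

lemma model_mult:
  "prod_encode (i, j) \<otimes>\<^bsub>metacyclic_model p m n l k\<^esub> prod_encode (i', j') =
     prod_encode ((i + i' * (1 + p ^ k) ^ j + p ^ l * ((j + j') div p ^ n)) mod p ^ m, (j + j') mod p ^ n)"
  by (simp add: metacyclic_model_def)

lemma model_one: "\<one>\<^bsub>metacyclic_model p m n l k\<^esub> = prod_encode (0, 0)"
  by (simp add: metacyclic_model_def)

lemma model_carrier: "carrier (metacyclic_model p m n l k) = prod_encode ` ({..<p ^ m} \<times> {..<p ^ n})"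
  by (simp add: metacyclic_model_def)

lemma (in metacyclic) model_iso: "metacyclic_model p m n l k \<cong> G"
proof -
  let ?M = "metacyclic_model p m n l k"
  let ?f = "\<lambda>(i, j). a [^] (i::nat) \<otimes> b [^] (j::nat)"
  have "?f \<circ> prod_decode \<in> hom ?M G"
  proof (rule homI)
    fix u v assume "u \<in> carrier ?M" "v \<in> carrier ?M"
    then obtain i j i' j' where uv: "u = prod_encode (i, j)" "v = prod_encode (i', j')"
      unfolding model_carrier by auto
    have "(a [^] i \<otimes> b [^] j) \<otimes> (a [^] i' \<otimes> b [^] j')
        = a [^] ((i + i' * (1 + p ^ k) ^ j + p ^ l * ((j + j') div p ^ n)) mod p ^ m) \<otimes> b [^] ((j + j') mod p ^ n)"
      unfolding mult_form by (rule form_mod)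
    then show "(?f \<circ> prod_decode) (u \<otimes>\<^bsub>?M\<^esub> v) = (?f \<circ> prod_decode) u \<otimes> (?f \<circ> prod_decode) v"
      unfolding uv model_mult by simp
  qed (use a b in \<open>auto split: prod.split\<close>)
  moreover have "bij_betw prod_decode (carrier ?M) ({..<p ^ m} \<times> {..<p ^ n})"
    unfolding model_carrier by (rule bij_betw_imageI) (auto simp: image_image inj_on_def)
  then have "bij_betw (?f \<circ> prod_decode) (carrier ?M) (carrier G)"
    using bij_form by (rule bij_betw_trans)
  ultimately show ?thesis unfolding is_iso_def iso_def by blast
qed

section \<open>Consistency of the presentation\<close>

lemma nat_mod_add_inverse:
  fixes t P :: nat
  assumes "P > 0"
  shows "((P - t mod P) mod P + t) mod P = 0"
proof -
  have "((P - t mod P) mod P + t) mod P = ((P - t mod P) + t mod P) mod P" by (simp add: mod_simps)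
  also have "\<dots> = 0" using assms by simp
  finally show ?thesis .
qed

text \<open>The two inequalities are what associativity needs: \<open>m <= n + k\<close> makes the
  action of \<open>b\<close> have order dividing \<open>p^n\<close>, and \<open>m <= l + k\<close>
  makes the carry element \<open>a^(p^l)\<close> fixed by \<open>b\<close>.\<close>

lemma model_metacyclic:
  assumes p: "Factorial_Ring.prime p" and k: "k \<ge> 2" and m: "m \<ge> 1" and n: "n \<ge> 1"
    and mlk: "m \<le> l + k" and mnk: "m \<le> n + k"
  shows "metacyclic (metacyclic_model p m n l k) p m n l k (prod_encode (1, 0)) (prod_encode (0, 1))"
proof -
  let ?G = "metacyclic_model p m n l k"
  define P where "P = p ^ m"
  define N where "N = p ^ n"
  define q where "q = 1 + p ^ k"
  define L where "L = p ^ l"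
  have P1: "P > 1" and N1: "N > 1"
    using one_less_power[OF prime_gt_1_nat[OF p]] m n unfolding P_def N_def by simp_all
  have mult: "prod_encode (i, j) \<otimes>\<^bsub>?G\<^esub> prod_encode (i', j') =
      prod_encode ((i + i' * q ^ j + L * ((j + j') div N)) mod P, (j + j') mod N)" for i j i' j'
    unfolding P_def N_def q_def L_def by (rule model_mult)
  have carr: "carrier ?G = prod_encode ` ({..<P} \<times> {..<N})" unfolding P_def N_def by (rule model_carrier)
  have qN: "[q ^ N = 1] (mod P)"
  proof -
    obtain z where "(1 + 1 * int p ^ k) ^ (p ^ n) = 1 + 1 * int p ^ (k + n) * (1 + int p * z)"
      using power_prime_power_exact[OF k] by blast
    then have e: "int (q ^ N) - 1 = int p ^ (k + n) * (1 + int p * z)" by (simp add: q_def N_def)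
    have "int P dvd int p ^ (k + n)" unfolding P_def using mnk by (simp add: le_imp_power_dvd)
    then have "int P dvd int (q ^ N) - int 1" unfolding of_nat_1 e by (rule dvd_mult2)
    then show ?thesis by (metis cong_iff_dvd_diff cong_int_iff)
  qed
  have qmod: "[q ^ (t mod N) = q ^ t] (mod P)" for t
  proof -
    have "[(q ^ N) ^ (t div N) * q ^ (t mod N) = 1 ^ (t div N) * q ^ (t mod N)] (mod P)"
      by (intro cong_mult cong_pow qN cong_refl)
    moreover have "(q ^ N) ^ (t div N) * q ^ (t mod N) = q ^ t"
      by (simp flip: power_mult power_add)
    ultimately show ?thesis by (simp add: cong_sym)
  qed
  have lq1: "[L * q = L] (mod P)"
  proof -
    have "P dvd p ^ (l + k)" unfolding P_def using mlk by (rule le_imp_power_dvd)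
    then have "[L + p ^ (l + k) = L + 0] (mod P)" by (intro cong_add cong_refl) (simp add: cong_0_iff)
    then show ?thesis by (simp add: L_def q_def algebra_simps power_add)
  qed
  have lq: "[L * q ^ j = L] (mod P)" for j
  proof (induction j)
    case (Suc j)
    have "[L * q ^ j * q = L * q] (mod P)" using Suc by (intro cong_mult cong_refl)
    then show ?case using lq1 by (simp add: mult_ac) (metis cong_trans)
  qed simp
  \<comment> \<open>The cocycle identity for carries in addition modulo \<open>N\<close>.\<close>
  have carry: "s div N + (s mod N + t) div N = (s + t) div N" for s t
  proof -
    have "(s + t) div N = (N * (s div N) + (s mod N + t)) div N" by (simp flip: add.assoc)
    also have "\<dots> = s div N + (s mod N + t) div N" using N1 by (subst div_mult_self4) auto
    finally show ?thesis by simp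
  qed
  have grp: "group ?G"
  proof (rule groupI)
    fix u v assume "u \<in> carrier ?G" "v \<in> carrier ?G"
    then obtain i j i' j' where uv: "u = prod_encode (i, j)" "v = prod_encode (i', j')"
      unfolding carr by auto
    show "u \<otimes>\<^bsub>?G\<^esub> v \<in> carrier ?G" unfolding uv mult carr using P1 N1 by (intro imageI) auto
    fix w assume "w \<in> carrier ?G"
    then obtain i'' j'' where w: "w = prod_encode (i'', j'')" unfolding carr by auto
    \<comment> \<open>The value of the \<open>a\<close>-exponent, modulo \<open>P\<close>, to which
      both bracketings are reduced.\<close>
    let ?X = "i + i' * q ^ j + i'' * q ^ (j + j') + L * ((j + j' + j'') div N)"
    have "[(i + i' * q ^ j + L * ((j + j') div N)) mod P + i'' * q ^ ((j + j') mod N) + L * (((j + j') mod N + j'') div N)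
        = (i + i' * q ^ j + L * ((j + j') div N)) + i'' * q ^ (j + j') + L * (((j + j') mod N + j'') div N)] (mod P)"
      by (intro cong_add cong_mult cong_refl qmod cong_mod_leftI)
    also have "(i + i' * q ^ j + L * ((j + j') div N)) + i'' * q ^ (j + j') + L * (((j + j') mod N + j'') div N) = ?X"
      unfolding carry[of "j + j'" j'', symmetric] by (simp add: algebra_simps)
    finally have LL: "[(i + i' * q ^ j + L * ((j + j') div N)) mod P + i'' * q ^ ((j + j') mod N) + L * (((j + j') mod N + j'') div N) = ?X] (mod P)" .
    have "[i + ((i' + i'' * q ^ j' + L * ((j' + j'') div N)) mod P) * q ^ j + L * ((j + (j' + j'') mod N) div N)
        = i + (i' + i'' * q ^ j' + L * ((j' + j'') div N)) * q ^ j + L * ((j + (j' + j'') mod N) div N)] (mod P)"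
      by (intro cong_add cong_mult cong_refl cong_mod_leftI)
    also have "i + (i' + i'' * q ^ j' + L * ((j' + j'') div N)) * q ^ j + L * ((j + (j' + j'') mod N) div N)
        = i + i' * q ^ j + i'' * q ^ (j + j') + (L * q ^ j) * ((j' + j'') div N) + L * ((j + (j' + j'') mod N) div N)"
      by (simp add: algebra_simps power_add)
    also have "[\<dots> = i + i' * q ^ j + i'' * q ^ (j + j') + L * ((j' + j'') div N) + L * ((j + (j' + j'') mod N) div N)] (mod P)"
      by (intro cong_add cong_mult cong_refl lq)
    also have "i + i' * q ^ j + i'' * q ^ (j + j') + L * ((j' + j'') div N) + L * ((j + (j' + j'') mod N) div N) = ?X"
      using carry[of "j' + j''" j] by (simp add: add_ac distrib_left[symmetric])
    finally have R: "[i + ((i' + i'' * q ^ j' + L * ((j' + j'') div N)) mod P) * q ^ j + L * ((j + (j' + j'') mod N) div N) = ?X] (mod P)" .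
    show "u \<otimes>\<^bsub>?G\<^esub> v \<otimes>\<^bsub>?G\<^esub> w = u \<otimes>\<^bsub>?G\<^esub> (v \<otimes>\<^bsub>?G\<^esub> w)"
      unfolding uv w mult using cong_trans[OF LL cong_sym[OF R]] by (simp add: cong_def mod_simps add.assoc)
  next
    show "\<one>\<^bsub>?G\<^esub> \<in> carrier ?G" unfolding carr model_one using P1 N1 by auto
  next
    fix u assume "u \<in> carrier ?G"
    then obtain i j where u: "u = prod_encode (i, j)" "i < P" "j < N" unfolding carr by auto
    show "\<one>\<^bsub>?G\<^esub> \<otimes>\<^bsub>?G\<^esub> u = u" unfolding u(1) model_one mult using u by simp
    \<comment> \<open>\<open>j'\<close> cancels the \<open>b\<close>-exponent; \<open>t\<close> is
      the \<open>a\<close>-exponent that this produces, carry included, and \<open>i'\<close>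
      cancels it.\<close>
    define j' where "j' = (N - j mod N) mod N"
    define t where "t = i * q ^ j' + L * ((j' + j) div N)"
    define i' where "i' = (P - t mod P) mod P"
    have "prod_encode (i', j') \<otimes>\<^bsub>?G\<^esub> u = prod_encode ((i' + t) mod P, (j' + j) mod N)"
      unfolding u(1) mult t_def by (simp add: add.assoc)
    also have "\<dots> = \<one>\<^bsub>?G\<^esub>"
      unfolding i'_def j'_def model_one using P1 N1 nat_mod_add_inverse by simp
    finally show "\<exists>v\<in>carrier ?G. v \<otimes>\<^bsub>?G\<^esub> u = \<one>\<^bsub>?G\<^esub>"
      unfolding carr i'_def j'_def using P1 N1 by (intro bexI imageI) auto
  qed
  interpret group ?G by (rule grp)
  let ?a = "prod_encode (1, 0)" and ?b = "prod_encode (0, 1)"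
  have a_pow: "?a [^]\<^bsub>?G\<^esub> i = prod_encode (i mod P, 0)" for i :: nat
  proof (induction i)
    case (Suc i)
    show ?case unfolding nat_pow_Suc Suc mult by (simp add: mod_simps)
  qed (simp add: model_one)
  have b_pow: "?b [^]\<^bsub>?G\<^esub> j = prod_encode ((L * (j div N)) mod P, j mod N)" for j :: nat
  proof (induction j)
    case (Suc j)
    have "[(L * (j div N)) mod P + L * ((j mod N + 1) div N) = L * (j div N) + L * ((j mod N + 1) div N)] (mod P)"
      by (intro cong_add cong_refl cong_mod_leftI)
    also have "L * (j div N) + L * ((j mod N + 1) div N) = L * (Suc j div N)"
      using carry[of j 1] by (simp flip: distrib_left)
    finally have 1: "((L * (j div N)) mod P + L * ((j mod N + 1) div N)) mod P = (L * (Suc j div N)) mod P"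
      by (simp add: cong_def)
    have 2: "(j mod N + 1) mod N = Suc j mod N" by (simp add: mod_simps)
    show ?case unfolding nat_pow_Suc Suc mult using 1 2 by simp
  qed (simp add: model_one)
  show ?thesis
  proof unfold_locales
    show aG: "?a \<in> carrier ?G" and bG: "?b \<in> carrier ?G" unfolding carr using P1 N1 by auto
    show "?b \<otimes>\<^bsub>?G\<^esub> ?a = ?a [^]\<^bsub>?G\<^esub> (1 + p ^ k) \<otimes>\<^bsub>?G\<^esub> ?b"
      unfolding a_pow mult using N1 by (simp add: q_def)
    show "?a [^]\<^bsub>?G\<^esub> (p ^ m) = \<one>\<^bsub>?G\<^esub>" unfolding a_pow model_one P_def by simp
    show "?b [^]\<^bsub>?G\<^esub> (p ^ n) = ?a [^]\<^bsub>?G\<^esub> (p ^ l)"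
      unfolding a_pow b_pow using N1 by (simp add: N_def[symmetric] L_def)
    show "finite (carrier ?G)" unfolding carr by simp
    show "order ?G = p ^ (m + n)"
      unfolding order_def carr by (simp add: card_image inj_on_def P_def N_def power_add card_cartesian_product)
    show "generate ?G {?a, ?b} = carrier ?G"
    proof
      show "generate ?G {?a, ?b} \<subseteq> carrier ?G" using aG bG by (intro generate_incl) simp
      show "carrier ?G \<subseteq> generate ?G {?a, ?b}"
      proof
        fix u assume "u \<in> carrier ?G"
        then obtain i j where u: "u = prod_encode (i, j)" "i < P" "j < N" unfolding carr by auto
        have W: "subgroup (generate ?G {?a, ?b}) ?G" using aG bG by (intro generate_is_subgroup) simp
        have "?a \<in> generate ?G {?a, ?b}" "?b \<in> generate ?G {?a, ?b}" by (simp_all add: generate.incl)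
        then have "?a [^]\<^bsub>?G\<^esub> i \<otimes>\<^bsub>?G\<^esub> ?b [^]\<^bsub>?G\<^esub> j \<in> generate ?G {?a, ?b}"
          using W by (metis int_pow_int subgroup_int_pow_closed subgroup.m_closed)
        moreover have "?a [^]\<^bsub>?G\<^esub> i \<otimes>\<^bsub>?G\<^esub> ?b [^]\<^bsub>?G\<^esub> j = u"
          unfolding a_pow b_pow mult u(1) using u(2,3) by simp
        ultimately show "u \<in> generate ?G {?a, ?b}" by simp
      qed
    qed
  qed (rule p)
qed

section \<open>Normal forms\<close>

context metacyclic
begin

text \<open>\<open>b\<close> commutes with its own power \<open>b^(p^n) = a^(p^l)\<close>, but also
  raises it to the power \<open>1 + p^k\<close>.\<close>

lemma m_le_l_k: "m \<le> l + k"
proof -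
  have "b \<otimes> a [^] (p ^ l) = a [^] (p ^ l) \<otimes> b"
    using commute_pow[OF b b refl, of 1 "p ^ n"] b unfolding b_pow by simp
  then have "a [^] (p ^ l * (1 + p ^ k)) \<otimes> b = a [^] (p ^ l) \<otimes> b" using swap[of 1 "p ^ l"] b by simp
  then have "a [^] (p ^ l * (1 + p ^ k)) = a [^] (p ^ l)" using a b by (meson nat_pow_closed r_cancel)
  then have "(p ^ l * (1 + p ^ k)) mod p ^ m = p ^ l mod p ^ m" unfolding a_pow_eq_iff .
  then have "p ^ m dvd p ^ l * (1 + p ^ k) - p ^ l" by (simp add: mod_eq_dvd_iff_nat)
  then have "p ^ m dvd p ^ (l + k)" by (simp add: algebra_simps power_add)
  then show ?thesis using p by (simp add: dvd_power_iff_le prime_ge_2_nat)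
qed

text \<open>\<open>a\<close> commutes with \<open>b^(p^n)\<close>, a power of \<open>a\<close>, so
  \<open>(1 + p^k)^(p^n)\<close> is 1 modulo \<open>p^m\<close>; its distance from 1 has exact
  \<open>p\<close>-adic valuation \<open>k + n\<close>.\<close>

lemma m_le_n_k:
  assumes k: "k \<ge> 2"
  shows "m \<le> n + k"
proof -
  have "a \<otimes> b [^] (p ^ n) = b [^] (p ^ n) \<otimes> a"
    using commute_pow[OF a a refl, of 1 "p ^ l"] a unfolding b_pow by simp
  then have "a \<otimes> b [^] (p ^ n) = a [^] ((1 + p ^ k) ^ (p ^ n)) \<otimes> b [^] (p ^ n)"
    using swap[of "p ^ n" 1] a by simp
  then have "a [^] (1::nat) = a [^] ((1 + p ^ k) ^ (p ^ n))" using a b by (metis nat_pow_closed nat_pow_eone r_cancel)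
  then have "((1 + p ^ k) ^ (p ^ n)) mod p ^ m = 1 mod p ^ m" unfolding a_pow_eq_iff by simp
  then have "[int ((1 + p ^ k) ^ (p ^ n)) = int 1] (mod int (p ^ m))" unfolding cong_int_iff by (simp add: cong_def)
  then have "int (p ^ m) dvd (1 + 1 * int p ^ k) ^ (p ^ n) - 1" by (simp add: cong_iff_dvd_diff)
  moreover obtain z where "(1 + 1 * int p ^ k) ^ (p ^ n) = 1 + 1 * int p ^ (k + n) * (1 + int p * z)"
    using power_prime_power_exact[OF k] by blast
  ultimately have d: "int (p ^ m) dvd int p ^ (k + n) * (1 + int p * z)" by simp
  have "coprime (int p) (1 + int p * z)"
  proof (rule coprimeI)
    fix d assume "d dvd int p" "d dvd 1 + int p * z"
    then have "d dvd (1 + int p * z) - int p * z" by (intro dvd_diff dvd_mult2)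
    then show "is_unit d" by simp
  qed
  then have "coprime (int (p ^ m)) (1 + int p * z)" by simp
  then have "int (p ^ m) dvd int (p ^ (k + n))" using d by (simp add: coprime_dvd_mult_left_iff)
  then have "p ^ m dvd p ^ (k + n)" by (simp only: int_dvd_int_iff)
  then show ?thesis using p by (simp add: dvd_power_iff_le prime_ge_2_nat)
qed

text \<open>Put \<open>b' = a^j b\<close>. Then \<open>b'^(p^n) = a^(j S + p^l)\<close>, where the
  geometric sum \<open>S\<close> is \<open>p^n\<close> times a unit. For \<open>n <= l\<close> a
  suitable \<open>j\<close> makes this trivial, which the parameters express as
  \<open>l = m\<close>.\<close>

lemma split_complement:
  assumes k: "k \<ge> 2" and nl: "n \<le> l"
  shows "\<exists>b'. metacyclic G p m n m k a b'"
proof -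
  have "int (p ^ 2) dvd (1 + int p ^ k) - 1" using k by (simp add: le_imp_power_dvd)
  from geometric_sum_exact[OF this] obtain z
    where z: "(\<Sum>u<p ^ n. (1 + int p ^ k) ^ u) = int (p ^ n) * (1 + int p * z)" by blast
  have "\<not> int p dvd 1 + int p * z"
  proof
    assume "int p dvd 1 + int p * z"
    then have "int p dvd (1 + int p * z) - int p * z" by (intro dvd_diff) auto
    then show False using p by (simp add: prime_nat_iff)
  qed
  then obtain j where "int (p ^ m) dvd int (p ^ (l - n)) + int j * (1 + int p * z)"
    using coprime_solve[OF p] by blast
  then have d: "int (p ^ m) dvd int (p ^ n) * (int (p ^ (l - n)) + int j * (1 + int p * z))" by (rule dvd_mult)
  define S where "S = (\<Sum>t<p ^ n. ((1 + p ^ k) ^ 1) ^ t)"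
  have S: "int S = int (p ^ n) * (1 + int p * z)" unfolding S_def z[symmetric] by simp
  have pl: "p ^ n * p ^ (l - n) = p ^ l" using nl by (simp flip: power_add)
  have "int (p ^ n) * (int (p ^ (l - n)) + int j * (1 + int p * z))
      = int j * (int (p ^ n) * (1 + int p * z)) + int (p ^ n * p ^ (l - n))"
    by (simp add: algebra_simps)
  also have "\<dots> = int (j * S + p ^ l)" unfolding S[symmetric] pl by simp
  finally have "p ^ m dvd j * S + p ^ l" using d by (simp only: int_dvd_int_iff)
  then have one: "a [^] (j * S + p ^ l) = \<one>" using a_pow_one_iff by blast
  define b' where "b' = a [^] j \<otimes> b"
  have b': "b' \<in> carrier G" unfolding b'_def using a b by simp
  have "metacyclic G p m n m k a b'"
  proof unfold_locales
    have "b' \<otimes> a = a [^] j \<otimes> (a [^] (1 + p ^ k) \<otimes> b)"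
      unfolding b'_def using a b ba by (simp add: m_assoc)
    also have "\<dots> = (a [^] j \<otimes> a [^] (1 + p ^ k)) \<otimes> b" using a b by (simp add: m_assoc)
    also have "a [^] j \<otimes> a [^] (1 + p ^ k) = a [^] (1 + p ^ k) \<otimes> a [^] j" by (rule commute_pow[OF a a refl])
    finally show "b' \<otimes> a = a [^] (1 + p ^ k) \<otimes> b'" unfolding b'_def using a b by (simp add: m_assoc)
    show "b' [^] (p ^ n) = a [^] (p ^ m)"
      using pow_form[of j 1 "p ^ n"] one a b unfolding b'_def S_def a_pow by (simp add: b_pow nat_pow_mult)
    have W: "subgroup (generate G {a, b'}) G" using a b' by (intro generate_is_subgroup) simp
    interpret W: subgroup "generate G {a, b'}" G by (rule W)
    have aW: "a \<in> generate G {a, b'}" and bW: "b' \<in> generate G {a, b'}" by (simp_all add: generate.incl)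
    have "a [^] j \<in> generate G {a, b'}" using aW W by (metis int_pow_int subgroup_int_pow_closed)
    then have "inv (a [^] j) \<otimes> b' \<in> generate G {a, b'}" using bW by simp
    moreover have "inv (a [^] j) \<otimes> b' = b" unfolding b'_def using a b by (simp flip: m_assoc)
    ultimately have "generate G {a, b} \<subseteq> generate G {a, b'}" using aW W by (intro generate_subgroup_incl) auto
    then show "generate G {a, b'} = carrier G" using gen W.subset by simp
  qed (use p a b' a_pow order finite_carrier in auto)
  then show ?thesis by blast
qed

end

context metacyclic_pair
begin

text \<open>\<open>m\<close> comes from the order of \<open>a\<close> and \<open>n\<close> from the
  index of \<open><a>\<close>, so \<open>b^(p^n)\<close> is some \<open>a^(d p^l)\<close> with
  \<open>d\<close> prime to \<open>p\<close>. Replacing \<open>a\<close> by \<open>a^d\<close>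
  absorbs \<open>d\<close> and leaves the action of \<open>b\<close> unchanged.\<close>

lemma metacyclic_parameters:
  assumes p: "Factorial_Ring.prime p" and ord: "order G = p ^ x" and Q: "Q = 1 + p ^ k"
  obtains m n l a' where "metacyclic G p m n l k a' b" "generate G {a'} = generate G {a}" "l \<le> m" "m + n = x"
proof -
  obtain m where m: "m \<le> x" "ord a = p ^ m"
    using ord_dvd_group_order[OF a] unfolding ord using divides_primepow_nat[OF p] by blast
  define n where "n = x - m"
  let ?A = "generate G {a}"
  have A: "?A \<lhd> G" using normal_sub[of 1] a by simp
  interpret A: normal ?A G by (rule A)
  have p0: "p > 0" using p prime_gt_0_nat by blast
  have "card (rcosets ?A) * card ?A = p ^ x"
    using lagrange[OF A.subgroup_axioms] ord by (simp add: mult.commute order_def)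
  moreover have "card ?A = p ^ m" using generate_pow_card[OF a] m by simp
  moreover have "p ^ x = p ^ n * p ^ m" using m by (simp add: n_def flip: power_add)
  ultimately have "card (rcosets ?A) = p ^ n" using p0 by simp
  then have ordQ: "order (G Mod ?A) = p ^ n" by (simp add: order_def FactGroup_def)
  interpret q: group_hom G "G Mod ?A" "\<lambda>x. ?A #> x" by (rule quotient_hom[OF A])
  have "(?A #> b) [^]\<^bsub>G Mod ?A\<^esub> (p ^ n) = \<one>\<^bsub>G Mod ?A\<^esub>"
    using q.H.pow_order_eq_1[of "?A #> b"] ordQ b by simp
  then have "?A #> (b [^] (p ^ n)) = \<one>\<^bsub>G Mod ?A\<^esub>" using q.hom_nat_pow[OF b] by simp
  then have "b [^] (p ^ n) \<in> ?A" using quotient_hom(3)[OF A] b by simp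
  then obtain i :: nat where i: "b [^] (p ^ n) = a [^] i"
    using generate_pow_on_finite_carrier[OF finite_carrier a] by blast
  have am: "a [^] (p ^ m) = \<one>" using pow_ord_eq_1[OF a] m by simp
  \<comment> \<open>A trivial power of \<open>a\<close> is written as \<open>a^(p^m)\<close>;
    otherwise \<open>l\<close> is the multiplicity of \<open>p\<close> in the exponent.\<close>
  have "\<exists>d l. \<not> p dvd d \<and> l \<le> m \<and> b [^] (p ^ n) = a [^] (d * p ^ l)"
  proof (cases "p ^ m dvd i")
    case True
    have "a [^] i = \<one>" using pow_dvd_one[OF a am True] .
    then have "b [^] (p ^ n) = a [^] (1 * p ^ m)" using i am by simp
    then show ?thesis using p by (intro exI[of _ 1] exI[of _ m]) (simp add: prime_nat_iff)
  next
    case False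
    then have "i \<noteq> 0" by (metis dvd_0_right)
    then obtain d where d: "i = p ^ multiplicity p i * d" "\<not> p dvd d"
      using multiplicity_decompose'[of i p] p by (metis not_prime_unit)
    have "multiplicity p i \<le> m"
    proof (rule ccontr)
      assume "\<not> multiplicity p i \<le> m"
      then have "p ^ m dvd p ^ multiplicity p i" by (intro le_imp_power_dvd) simp
      then show False using False d(1) by (metis dvd_mult2)
    qed
    then show ?thesis using i d by (metis mult.commute)
  qed
  then obtain d l where d: "\<not> p dvd d" "l \<le> m" "b [^] (p ^ n) = a [^] (d * p ^ l)" by blast
  define a' where "a' = a [^] d"
  have a': "a' \<in> carrier G" unfolding a'_def using a by simp
  have gen': "generate G {a'} = generate G {a}"
    using generate_pow_unit[OF p a am, of "int d"] d(1) unfolding a'_def int_pow_int by simp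
  have "metacyclic G p m n l k a' b"
  proof unfold_locales
    have "b \<otimes> a' = (a [^] Q) [^] d \<otimes> b" unfolding a'_def using a b ba by (intro conj_pow) auto
    then show "b \<otimes> a' = a' [^] (1 + p ^ k) \<otimes> b"
      unfolding a'_def nat_pow_pow[OF a] Q by (simp only: mult.commute)
    show "a' [^] (p ^ m) = \<one>"
      unfolding a'_def nat_pow_pow[OF a] using pow_dvd_one[OF a am] by simp
    show "b [^] (p ^ n) = a' [^] (p ^ l)" unfolding d(3) a'_def nat_pow_pow[OF a] ..
    show "order G = p ^ (m + n)" using ord m by (simp add: n_def)
    have "a \<in> generate G {a'}" unfolding gen' by (simp add: generate.incl)
    also have "generate G {a'} \<subseteq> generate G {a', b}" by (rule mono_generate) simp
    finally have "generate G {a, b} \<subseteq> generate G {a', b}"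
      using a' b by (intro generate_subgroup_incl generate_is_subgroup) (auto intro: generate.incl)
    then show "generate G {a', b} = carrier G" using gen generate_incl[of "{a', b}"] a' b by auto
  qed (use p a' b finite_carrier in auto)
  then show thesis using that gen' d(2) m by (simp add: n_def)
qed

end

text \<open>The three cases are the abelian, the split nonabelian and the nonsplit groups. An abelian group is given
  \<open>k = m + 1\<close>, which makes the action of \<open>b\<close> on \<open>a\<close> trivial and keeps \<open>k \<ge> 2\<close> true in all cases.\<close>

definition metacyclic_types :: "nat \<Rightarrow> (nat \<times> nat \<times> nat \<times> nat) set" where
  "metacyclic_types x = {(m, n, l, k). m + n = x \<and> 1 \<le> n \<and>
     (l = m \<and> k = m + 1 \<and> n \<le> m \<or>
      l = m \<and> 2 \<le> k \<and> k < m \<and> m \<le> n + k \<or>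
      2 \<le> k \<and> k < l \<and> l < m \<and> l < n \<and> m \<le> l + k)}"

section \<open>Every group in question has a type\<close>

context group
begin

text \<open>Choosing \<open>a\<close> as the generator of larger order yields \<open>n <= l\<close>,
  so that a complement exists.\<close>

lemma abelian_type:
  assumes p: "Factorial_Ring.prime p" and ord: "order G = p ^ x"
    and xy: "a \<in> carrier G" "b \<in> carrier G" "generate G {a, b} = carrier G"
    and comm: "a \<otimes> b = b \<otimes> a" and dvd: "ord b dvd ord a"
    and nc: "\<And>g. g \<in> carrier G \<Longrightarrow> generate G {g} \<noteq> carrier G"
  shows "\<exists>m n l k a b. (m, n, l, k) \<in> metacyclic_types x \<and> metacyclic G p m n l k a b"
proof -
  have p0: "p > 0" using p prime_gt_0_nat by blast
  have fin: "finite (carrier G)"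
    using ord p0 unfolding order_def by (metis card.infinite zero_less_power less_irrefl)
  obtain m where m: "m \<le> x" "ord a = p ^ m"
    using ord_dvd_group_order[OF xy(1)] unfolding ord using divides_primepow_nat[OF p] by blast
  define k where "k = m + 1"
  have am: "a [^] (p ^ m) = \<one>" using pow_ord_eq_1[OF xy(1)] m by simp
  have ak: "a [^] (p ^ k) = \<one>" using pow_dvd_one[OF xy(1) am] unfolding k_def by simp
  interpret mp: metacyclic_pair G "1 + p ^ k" a b
  proof unfold_locales
    show "b \<otimes> a = a [^] (1 + p ^ k) \<otimes> b" using xy comm ak by (simp add: nat_pow_mult[symmetric])
  qed (use xy fin in auto)
  obtain m' n l a' where mc': "metacyclic G p m' n l k a' b"
    and g': "generate G {a'} = generate G {a}" and l: "l \<le> m'" and x: "m' + n = x"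
    using mp.metacyclic_parameters[OF p ord refl] by blast
  interpret mc': metacyclic G p m' n l k a' b by (rule mc')
  have "ord a' = ord a" using generate_pow_card[OF mc'.a] generate_pow_card[OF xy(1)] g' by simp
  then have "p ^ m' = p ^ m" using mc'.ord_a m by simp
  then have mm: "m' = m" using p prime_gt_1_nat power_inject_exp by metis
  have bm: "b [^] (p ^ m) = \<one>" using dvd pow_eq_id[OF xy(2)] m by simp
  have "p ^ n dvd p ^ m" using mc'.b_pow_in_a[of "p ^ m" 0] bm by simp
  then have nm: "n \<le> m" using p by (simp add: dvd_power_iff_le prime_ge_2_nat)
  \<comment> \<open>\<open>b^(p^m) = 1\<close> reads \<open>a'^(p^(l + m - n)) = 1\<close>, whence
    \<open>m <= l + m - n\<close>.\<close>
  have "n \<le> l"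
  proof -
    have "p ^ m = p ^ n * p ^ (m - n)" using nm by (simp flip: power_add)
    then have "b [^] (p ^ m) = (b [^] (p ^ n)) [^] (p ^ (m - n))" using xy(2) by (simp add: nat_pow_pow)
    then have "b [^] (p ^ m) = a' [^] (p ^ l * p ^ (m - n))" using mc'.b_pow mc'.a by (simp add: nat_pow_pow)
    then have "a' [^] (p ^ l * p ^ (m - n)) = \<one>" using bm by simp
    then have "p ^ m dvd p ^ (l + (m - n))" unfolding mc'.a_pow_one_iff mm by (simp add: power_add)
    then have "m \<le> l + (m - n)" using p by (simp add: dvd_power_iff_le prime_ge_2_nat)
    then show ?thesis using nm by simp
  qed
  have n1: "1 \<le> n"
  proof (rule ccontr)
    assume "\<not> 1 \<le> n"
    then have "n = 0" by simp
    then have "b = a' [^] (p ^ l)" using mc'.b_pow xy(2) by simp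
    then have "b \<in> generate G {a'}"
      using mc'.a generate_pow[OF mc'.a] by (metis (mono_tags, lifting) UNIV_I int_pow_int mem_Collect_eq)
    moreover have "a' \<in> generate G {a'}" by (simp add: generate.incl)
    ultimately have "generate G {a', b} \<subseteq> generate G {a'}"
      using mc'.a by (intro generate_subgroup_incl generate_is_subgroup) auto
    then have "generate G {a'} = carrier G" using mc'.gen mc'.a generate_incl[of "{a'}"] by auto
    then show False using nc mc'.a by blast
  qed
  have "2 \<le> k" unfolding k_def using n1 nm by simp
  then obtain b' where b': "metacyclic G p m n m k a' b'"
    using mc'.split_complement \<open>n \<le> l\<close> mm by blast
  moreover have "(m, n, m, k) \<in> metacyclic_types x"
    unfolding metacyclic_types_def using x mm n1 nm by (simp add: k_def)
  ultimately show ?thesis by blast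
qed

text \<open>The deep root \<open>a\<close> of \<open>metacyclic_generators\<close> generates a
  normal subgroup. What remains is to normalise the multiplier through \<open>b\<close>, the
  relation for \<open>b^(p^n)\<close> through \<open>a\<close>, and to split whenever
  \<open>n <= l\<close>.\<close>

lemma nonabelian_type:
  assumes p: "Factorial_Ring.prime p" and ord: "order G = p ^ x"
    and xy: "u \<in> carrier G" "v \<in> carrier G" "generate G {u, v} = carrier G"
    and nonab: "comm G u v \<noteq> \<one>"
    and pw: "derived G (carrier G) \<subseteq> power_subgroup G (carrier G) (powerful_exponent p)"
    and chain: "pn_chain p G H N"
  shows "\<exists>m n l k a b. (m, n, l, k) \<in> metacyclic_types x \<and> metacyclic G p m n l k a b"
proof -
  let ?D = "derived G (carrier G)"
  have p0: "p > 0" using p prime_gt_0_nat by blast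
  have fin: "finite (carrier G)"
    using ord p0 unfolding order_def by (metis card.infinite zero_less_power less_irrefl)
  have exp: "g [^] (p ^ x) = \<one>" if "g \<in> carrier G" for g using pow_order_eq_1[OF that] ord by simp
  obtain a b k where a: "a \<in> carrier G" and b: "b \<in> carrier G" and gen: "generate G {a, b} = carrier G"
    and k: "k \<ge> 2" and D: "?D = generate G {a [^] (p ^ k)}"
    and max: "\<And>v k'. v \<in> carrier G \<Longrightarrow> ?D = generate G {v [^] (p ^ k')} \<Longrightarrow> k' \<le> k"
    using metacyclic_generators[OF p exp xy pw chain nonab] by blast
  have Dne: "?D \<noteq> {\<one>}" using comm_in_derived[OF xy(1,2)] nonab by auto
  have ak: "a [^] (p ^ k) \<in> carrier G" using a by simp
  have "comm G b a \<in> ?D" using b a by (rule comm_in_derived)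
  then obtain z :: nat where z: "comm G b a = (a [^] (p ^ k)) [^] z"
    unfolding D generate_pow_on_finite_carrier[OF fin ak] by blast
  have "b \<otimes> a = a [^] (1 + p ^ k * z) \<otimes> b"
    using comm_swap[OF b a] unfolding z using a by (simp add: nat_pow_pow nat_pow_mult[symmetric] nat_pow_comm)
  then interpret mp: metacyclic_pair G "1 + p ^ k * z" a b
    using a b gen fin by unfold_locales auto
  \<comment> \<open>Otherwise \<open>G'\<close> would lie in \<open><a^(p^(k+1))>\<close>, a proper
    subgroup of \<open><a^(p^k)> = G'\<close>.\<close>
  have pz: "\<not> p dvd z"
  proof
    assume "p dvd z"
    then obtain t where t: "z = p * t" by blast
    let ?N = "generate G {a [^] (p ^ (k + 1))}"
    have a1: "a [^] (p ^ (k + 1)) \<in> carrier G" using a by simp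
    have "comm G b a = (a [^] (p ^ (k + 1))) [^] t" unfolding z t using a by (simp add: nat_pow_pow mult_ac)
    then have "comm G b a \<in> ?N" unfolding generate_pow_on_finite_carrier[OF fin a1] by blast
    then have "?D \<subseteq> ?N"
      using gen by (intro derived_subset_normal2[OF mp.normal_sub b a]) (simp_all add: insert_commute)
    moreover have "a [^] (p ^ k) \<in> ?D" unfolding D by (simp add: generate.incl)
    ultimately obtain j where "a [^] (p ^ k) = (a [^] (p ^ (k + 1))) [^] (j::int)"
      unfolding generate_pow[OF a1] by blast
    also have "\<dots> = (a [^] (p ^ k)) [^] (int p * j)" using a by (simp add: int_pow_pow mult_ac flip: int_pow_int)
    finally have "a [^] (p ^ k) = \<one>" using int_pow_p_eq_self[OF p ak exp[OF ak]] by blast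
    then show False using Dne D generate_one by simp
  qed
  then have "\<not> int p dvd int z" by simp
  \<comment> \<open>The modulus \<open>p^x\<close> is the group order, so congruent exponents give
    equal powers of \<open>a\<close>.\<close>
  then obtain i where i: "\<not> p dvd i" and iM: "int p ^ x dvd (1 + int z * int p ^ k) ^ i - (1 + int p ^ k)"
    using normalize_multiplier[OF p k] by blast
  define b1 where "b1 = b [^] i"
  have b1: "b1 \<in> carrier G" unfolding b1_def using b by simp
  interpret mp1: metacyclic_pair G "1 + p ^ k" a b1
  proof unfold_locales
    have "[int ((1 + p ^ k * z) ^ i) = int (1 + p ^ k)] (mod int (p ^ x))"
      unfolding cong_iff_dvd_diff using iM by (simp add: mult.commute)
    then have "[(1 + p ^ k * z) ^ i = 1 + p ^ k] (mod (p ^ x))" by (simp only: cong_int_iff)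
    then have "a [^] ((1 + p ^ k * z) ^ i) = a [^] (1 + p ^ k)"
      unfolding cong_def by (metis pow_mod[OF a exp[OF a]])
    then show "b1 \<otimes> a = a [^] (1 + p ^ k) \<otimes> b1" using mp.swap[of i 1] a unfolding b1_def by simp
    have "generate G {b1} = generate G {b}"
      using generate_pow_unit[OF p b exp[OF b], of "int i"] i unfolding b1_def int_pow_int by simp
    then have "b \<in> generate G {b1}" by (simp add: generate.incl)
    also have "generate G {b1} \<subseteq> generate G {a, b1}" by (rule mono_generate) simp
    finally have "generate G {a, b} \<subseteq> generate G {a, b1}"
      using a b1 by (intro generate_subgroup_incl generate_is_subgroup) (auto intro: generate.incl)
    then have "carrier G \<subseteq> generate G {a, b1}" unfolding gen .
    moreover have "generate G {a, b1} \<subseteq> carrier G" by (rule generate_incl) (use a b1 in simp)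
    ultimately show "generate G {a, b1} = carrier G" by blast
  qed (rule a b1 fin)+
  obtain m n l a' where mc: "metacyclic G p m n l k a' b1" and "generate G {a'} = generate G {a}"
    and l: "l \<le> m" and x: "m + n = x"
    by (rule mp1.metacyclic_parameters[OF p ord refl])
  interpret mc: metacyclic G p m n l k a' b1 by (rule mc)
  have km: "k < m"
  proof (rule ccontr)
    assume "\<not> k < m"
    then have "card ?D = 1" using mc.card_derived by simp
    then show False using Dne comm_in_derived[OF one_closed one_closed] by (auto simp: card_1_singleton_iff)
  qed
  have mlk: "m \<le> l + k" and mnk: "m \<le> n + k" using mc.m_le_l_k mc.m_le_n_k[OF k] by auto
  have n1: "1 \<le> n" using mnk km by simp
  show ?thesis
  proof (cases "n \<le> l \<or> l = m")
    case True
    then obtain b' where b': "metacyclic G p m n m k a' b'"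
      using mc.split_complement[OF k] mc by blast
    moreover have "(m, n, m, k) \<in> metacyclic_types x"
      unfolding metacyclic_types_def using x n1 k km mnk by simp
    ultimately show ?thesis by blast
  next
    case False
    \<comment> \<open>If \<open>l <= k\<close>, then \<open>b1^(p^(n+k-l)) = a'^(p^k)\<close>
      generates \<open>G'\<close>. Maximality of \<open>k\<close> bounds \<open>n + k - l\<close> by
      \<open>k\<close>, so \<open>n <= l\<close>, the case already split.\<close>
    have "k < l"
    proof (rule ccontr)
      assume "\<not> k < l"
      then have kl: "l \<le> k" by simp
      have "p ^ (n + k - l) = p ^ n * p ^ (k - l)" using kl by (simp flip: power_add)
      then have "b1 [^] (p ^ (n + k - l)) = a' [^] (p ^ l * p ^ (k - l))"
        using mc.b_pow mc.a b1 by (metis nat_pow_pow)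
      also have "p ^ l * p ^ (k - l) = p ^ k" using kl by (simp flip: power_add)
      finally have "?D = generate G {b1 [^] (p ^ (n + k - l))}" using mc.derived_eq by simp
      then have "n + k - l \<le> k" using max[OF b1] by blast
      then have "n \<le> l" by linarith
      then show False using False by simp
    qed
    then have "(m, n, l, k) \<in> metacyclic_types x"
      unfolding metacyclic_types_def using x n1 k False l mlk by simp
    then show ?thesis using mc by blast
  qed
qed

lemma pn_rank2_type:
  assumes pn: "powerfully_nilpotent p G" and rank: "group_rank G = 2" and ord: "order G = p ^ x"
  shows "\<exists>m n l k a b. (m, n, l, k) \<in> metacyclic_types x \<and> metacyclic G p m n l k a b"
proof -
  obtain H N where p: "Factorial_Ring.prime p" and chain: "pn_chain p G H N"
    and pw: "derived G (carrier G) \<subseteq> power_subgroup G (carrier G) (powerful_exponent p)"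
    using powerfully_nilpotentE[OF pn] by blast
  define R where "R t \<longleftrightarrow> (\<exists>S\<subseteq>carrier G. finite S \<and> card S = t \<and> generate G S = carrier G)" for t
  have p0: "p > 0" using p prime_gt_0_nat by blast
  have fin: "finite (carrier G)"
    using ord p0 unfolding order_def by (metis card.infinite zero_less_power less_irrefl)
  have "generate G (carrier G) = carrier G"
    using generate_incl[of "carrier G"] generate.incl[of _ "carrier G" G] by blast
  then have "R (card (carrier G))" unfolding R_def using fin by blast
  then have "R (LEAST t. R t)" by (rule LeastI)
  moreover have L: "(LEAST t. R t) = 2" using rank unfolding group_rank_def R_def .
  ultimately obtain S where S: "S \<subseteq> carrier G" "card S = 2" "generate G S = carrier G" unfolding R_def by auto
  have nc: "generate G {g} \<noteq> carrier G" if "g \<in> carrier G" for g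
  proof
    assume "generate G {g} = carrier G"
    then have "R 1" unfolding R_def using that by (intro exI[of _ "{g}"]) simp
    then show False using L Least_le[of R 1] by simp
  qed
  obtain u v where uv: "S = {u, v}" using S(2) by (auto simp: card_2_iff)
  have uvG: "u \<in> carrier G" "v \<in> carrier G" and gen: "generate G {u, v} = carrier G" using S uv by auto
  show ?thesis
  proof (cases "comm G u v = \<one>")
    case False
    then show ?thesis using nonabelian_type[OF p ord uvG gen _ pw chain] by blast
  next
    case True
    then have c: "u \<otimes> v = v \<otimes> u" using comm_eq_one_iff[OF uvG] by simp
    obtain s t where "ord u = p ^ s" "ord v = p ^ t"
      using ord_dvd_group_order[OF uvG(1)] ord_dvd_group_order[OF uvG(2)]
      unfolding ord using divides_primepow_nat[OF p] by metis
    \<comment> \<open>Orders are powers of \<open>p\<close> and hence comparable; the generators can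
      be exchanged if necessary.\<close>
    then have "ord v dvd ord u \<or> ord u dvd ord v" by (metis le_imp_power_dvd nat_le_linear)
    then show ?thesis
    proof
      assume "ord v dvd ord u"
      then show ?thesis using abelian_type[OF p ord uvG gen c] nc by blast
    next
      assume d: "ord u dvd ord v"
      have "generate G {v, u} = carrier G" using gen by (simp add: insert_commute)
      then show ?thesis using abelian_type[OF p ord uvG(2,1) _ c[symmetric] d] nc by blast
    qed
  qed
qed

end

section \<open>Counting\<close>

text \<open>The nonsplit types with \<open>m - l = u + 1\<close> and \<open>2 l - m = w\<close> are parametrised by \<open>l - k \<in> {1..w}\<close>, except that
  for \<open>u = 0\<close> the value \<open>l - k = w\<close> would give \<open>k = 1\<close>. In \<open>triangle_count y\<close> truncated subtraction makes
  the sum empty for \<open>y < 3\<close>.\<close>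

definition triangle_count :: "nat \<Rightarrow> nat" where
  "triangle_count y = (\<Sum>w=1..(y - 1) div 2. w)"

text \<open>Here \<open>l = u + 1 + w\<close> and \<open>m = 2 (u + 1) + w\<close>, so
  \<open>l < n\<close> means \<open>2 w < x - 3 (u + 1)\<close>; this is the argument given to
  \<open>triangle_count\<close>. The range \<open>u < x\<close> is a crude bound, as later terms
  vanish.\<close>

definition nonsplit_sum :: "nat \<Rightarrow> nat" where
  "nonsplit_sum x = (\<Sum>u<x. triangle_count (x - 3 * Suc u))"

text \<open>For split nonabelian types with \<open>x = y + 2\<close>, the summand is the number of
  values of \<open>m - k\<close>, which runs from 1 to the minimum of \<open>n\<close> and
  \<open>m - 2 = y - n\<close>.\<close>

definition split_sum :: "nat \<Rightarrow> nat" where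
  "split_sum y = (\<Sum>n<y. min n (y - n))"

section \<open>Closed forms of the counting sums\<close>

lemma triangle_count_even: "2 * int (triangle_count (2 * a)) = int a * (int a - 1)"
proof (cases a)
  case (Suc c)
  have "(2 * a - 1) div 2 = c" using Suc by simp
  then have "2 * triangle_count (2 * a) = c * Suc c"
    unfolding triangle_count_def using gauss_sum_from_Suc_0[of c, where 'a = nat] by simp
  then show ?thesis using Suc by (simp add: algebra_simps flip: of_nat_mult)
qed (simp add: triangle_count_def)

lemma triangle_count_odd: "2 * int (triangle_count (2 * a + 1)) = int a * (int a + 1)"
proof -
  have "2 * triangle_count (2 * a + 1) = a * Suc a"
    unfolding triangle_count_def using gauss_sum_from_Suc_0[of a, where 'a = nat] by simp
  then show ?thesis by (simp add: algebra_simps flip: of_nat_mult)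
qed

lemma nonsplit_sum_add3: "nonsplit_sum (x + 3) = triangle_count x + nonsplit_sum x"
proof -
  have t0: "triangle_count 0 = 0" by (simp add: triangle_count_def)
  have "nonsplit_sum (x + 3) = (\<Sum>u<Suc (Suc (Suc x)). triangle_count (x - 3 * u))"
    unfolding nonsplit_sum_def by (intro sum.cong) auto
  also have "\<dots> = triangle_count x + (\<Sum>u<Suc (Suc x). triangle_count (x - 3 * Suc u))"
    by (subst sum.lessThan_Suc_shift) simp
  also have "\<dots> = triangle_count x + nonsplit_sum x" by (simp add: nonsplit_sum_def t0)
  finally show ?thesis .
qed

lemma nonsplit_sum_add6: "nonsplit_sum (x + 6) = triangle_count (x + 3) + triangle_count x + nonsplit_sum x"
  using nonsplit_sum_add3[of "x + 3"] nonsplit_sum_add3[of x] by (simp add: ac_simps)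

text \<open>Shifting \<open>n\<close> by one raises both arguments of the minimum by one.\<close>

lemma split_sum_add2: "split_sum (y + 2) = split_sum y + y + 1"
proof -
  have "split_sum (y + 2) = (\<Sum>n<Suc (Suc y). min n (y + 2 - n))" by (simp add: split_sum_def)
  also have "\<dots> = (\<Sum>n<Suc y. min (Suc n) (y + 2 - Suc n))" by (subst sum.lessThan_Suc_shift) simp
  also have "\<dots> = (\<Sum>n<Suc y. 1 + min n (y - n))" by (intro sum.cong) auto
  also have "\<dots> = (\<Sum>n<Suc y. 1) + (\<Sum>n<Suc y. min n (y - n))" by (rule sum.distrib)
  also have "\<dots> = (\<Sum>n<y. min n (y - n)) + y + 1" by simp
  finally show ?thesis by (simp add: split_sum_def)
qed

lemma split_sum_even: "int (split_sum (2 * a)) = int a ^ 2"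
proof (induction a)
  case (Suc a)
  then show ?case using split_sum_add2[of "2 * a"] by (simp add: power2_eq_square algebra_simps)
qed (simp add: split_sum_def)

lemma split_sum_odd: "int (split_sum (2 * a + 1)) = int a * (int a + 1)"
proof (induction a)
  case (Suc a)
  then show ?case using split_sum_add2[of "2 * a + 1"] by (simp add: algebra_simps)
qed (simp add: split_sum_def)

text \<open>Two shifts by 3 restore the parity: one of \<open>x\<close> and \<open>x + 3\<close> is
  even and the other odd, so both formulas for \<open>triangle_count\<close> enter once. This is the
  origin of the period 6.\<close>

lemma nonsplit_sum_step:
  "72 * int (nonsplit_sum (x + 6)) =
     72 * int (nonsplit_sum x) + 18 * int x ^ 2 + 36 * int x + (if even x then 72 else 18)"
proof (cases "even x")
  case True
  then obtain a where a: "x = 2 * a" by blast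
  have "x + 3 = 2 * (a + 1) + 1" using a by simp
  then have "2 * int (triangle_count (x + 3)) = int (a + 1) * (int (a + 1) + 1)"
    by (metis triangle_count_odd)
  moreover have "2 * int (triangle_count x) = int a * (int a - 1)" unfolding a by (rule triangle_count_even)
  moreover have "int x = 2 * int a" using a by simp
  ultimately show ?thesis using True nonsplit_sum_add6[of x] by (simp add: power2_eq_square algebra_simps)
next
  case False
  then obtain a where a: "x = 2 * a + 1" by (elim oddE)
  have "x + 3 = 2 * (a + 2)" using a by simp
  then have "2 * int (triangle_count (x + 3)) = int (a + 2) * (int (a + 2) - 1)"
    by (metis triangle_count_even)
  moreover have "2 * int (triangle_count x) = int a * (int a + 1)" unfolding a by (rule triangle_count_odd)
  moreover have "int x = 2 * int a + 1" using a by simp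
  ultimately show ?thesis using False nonsplit_sum_add6[of x] by (simp add: power2_eq_square algebra_simps)
qed

text \<open>In terms of \<open>z = x - 2\<close> the value is \<open>z^3\<close> for even
  \<open>x\<close> and \<open>z^3 - 9 z\<close> for odd \<open>x\<close>, corrected by 8, -8 or 0
  according to whether \<open>x\<close> is 0, 1 or 2 modulo 3.\<close>

lemma nonsplit_sum_eval:
  "72 * int (nonsplit_sum (6 * j)) = (6 * int j - 2) ^ 3 + 8"
  "72 * int (nonsplit_sum (6 * j + 1)) = (6 * int j - 1) ^ 3 - 9 * (6 * int j - 1) - 8"
  "72 * int (nonsplit_sum (6 * j + 2)) = (6 * int j) ^ 3"
  "72 * int (nonsplit_sum (6 * j + 3)) = (6 * int j + 1) ^ 3 - 9 * (6 * int j + 1) + 8"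
  "72 * int (nonsplit_sum (6 * j + 4)) = (6 * int j + 2) ^ 3 - 8"
  "72 * int (nonsplit_sum (6 * j + 5)) = (6 * int j + 3) ^ 3 - 9 * (6 * int j + 3)"
proof (induction j)
  case 0
  { case 1 show ?case by (simp add: nonsplit_sum_def triangle_count_def)
  next case 2 show ?case by (simp add: nonsplit_sum_def triangle_count_def)
  next case 3 show ?case by (simp add: nonsplit_sum_def triangle_count_def numeral_eq_Suc)
  next case 4 show ?case by (simp add: nonsplit_sum_def triangle_count_def numeral_eq_Suc)
  next case 5 show ?case by (simp add: nonsplit_sum_def triangle_count_def numeral_eq_Suc)
  next case 6 show ?case by (simp add: nonsplit_sum_def triangle_count_def numeral_eq_Suc)
  }
next
  case (Suc j)
  { case 1 show ?case using Suc.IH(1) nonsplit_sum_step[of "6 * j"]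
      by (simp add: power2_eq_square power3_eq_cube algebra_simps)
  next case 2 show ?case using Suc.IH(2) nonsplit_sum_step[of "6 * j + 1"]
      by (simp add: power2_eq_square power3_eq_cube algebra_simps)
  next case 3 show ?case using Suc.IH(3) nonsplit_sum_step[of "6 * j + 2"]
      by (simp add: power2_eq_square power3_eq_cube algebra_simps)
  next case 4 show ?case using Suc.IH(4) nonsplit_sum_step[of "6 * j + 3"]
      by (simp add: power2_eq_square power3_eq_cube algebra_simps)
  next case 5 show ?case using Suc.IH(5) nonsplit_sum_step[of "6 * j + 4"]
      by (simp add: power2_eq_square power3_eq_cube algebra_simps)
  next case 6 show ?case using Suc.IH(6) nonsplit_sum_step[of "6 * j + 5"]
      by (simp add: power2_eq_square power3_eq_cube algebra_simps)
  }
qed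

section \<open>Sizes of the three families of types\<close>

lemma card_abelian_types:
  "card {(m, n, l, k). m + n = x \<and> 1 \<le> n \<and> l = m \<and> k = m + 1 \<and> n \<le> m} = x div 2" (is "card ?A = _")
proof -
  have "bij_betw (\<lambda>n. (x - n, n, x - n, x - n + 1)) {1..x div 2} ?A"
    by (rule bij_betw_byWitness[where f' = "\<lambda>(m, n, l, k). n"]) auto
  then show ?thesis using bij_betw_same_card by fastforce
qed

lemma card_split_types:
  assumes "x \<ge> 2"
  shows "card {(m, n, l, k). m + n = x \<and> 1 \<le> n \<and> l = m \<and> 2 \<le> k \<and> k < m \<and> m \<le> n + k} = split_sum (x - 2)"
    (is "card ?B = _")
proof -
  let ?S = "SIGMA n:{..<x - 2}. {1..min n (x - 2 - n)}"
  have "bij_betw (\<lambda>(n, d). (x - n, n, x - n, x - n - d)) ?S ?B"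
    by (rule bij_betw_byWitness[where f' = "\<lambda>(m, n, l, k). (n, m - k)"]) auto
  then have "card ?B = card ?S" using bij_betw_same_card by fastforce
  also have "\<dots> = split_sum (x - 2)" unfolding split_sum_def by (subst card_SigmaI) auto
  finally show ?thesis .
qed

text \<open>The added term restores the tuples with \<open>k = 1\<close>, one for each
  \<open>w\<close> at \<open>u = 0\<close>, so that the full triangular sums appear.\<close>

lemma card_nonsplit_types:
  assumes "x \<ge> 1"
  shows "card {(m, n, l, k). m + n = x \<and> 1 \<le> n \<and> 2 \<le> k \<and> k < l \<and> l < m \<and> l < n \<and> m \<le> l + k} + (x - 4) div 2
    = nonsplit_sum x" (is "card ?C + _ = _")
proof -
  define h where "h u = (x - 3 * Suc u - 1) div 2" for u
  let ?S = "SIGMA u:{..<x}. SIGMA w:{1..h u}. {1..if u = 0 then w - 1 else w}"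
  have "bij_betw (\<lambda>(u, w, s). (2 * Suc u + w, x - (2 * Suc u + w), Suc u + w, Suc u + w - s)) ?S ?C"
  proof (rule bij_betw_byWitness[where f' = "\<lambda>(m, n, l, k). (m - l - 1, 2 * l - m, l - k)"])
    show "(\<lambda>(u, w, s). (2 * Suc u + w, x - (2 * Suc u + w), Suc u + w, Suc u + w - s)) ` ?S \<subseteq> ?C"
    proof (rule image_subsetI)
      fix t assume tS: "t \<in> ?S"
      obtain u w s where t: "t = (u, w, s)" by (rule prod_cases3)
      have a: "u \<in> {..<x}" "w \<in> {1..h u}" "s \<in> {1..if u = 0 then w - 1 else w}"
        using tS unfolding t by blast+
      have "3 * Suc u + 2 * w < x" using a(2) unfolding h_def by auto
      moreover have "1 \<le> s" "s \<le> w" "u = 0 \<longrightarrow> s < w" using a(3) by (auto split: if_splits)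
      ultimately show "(case t of (u, w, s) \<Rightarrow> (2 * Suc u + w, x - (2 * Suc u + w), Suc u + w, Suc u + w - s)) \<in> ?C"
        unfolding t by auto
    qed
    show "(\<lambda>(m, n, l, k). (m - l - 1, 2 * l - m, l - k)) ` ?C \<subseteq> ?S"
      by (auto simp: h_def split: if_splits)
  qed auto
  then have "card ?C = card ?S" using bij_betw_same_card by fastforce
  also have "\<dots> = (\<Sum>u<x. \<Sum>w=1..h u. if u = 0 then w - 1 else w)"
    by (subst card_SigmaI) (auto intro!: sum.cong)
  finally have C: "card ?C = (\<Sum>u<x. \<Sum>w=1..h u. if u = 0 then w - 1 else w)" .
  obtain y where y: "x = Suc y" using assms by (cases x) auto
  have "(\<Sum>w=1..h 0. w - 1) + h 0 = (\<Sum>w=1..h 0. (w - 1) + 1)" by (subst sum.distrib) simp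
  also have "\<dots> = (\<Sum>w=1..h 0. w)" by (intro sum.cong) auto
  finally have "(\<Sum>w=1..h 0. w - 1) + h 0 = (\<Sum>w=1..h 0. w)" .
  then have "(\<Sum>u<x. \<Sum>w=1..h u. if u = 0 then w - 1 else w) + h 0 = (\<Sum>u<x. \<Sum>w=1..h u. w)"
    unfolding y sum.lessThan_Suc_shift by simp
  moreover have "h 0 = (x - 4) div 2" by (simp add: h_def)
  ultimately have "card ?C + (x - 4) div 2 = (\<Sum>u<x. \<Sum>w=1..h u. w)" unfolding C by simp
  then show ?thesis unfolding nonsplit_sum_def triangle_count_def h_def .
qed

lemma metacyclic_types_finite: "finite (metacyclic_types x)"
  by (rule finite_subset[of _ "{..x} \<times> {..x} \<times> {..x} \<times> {..Suc x}"]) (auto simp: metacyclic_types_def)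

text \<open>The number \<open>x div 2\<close> of abelian types is \<open>2 + (x - 4) div 2\<close>;
  its second part is just what the nonsplit count falls short of
  \<open>nonsplit_sum\<close>.\<close>

lemma card_metacyclic_types:
  assumes "x \<ge> 4"
  shows "card (metacyclic_types x) = 2 + split_sum (x - 2) + nonsplit_sum x"
proof -
  let ?A = "{(m, n, l, k). m + n = x \<and> 1 \<le> n \<and> l = m \<and> k = m + 1 \<and> n \<le> m}"
  let ?B = "{(m, n, l, k). m + n = x \<and> 1 \<le> n \<and> l = m \<and> 2 \<le> k \<and> k < m \<and> m \<le> n + k}"
  let ?C = "{(m, n, l, k). m + n = x \<and> 1 \<le> n \<and> 2 \<le> k \<and> k < l \<and> l < m \<and> l < n \<and> m \<le> l + k}"
  have T: "metacyclic_types x = (?A \<union> ?B) \<union> ?C" unfolding metacyclic_types_def by auto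
  have "?A \<subseteq> metacyclic_types x" "?B \<subseteq> metacyclic_types x" "?C \<subseteq> metacyclic_types x"
    unfolding T by (rule le_supI1, rule Un_upper1, rule le_supI1, rule Un_upper2, rule Un_upper2)
  then have fin: "finite ?A" "finite ?B" "finite ?C"
    using finite_subset[OF _ metacyclic_types_finite[of x]] by (simp_all only:)
  have "?A \<inter> ?B = {}" "(?A \<union> ?B) \<inter> ?C = {}" by fastforce+
  then have "card (metacyclic_types x) = card ?A + card ?B + card ?C"
    unfolding T using fin by (simp only: card_Un_disjoint finite_Un)
  moreover have "x div 2 = 2 + (x - 4) div 2" using assms by auto
  moreover have "card ?C + (x - 4) div 2 = nonsplit_sum x" using assms by (intro card_nonsplit_types) simp
  moreover have "card ?B = split_sum (x - 2)" using assms by (intro card_split_types) simp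
  ultimately show ?thesis using card_abelian_types[of x] by linarith
qed

section \<open>Distinguishing the types by invariants\<close>

lemma iso_invariants:
  assumes "group G" "group G'" "f \<in> iso G G'"
  shows "card (derived G (carrier G)) = card (derived G' (carrier G'))"
    and "(\<forall>g\<in>carrier G. g [^]\<^bsub>G\<^esub> (N::nat) = \<one>\<^bsub>G\<^esub>) \<longleftrightarrow> (\<forall>g\<in>carrier G'. g [^]\<^bsub>G'\<^esub> N = \<one>\<^bsub>G'\<^esub>)"
    and "(\<forall>g\<in>carrier G. g [^]\<^bsub>G\<^esub> N \<in> derived G (carrier G)) \<longleftrightarrow>
      (\<forall>g\<in>carrier G'. g [^]\<^bsub>G'\<^esub> N \<in> derived G' (carrier G'))"
proof -
  interpret f: group_hom G G' f
    using assms by (simp add: group_hom_def group_hom_axioms_def iso_def)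
  have bij: "bij_betw f (carrier G) (carrier G')" using assms(3) by (simp add: iso_def)
  then have im: "carrier G' = f ` carrier G" and inj: "inj_on f (carrier G)" by (auto simp: bij_betw_def)
  have D: "derived G' (carrier G') = f ` derived G (carrier G)" using f.derived_img[of "carrier G"] im by simp
  have DG: "derived G (carrier G) \<subseteq> carrier G" using f.G.derived_in_carrier by simp
  show "card (derived G (carrier G)) = card (derived G' (carrier G'))"
    unfolding D using inj DG by (metis card_image inj_on_subset)
  have pow: "f g [^]\<^bsub>G'\<^esub> N = f (g [^]\<^bsub>G\<^esub> N)" if "g \<in> carrier G" for g using f.hom_nat_pow[OF that] by simp
  have one: "f g = \<one>\<^bsub>G'\<^esub> \<longleftrightarrow> g = \<one>\<^bsub>G\<^esub>" if "g \<in> carrier G" for g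
    using inj that by (metis f.G.one_closed f.hom_one inj_onD)
  have mem: "f g \<in> f ` derived G (carrier G) \<longleftrightarrow> g \<in> derived G (carrier G)" if "g \<in> carrier G" for g
    using inj that DG by (simp add: inj_on_image_mem_iff)
  show "(\<forall>g\<in>carrier G. g [^]\<^bsub>G\<^esub> N = \<one>\<^bsub>G\<^esub>) \<longleftrightarrow> (\<forall>g\<in>carrier G'. g [^]\<^bsub>G'\<^esub> N = \<one>\<^bsub>G'\<^esub>)"
    unfolding im using pow one by simp
  show "(\<forall>g\<in>carrier G. g [^]\<^bsub>G\<^esub> N \<in> derived G (carrier G)) \<longleftrightarrow>
      (\<forall>g\<in>carrier G'. g [^]\<^bsub>G'\<^esub> N \<in> derived G' (carrier G'))"
    unfolding D unfolding im using pow mem by simp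
qed

lemma model_std:
  assumes p: "Factorial_Ring.prime p" and t: "(m, n, l, k) \<in> metacyclic_types x"
  shows "std_metacyclic (metacyclic_model p m n l k) p m n l k (prod_encode (1, 0)) (prod_encode (0, 1))"
proof -
  have c: "2 \<le> k" "1 \<le> n" "1 \<le> m" "1 \<le> l" "l \<le> m" "min k m \<le> l" "m \<le> l + k" "m \<le> n + k"
    using t unfolding metacyclic_types_def by auto
  interpret metacyclic "metacyclic_model p m n l k" p m n l k "prod_encode (1, 0)" "prod_encode (0, 1)"
    using model_metacyclic[OF p c(1,3,2,7,8)] .
  show ?thesis by unfold_locales (use c in auto)
qed

text \<open>\<open>m - k\<close> vanishes only for abelian types. For nonsplit types the two maxima
  are \<open>n + m - l\<close> and \<open>n\<close>; for split nonabelian ones they are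
  \<open>max m n\<close> and \<open>max k n\<close>. With \<open>m + n = x\<close> fixed, every
  combination of cases is linear arithmetic.\<close>

lemma metacyclic_types_invariants:
  assumes "(m, n, l, k) \<in> metacyclic_types x" "(m', n', l', k') \<in> metacyclic_types x"
    and "m - k = m' - k'" and "max m (n + m - l) = max m' (n' + m' - l')"
    and "max (min k m) n = max (min k' m') n'"
  shows "(m, n, l, k) = (m', n', l', k')"
proof -
  have a: "m + n = x \<and> 1 \<le> n" "m' + n' = x \<and> 1 \<le> n'"
    and t: "l = m \<and> k = m + 1 \<and> n \<le> m \<or> l = m \<and> 2 \<le> k \<and> k < m \<and> m \<le> n + k \<or>
      2 \<le> k \<and> k < l \<and> l < m \<and> l < n \<and> m \<le> l + k"
    and t': "l' = m' \<and> k' = m' + 1 \<and> n' \<le> m' \<or> l' = m' \<and> 2 \<le> k' \<and> k' < m' \<and> m' \<le> n' + k' \<or>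
      2 \<le> k' \<and> k' < l' \<and> l' < m' \<and> l' < n' \<and> m' \<le> l' + k'"
    using assms(1,2) unfolding metacyclic_types_def mem_Collect_eq prod.case by blast+
  have "m = m' \<and> n = n' \<and> l = l' \<and> k = k'"
    using t t'
    by (elim disjE conjE; insert a assms(3-5); simp add: max_def min_def split: if_splits; linarith?)
  then show ?thesis by simp
qed

lemma model_iso_unique:
  assumes p: "Factorial_Ring.prime p"
    and t: "(m, n, l, k) \<in> metacyclic_types x" "(m', n', l', k') \<in> metacyclic_types x"
    and iso: "metacyclic_model p m n l k \<cong> metacyclic_model p m' n' l' k'"
  shows "(m, n, l, k) = (m', n', l', k')"
proof -
  let ?G = "metacyclic_model p m n l k" and ?G' = "metacyclic_model p m' n' l' k'"
  interpret G: std_metacyclic ?G p m n l k "prod_encode (1, 0)" "prod_encode (0, 1)"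
    by (rule model_std[OF p t(1)])
  interpret G': std_metacyclic ?G' p m' n' l' k' "prod_encode (1, 0)" "prod_encode (0, 1)"
    by (rule model_std[OF p t(2)])
  obtain f where f: "f \<in> iso ?G ?G'" using iso unfolding is_iso_def by blast
  note inv = iso_invariants[OF G.group_axioms G'.group_axioms f]
  have "p ^ (m - k) = p ^ (m' - k')" using inv(1) G.card_derived G'.card_derived by simp
  then have "m - k = m' - k'" using p prime_gt_1_nat power_inject_exp by metis
  moreover have "max m (n + m - l) \<le> e \<longleftrightarrow> max m' (n' + m' - l') \<le> e" for e
    using inv(2)[of "p ^ e"] unfolding G.exponent_iff G'.exponent_iff .
  then have "max m (n + m - l) = max m' (n' + m' - l')" by (meson order.antisym order_refl)
  moreover have "max (min k m) n \<le> e \<longleftrightarrow> max (min k' m') n' \<le> e" for e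
    using inv(3)[of "p ^ e"] unfolding G.derived_exponent_iff G'.derived_exponent_iff .
  then have "max (min k m) n = max (min k' m') n'" by (meson order.antisym order_refl)
  ultimately show ?thesis by (rule metacyclic_types_invariants[OF t])
qed

text \<open>Sending a type to the class of its model is a bijection: surjective because each group
  is isomorphic to the model of one of its types, injective by the invariants.\<close>

lemma card_iso_classes:
  assumes p: "Factorial_Ring.prime p"
  shows "card (iso_classes (pn_rank2_groups p x)) = card (metacyclic_types x)"
proof -
  let ?S = "pn_rank2_groups p x"
  define M where "M = (\<lambda>(m, n, l, k). metacyclic_model p m n l k)"
  define R where "R = {(G, H). G \<in> ?S \<and> H \<in> ?S \<and> G \<cong> H}"
  have grp: "group G" if "G \<in> ?S" for G
    using that unfolding pn_rank2_groups_def powerfully_nilpotent_def powerful_def finite_p_group_def by blast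
  have MS: "M t \<in> ?S" if t: "t \<in> metacyclic_types x" for t
  proof -
    obtain m n l k where mnlk: "t = (m, n, l, k)" by (cases t) auto
    interpret G: std_metacyclic "metacyclic_model p m n l k" p m n l k "prod_encode (1, 0)" "prod_encode (0, 1)"
      using model_std[OF p] t unfolding mnlk by blast
    have "m + n = x" using t unfolding mnlk metacyclic_types_def by simp
    then show ?thesis unfolding mnlk M_def pn_rank2_groups_def
      using G.powerfully_nilpotent G.group_rank_eq G.order by simp
  qed
  have cover: "\<exists>t\<in>metacyclic_types x. M t \<cong> G" if G: "G \<in> ?S" for G
  proof -
    interpret group G by (rule grp[OF G])
    obtain m n l k a b where t: "(m, n, l, k) \<in> metacyclic_types x" and "metacyclic G p m n l k a b"
      using pn_rank2_type[of p x] G unfolding pn_rank2_groups_def by blast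
    then interpret metacyclic G p m n l k a b by simp
    show ?thesis using model_iso t unfolding M_def by (intro bexI[of _ "(m, n, l, k)"]) auto
  qed
  have equiv: "equiv ?S R"
  proof (rule equivI)
    show "refl_on ?S R" unfolding refl_on_def R_def using iso_refl by auto
    show "sym R" unfolding sym_def R_def using group.iso_sym[OF grp] by blast
    show "trans R" unfolding trans_def R_def using iso_trans by blast
  qed (auto simp: R_def)
  have "?S // R = (\<lambda>t. R `` {M t}) ` metacyclic_types x"
  proof
    show "(\<lambda>t. R `` {M t}) ` metacyclic_types x \<subseteq> ?S // R" using MS by (auto intro: quotientI)
    show "?S // R \<subseteq> (\<lambda>t. R `` {M t}) ` metacyclic_types x"
    proof
      fix cl assume "cl \<in> ?S // R"
      then obtain G where G: "G \<in> ?S" "cl = R `` {G}" by (rule quotientE)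
      obtain t where t: "t \<in> metacyclic_types x" "M t \<cong> G" using cover[OF G(1)] by blast
      then have "(M t, G) \<in> R" using MS G unfolding R_def by blast
      then have "cl = R `` {M t}" unfolding G(2) using equiv_class_eq[OF equiv] by blast
      then show "cl \<in> (\<lambda>t. R `` {M t}) ` metacyclic_types x" using t by blast
    qed
  qed
  moreover have "inj_on (\<lambda>t. R `` {M t}) (metacyclic_types x)"
  proof (rule inj_onI)
    fix t t' assume t: "t \<in> metacyclic_types x" "t' \<in> metacyclic_types x" and e: "R `` {M t} = R `` {M t'}"
    then have "(M t, M t') \<in> R" using eq_equiv_class[OF e equiv] MS by blast
    then have "M t \<cong> M t'" unfolding R_def by blast
    then show "t = t'" using t model_iso_unique[OF p] unfolding M_def by (cases t; cases t') auto
  qed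
  ultimately show ?thesis unfolding iso_classes_def R_def[symmetric] by (simp add: card_image)
qed

theorem proposition2p2:
  fixes p x :: nat
  assumes "Factorial_Ring.prime p" and "x \<ge> 4"
  shows
   "(x mod 6 = 0 \<longrightarrow> real (card (iso_classes (pn_rank2_groups p x)))
        = (real x ^ 3 + 12 * real x ^ 2 - 60 * real x + 216) / 72) \<and>
    (x mod 6 = 1 \<longrightarrow> real (card (iso_classes (pn_rank2_groups p x)))
        = (real x ^ 3 + 12 * real x ^ 2 - 69 * real x + 200) / 72) \<and>
    (x mod 6 = 2 \<longrightarrow> real (card (iso_classes (pn_rank2_groups p x)))
        = (real x ^ 3 + 12 * real x ^ 2 - 60 * real x + 208) / 72) \<and>
    (x mod 6 = 3 \<longrightarrow> real (card (iso_classes (pn_rank2_groups p x)))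
        = (real x ^ 3 + 12 * real x ^ 2 - 69 * real x + 216) / 72) \<and>
    (x mod 6 = 4 \<longrightarrow> real (card (iso_classes (pn_rank2_groups p x)))
        = (real x ^ 3 + 12 * real x ^ 2 - 60 * real x + 200) / 72) \<and>
    (x mod 6 = 5 \<longrightarrow> real (card (iso_classes (pn_rank2_groups p x)))
        = (real x ^ 3 + 12 * real x ^ 2 - 69 * real x + 208) / 72)"
proof -
  define C where "C = card (iso_classes (pn_rank2_groups p x))"
  have C: "int C = 2 + int (split_sum (x - 2)) + int (nonsplit_sum x)"
    unfolding C_def card_iso_classes[OF assms(1)] card_metacyclic_types[OF assms(2)] by simp
  define j where "j = x div 6"
  have conv: "real C = (real x ^ 3 + 12 * real x ^ 2 - real_of_int r * real x + real_of_int s) / 72"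
    if "72 * int C = int x ^ 3 + 12 * int x ^ 2 - r * int x + s" for r s
  proof -
    have "real_of_int (72 * int C) = real_of_int (int x ^ 3 + 12 * int x ^ 2 - r * int x + s)" using that by simp
    then show ?thesis by (simp add: field_simps)
  qed
  have even: "4 * int (split_sum (x - 2)) = (int x - 2) ^ 2" if ev: "even x"
  proof -
    obtain c where "x = 2 * c" using ev by blast
    then have "x - 2 = 2 * (c - 1)" "int x - 2 = 2 * int (c - 1)" using assms(2) by auto
    then show ?thesis using split_sum_even[of "c - 1"] by (simp add: power2_eq_square)
  qed
  have odd: "4 * int (split_sum (x - 2)) = (int x - 2) ^ 2 - 1" if od: "odd x"
  proof -
    obtain c where "x = 2 * c + 1" using od by (elim oddE)
    then have "x - 2 = 2 * (c - 1) + 1" "int x - 2 = 2 * int (c - 1) + 1" using assms(2) by auto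
    then show ?thesis using split_sum_odd[of "c - 1"] by (simp add: power2_eq_square algebra_simps)
  qed
  \<comment> \<open>With \<open>z = x - 2\<close>, for even \<open>x\<close> the total is
    \<open>72 C = 144 + 18 z^2 + 72 * nonsplit_sum x\<close>; for odd \<open>x\<close> it is 18
    less. Each residue class is then a polynomial identity.\<close>
  have e0: "72 * int C = int x ^ 3 + 12 * int x ^ 2 - 60 * int x + 216" if "x mod 6 = 0"
  proof -
    have x: "x = 6 * j" using that unfolding j_def by presburger
    then have "int x = 6 * int j" "even x" by simp_all
    then show ?thesis using C even nonsplit_sum_eval(1)[of j] unfolding x[symmetric]
      by (simp add: power2_eq_square power3_eq_cube algebra_simps)
  qed
  have e1: "72 * int C = int x ^ 3 + 12 * int x ^ 2 - 69 * int x + 200" if "x mod 6 = 1"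
  proof -
    have x: "x = 6 * j + 1" using that unfolding j_def by presburger
    then have "int x = 6 * int j + 1" "odd x" by simp_all
    then show ?thesis using C odd nonsplit_sum_eval(2)[of j] unfolding x[symmetric]
      by (simp add: power2_eq_square power3_eq_cube algebra_simps)
  qed
  have e2: "72 * int C = int x ^ 3 + 12 * int x ^ 2 - 60 * int x + 208" if "x mod 6 = 2"
  proof -
    have x: "x = 6 * j + 2" using that unfolding j_def by presburger
    then have "int x = 6 * int j + 2" "even x" by simp_all
    then show ?thesis using C even nonsplit_sum_eval(3)[of j] unfolding x[symmetric]
      by (simp add: power2_eq_square power3_eq_cube algebra_simps)
  qed
  have e3: "72 * int C = int x ^ 3 + 12 * int x ^ 2 - 69 * int x + 216" if "x mod 6 = 3"
  proof -
    have x: "x = 6 * j + 3" using that unfolding j_def by presburger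
    then have "int x = 6 * int j + 3" "odd x" by simp_all
    then show ?thesis using C odd nonsplit_sum_eval(4)[of j] unfolding x[symmetric]
      by (simp add: power2_eq_square power3_eq_cube algebra_simps)
  qed
  have e4: "72 * int C = int x ^ 3 + 12 * int x ^ 2 - 60 * int x + 200" if "x mod 6 = 4"
  proof -
    have x: "x = 6 * j + 4" using that unfolding j_def by presburger
    then have "int x = 6 * int j + 4" "even x" by simp_all
    then show ?thesis using C even nonsplit_sum_eval(5)[of j] unfolding x[symmetric]
      by (simp add: power2_eq_square power3_eq_cube algebra_simps)
  qed
  have e5: "72 * int C = int x ^ 3 + 12 * int x ^ 2 - 69 * int x + 208" if "x mod 6 = 5"
  proof -
    have x: "x = 6 * j + 5" using that unfolding j_def by presburger
    then have "int x = 6 * int j + 5" "odd x" by simp_all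
    then show ?thesis using C odd nonsplit_sum_eval(6)[of j] unfolding x[symmetric]
      by (simp add: power2_eq_square power3_eq_cube algebra_simps)
  qed
  show ?thesis unfolding C_def[symmetric]
    using conv[OF e0] conv[OF e1] conv[OF e2] conv[OF e3] conv[OF e4] conv[OF e5] by simp
qed

end
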